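(* There is an algorithm that, given a finite linearly ordered alphabet $\Sigma$ with $k=|\Sigma|$ symbols, a length $n$, and an integer $z$ between $1$ and the number of bracelets of length $n$ over $\Sigma$, computes the (representative of the) $z$-th bracelet of length $n$ over $\Sigma$ in $O(n^5\cdot k^2\cdot\log(k))$ time.
   Context: $\Sigma$ is a finite linearly ordered alphabet, $k=|\Sigma|$, and words of length $n$ are compared lexicographically. A bracelet of length $n$ is an equivalence class of words in $\Sigma^n$ under rotations $w_1\cdots w_n\mapsto w_{r+1}\cdots w_nw_1\cdots w_r$ and reversal $w_1\cdots w_n\mapsto w_n\cdots w_1$; its representative is the lexicographically smallest word in the class, and bracelets are ordered by their representatives. The $z$-th bracelet is the bracelet for which exactly $z-1$ bracelets of length $n$ over $\Sigma$ are smaller. Time is the number of elementary operations (symbol comparisons, integer arithmetic operations and array accesses, each at unit cost). *)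

theory Defs
  imports Complex_Main "HOL-Library.List_Lexorder"
begin

section \<open>Bracelets\<close>

text \<open>Words are compared with the lexicographic order instance of \<^theory>\<open>HOL-Library.List_Lexorder\<close>;
  it is only used on words of equal length.\<close>

definition words :: "'a set \<Rightarrow> nat \<Rightarrow> 'a list set" where
  "words \<Sigma> n = {w. length w = n \<and> set w \<subseteq> \<Sigma>}"

inductive bracelet_equiv :: "'a list \<Rightarrow> 'a list \<Rightarrow> bool" where
  refl: "bracelet_equiv u u"
| rotation: "bracelet_equiv u v \<Longrightarrow> bracelet_equiv u (rotate r v)"
| reversal: "bracelet_equiv u v \<Longrightarrow> bracelet_equiv u (rev v)"

definition bracelet_rel :: "'a set \<Rightarrow> nat \<Rightarrow> 'a list rel" where
  "bracelet_rel \<Sigma> n = {(u, v). u \<in> words \<Sigma> n \<and> v \<in> words \<Sigma> n \<and> bracelet_equiv u v}"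

definition bracelets :: "'a set \<Rightarrow> nat \<Rightarrow> 'a list set set" where
  "bracelets \<Sigma> n = words \<Sigma> n // bracelet_rel \<Sigma> n"

definition representative :: "'a::linorder list set \<Rightarrow> 'a list" where
  "representative b = Min b"

definition is_zth_bracelet :: "'a::linorder set \<Rightarrow> nat \<Rightarrow> nat \<Rightarrow> 'a list set \<Rightarrow> bool" where
  "is_zth_bracelet \<Sigma> n z b \<longleftrightarrow> b \<in> bracelets \<Sigma> n \<and>
     int (card {b' \<in> bracelets \<Sigma> n. representative b' < representative b}) = int z - 1"

lemma finite_words: "finite \<Sigma> \<Longrightarrow> finite (words \<Sigma> n)"
  using finite_lists_length_eq[of \<Sigma> n] by (simp add: words_def conj_commute)

lemma bracelet_equiv_trans:
  assumes "bracelet_equiv v w" and "bracelet_equiv u v"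
  shows "bracelet_equiv u w"
  using assms by (induction rule: bracelet_equiv.induct) (auto intro: bracelet_equiv.intros)

lemma rotate_back: "\<exists>s. rotate s (rotate r v) = v"
proof (cases "v = []")
  case False
  then have "(length v - r mod length v + r) mod length v = 0"
    by (metis add.commute le_add_diff_inverse less_imp_le_nat mod_add_left_eq mod_less_divisor
        mod_self length_greater_0_conv)
  then have "rotate (length v - r mod length v) (rotate r v) = v"
    by (metis rotate_rotate rotate_id)
  then show ?thesis ..
qed simp

lemma bracelet_equiv_sym: "bracelet_equiv u v \<Longrightarrow> bracelet_equiv v u"
proof (induction rule: bracelet_equiv.induct)
  case (rotation u v r)
  obtain s where "rotate s (rotate r v) = v"
    using rotate_back by blast
  then have "bracelet_equiv (rotate r v) v"
    by (metis bracelet_equiv.refl bracelet_equiv.rotation)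
  then show ?case
    using rotation.IH bracelet_equiv_trans by blast
next
  case (reversal u v)
  have "bracelet_equiv (rev v) v"
    by (metis bracelet_equiv.refl bracelet_equiv.reversal rev_rev_ident)
  then show ?case
    using reversal.IH bracelet_equiv_trans by blast
qed (rule bracelet_equiv.refl)

lemma equiv_bracelet_rel: "equiv (words \<Sigma> n) (bracelet_rel \<Sigma> n)"
  by (auto simp: equiv_def refl_on_def sym_def trans_def bracelet_rel_def
      intro: bracelet_equiv.refl bracelet_equiv_sym bracelet_equiv_trans)

lemma finite_bracelets: "finite \<Sigma> \<Longrightarrow> finite (bracelets \<Sigma> n)"
  unfolding bracelets_def
  by (rule finite_quotient[OF finite_words]) (auto simp: bracelet_rel_def)

lemma representative_in:
  assumes "finite \<Sigma>" and "b \<in> bracelets \<Sigma> n"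
  shows "representative b \<in> b"
proof -
  have "b \<subseteq> words \<Sigma> n"
    using assms(2) by (auto simp: bracelets_def quotient_def bracelet_rel_def)
  then have "finite b"
    using finite_words[OF assms(1)] finite_subset by blast
  moreover have "b \<noteq> {}"
    using assms(2) equiv_bracelet_rel in_quotient_imp_non_empty unfolding bracelets_def by blast
  ultimately show ?thesis
    by (simp add: representative_def)
qed

lemma inj_on_representative:
  assumes "finite \<Sigma>"
  shows "inj_on representative (bracelets \<Sigma> n)"
proof (rule inj_onI)
  fix b c
  assume b: "b \<in> bracelets \<Sigma> n" and c: "c \<in> bracelets \<Sigma> n"
    and eq: "representative b = representative c"
  have "representative b \<in> b \<inter> c"
    using representative_in[OF assms b] representative_in[OF assms c] eq by simp
  then show "b = c"
    using quotient_disj[OF equiv_bracelet_rel] b c unfolding bracelets_def by blast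
qed

lemma ex1_card_less:
  fixes A :: "'b::linorder set"
  assumes "finite A" and "m < card A"
  shows "\<exists>!a. a \<in> A \<and> card {x \<in> A. x < a} = m"
proof -
  have less: "card {x \<in> A. x < a} < card {x \<in> A. x < a'}" if "a \<in> A" "a < a'" for a a'
    by (rule psubset_card_mono) (use assms(1) that in auto)
  have inj: "inj_on (\<lambda>a. card {x \<in> A. x < a}) A"
  proof (rule inj_onI)
    fix a a'
    assume "a \<in> A" "a' \<in> A" and "card {x \<in> A. x < a} = card {x \<in> A. x < a'}"
    then show "a = a'"
      using less[of a a'] less[of a' a] by (cases a a' rule: linorder_cases) simp_all
  qed
  have "card {x \<in> A. x < a} < card A" if "a \<in> A" for a
    by (rule psubset_card_mono) (use assms(1) that in auto)
  then have "(\<lambda>a. card {x \<in> A. x < a}) ` A \<subseteq> {..<card A}"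
    by auto
  then have "(\<lambda>a. card {x \<in> A. x < a}) ` A = {..<card A}"
    by (intro card_subset_eq) (simp_all add: card_image[OF inj])
  then have "m \<in> (\<lambda>a. card {x \<in> A. x < a}) ` A"
    using assms(2) by simp
  then obtain a where a: "a \<in> A" "card {x \<in> A. x < a} = m"
    by (auto elim!: imageE)
  show ?thesis
  proof (rule ex1I[of _ a])
    fix a'
    assume "a' \<in> A \<and> card {x \<in> A. x < a'} = m"
    then show "a' = a"
      using inj_onD[OF inj, of a' a] a by simp
  qed (use a in simp)
qed

lemma ex1_zth_bracelet:
  fixes \<Sigma> :: "'a::linorder set"
  assumes fin: "finite \<Sigma>" and "1 \<le> z" and "z \<le> card (bracelets \<Sigma> n)"
  shows "\<exists>!b. is_zth_bracelet \<Sigma> n z b"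
proof -
  let ?B = "bracelets \<Sigma> n" and ?R = "representative ` bracelets \<Sigma> n"
  note inj = inj_on_representative[OF fin, of n]
  have card_eq: "card {x \<in> ?R. x < y} = card {b' \<in> ?B. representative b' < y}" for y
  proof -
    have "{x \<in> ?R. x < y} = representative ` {b' \<in> ?B. representative b' < y}"
      by auto
    then show ?thesis
      by (simp add: card_image[OF inj_on_subset[OF inj]])
  qed
  have "z - 1 < card ?R"
    using assms by (simp add: card_image[OF inj])
  then have "\<exists>!a. a \<in> ?R \<and> card {x \<in> ?R. x < a} = z - 1"
    by (intro ex1_card_less) (simp_all add: finite_bracelets[OF fin])
  then obtain b where b: "b \<in> ?B" "card {x \<in> ?R. x < representative b} = z - 1"
    and uniq: "\<And>y. y \<in> ?R \<Longrightarrow> card {x \<in> ?R. x < y} = z - 1 \<Longrightarrow> y = representative b"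
    by (elim ex1E) blast
  have "\<exists>!b. b \<in> ?B \<and> card {b' \<in> ?B. representative b' < representative b} = z - 1"
  proof (rule ex1I[of _ b])
    fix c
    assume c: "c \<in> ?B \<and> card {b' \<in> ?B. representative b' < representative c} = z - 1"
    then have "representative c = representative b"
      by (intro uniq) (simp_all only: card_eq imageI)
    then show "c = b"
      using inj_onD[OF inj] c b(1) by blast
  qed (use b card_eq in simp)
  moreover have "is_zth_bracelet \<Sigma> n z b \<longleftrightarrow>
      b \<in> ?B \<and> card {b' \<in> ?B. representative b' < representative b} = z - 1" for b
    using assms(2) by (auto simp: is_zth_bracelet_def)
  ultimately show ?thesis
    by simp
qed

section \<open>Algorithms and their running time\<close>

text \<open>An algorithm is a program of a While language over unbounded integers with integer variables
  and integer arrays, so that one program has to serve all inputs. Symbols are integers,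
  hence symbol comparisons are integer comparisons. Every operation of the machine costs one unit,
  including constants, variable accesses and control steps.\<close>

datatype aop = Plus | Minus | Times | Div | Mod

datatype aexp =
    Const int
  | Var string
  | Read string aexp
  | Op aop aexp aexp

datatype bexp =
    Less aexp aexp
  | Equal aexp aexp
  | Not bexp
  | And bexp bexp

datatype com =
    Skip
  | Assign string aexp
  | Write string aexp aexp
  | Seq com com
  | If bexp com com
  | While bexp com

record state =
  vars :: "string \<Rightarrow> int"
  arrs :: "string \<Rightarrow> int \<Rightarrow> int"

fun aop_val :: "aop \<Rightarrow> int \<Rightarrow> int \<Rightarrow> int" where
  "aop_val Plus x y = x + y"
| "aop_val Minus x y = x - y"
| "aop_val Times x y = x * y"
| "aop_val Div x y = x div y"
| "aop_val Mod x y = x mod y"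

fun aval :: "aexp \<Rightarrow> state \<Rightarrow> int" where
  "aval (Const c) s = c"
| "aval (Var x) s = vars s x"
| "aval (Read a e) s = arrs s a (aval e s)"
| "aval (Op f e1 e2) s = aop_val f (aval e1 s) (aval e2 s)"

fun bval :: "bexp \<Rightarrow> state \<Rightarrow> bool" where
  "bval (Less e1 e2) s \<longleftrightarrow> aval e1 s < aval e2 s"
| "bval (Equal e1 e2) s \<longleftrightarrow> aval e1 s = aval e2 s"
| "bval (Not b) s \<longleftrightarrow> \<not> bval b s"
| "bval (And b1 b2) s \<longleftrightarrow> bval b1 s \<and> bval b2 s"

fun acost :: "aexp \<Rightarrow> nat" where
  "acost (Const c) = 1"
| "acost (Var x) = 1"
| "acost (Read a e) = acost e + 1"
| "acost (Op f e1 e2) = acost e1 + acost e2 + 1"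

fun bcost :: "bexp \<Rightarrow> nat" where
  "bcost (Less e1 e2) = acost e1 + acost e2 + 1"
| "bcost (Equal e1 e2) = acost e1 + acost e2 + 1"
| "bcost (Not b) = bcost b + 1"
| "bcost (And b1 b2) = bcost b1 + bcost b2 + 1"

text \<open>\<open>exec c s t s'\<close>: started in state \<open>s\<close>, program \<open>c\<close> terminates in state \<open>s'\<close> at total cost \<open>t\<close>.\<close>

inductive exec :: "com \<Rightarrow> state \<Rightarrow> nat \<Rightarrow> state \<Rightarrow> bool" where
  Skip: "exec Skip s 1 s"
| Assign: "exec (Assign x e) s (acost e + 1) (s\<lparr>vars := (vars s)(x := aval e s)\<rparr>)"
| Write: "exec (Write a i e) s (acost i + acost e + 1)
    (s\<lparr>arrs := (arrs s)(a := (arrs s a)(aval i s := aval e s))\<rparr>)"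
| Seq: "exec c1 s t1 s1 \<Longrightarrow> exec c2 s1 t2 s2 \<Longrightarrow> exec (Seq c1 c2) s (t1 + t2) s2"
| IfTrue: "bval b s \<Longrightarrow> exec c1 s t s' \<Longrightarrow> exec (If b c1 c2) s (bcost b + t + 1) s'"
| IfFalse: "\<not> bval b s \<Longrightarrow> exec c2 s t s' \<Longrightarrow> exec (If b c1 c2) s (bcost b + t + 1) s'"
| WhileFalse: "\<not> bval b s \<Longrightarrow> exec (While b c) s (bcost b + 1) s"
| WhileTrue: "bval b s \<Longrightarrow> exec c s t1 s1 \<Longrightarrow> exec (While b c) s1 t2 s2 \<Longrightarrow>
    exec (While b c) s (bcost b + t1 + t2 + 1) s2"

inductive_cases exec_elims:
  "exec Skip s t s'" "exec (Assign x e) s t s'" "exec (Write a i e) s t s'"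
  "exec (Seq c1 c2) s t s'" "exec (If b c1 c2) s t s'"

inductive_cases exec_WhileE: "exec (While b c) s t s'"

lemma exec_deterministic: "exec c s t s' \<Longrightarrow> exec c s u r \<Longrightarrow> u = t \<and> r = s'"
proof (induction arbitrary: u r rule: exec.induct)
  case (Seq c1 s t1 s1 c2 t2 s2)
  from Seq.prems obtain v1 r1 v2 where "u = v1 + v2" "exec c1 s v1 r1" "exec c2 r1 v2 r"
    by (rule exec_elims)
  then show ?case
    using Seq.IH(1)[of v1 r1] Seq.IH(2)[of v2 r] by simp
next
  case (IfTrue b s c1 t s' c2)
  from IfTrue.prems IfTrue.hyps(1) obtain v where "u = bcost b + v + 1" "exec c1 s v r"
    by (auto elim: exec_elims(5))
  then show ?case
    using IfTrue.IH[of v r] by simp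
next
  case (IfFalse b s c2 t s' c1)
  from IfFalse.prems IfFalse.hyps(1) obtain v where "u = bcost b + v + 1" "exec c2 s v r"
    by (auto elim: exec_elims(5))
  then show ?case
    using IfFalse.IH[of v r] by simp
next
  case (WhileFalse b s c)
  then show ?case
    by (auto elim: exec_WhileE)
next
  case (WhileTrue b s c t1 s1 t2 s2)
  from WhileTrue.prems obtain v1 r1 v2
    where "u = bcost b + v1 + v2 + 1" "exec c s v1 r1" "exec (While b c) r1 v2 r"
    by (rule exec_WhileE) (use WhileTrue.hyps(1) in auto)
  then show ?case
    using WhileTrue.IH(1)[of v1 r1] WhileTrue.IH(2)[of v2 r] by simp
qed (auto elim: exec_elims)

text \<open>A finite linearly ordered alphabet is a finite set of integers, handed over as its increasing
  enumeration in positions \<open>0, \<dots>, k - 1\<close> of an array. Everything else is initially 0.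
  The output word is read off positions \<open>0, \<dots>, n - 1\<close> of an array.\<close>

definition input_state :: "int set \<Rightarrow> nat \<Rightarrow> nat \<Rightarrow> state" where
  "input_state \<Sigma> n z = \<lparr>
     vars = (\<lambda>_. 0)(''k'' := int (card \<Sigma>), ''n'' := int n, ''z'' := int z),
     arrs = (\<lambda>_ _. 0)(''alphabet'' := (\<lambda>i. if 0 \<le> i \<and> i < int (card \<Sigma>)
                                           then sorted_list_of_set \<Sigma> ! nat i else 0))\<rparr>"

definition output_word :: "nat \<Rightarrow> state \<Rightarrow> int list" where
  "output_word n s = map (\<lambda>i. arrs s ''output'' (int i)) [0..<n]"

text \<open>The bound \<open>n^5 * k^2 * log k\<close>, read with \<open>1\<close> in place of \<open>log 1 = 0\<close>: for a unary alphabet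
  the literal bound is \<open>0\<close>, which no algorithm meets. For \<open>k \<ge> 2\<close> the maximum is \<open>log 2 k\<close>.\<close>

definition time_bound :: "nat \<Rightarrow> nat \<Rightarrow> real" where
  "time_bound n k = real n ^ 5 * real k ^ 2 * max 1 (log 2 (real k))"

end

(* The z-th representative is the largest word w such that at least total - z + 1 representatives
   are >= w. It is found greedily, digit by digit, so it suffices to count the representatives that
   are >= a given threshold word w.

   By the orbit counting argument for the dihedral group, 2 n times that number is the sum, over the
   2 n rotations and reflections, of the fixed words all of whose cyclic readings in both
   directions are >= w. Such words are recognised by an automaton: label every gap of the cyclic
   word by the rank of its past (read backwards) among the suffixes of w. The rank after a letter c
   depends only on c and on the rank before it, and a cyclic word has at most one consistent
   labelling with labels above the rank of w. With the ranks of the futures as a second label, the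
   words fixed by a rotation are closed walks, and the words fixed by a reflection are walks
   between the two ends of the axis. One dynamic program counts the walks from all start nodes
   simultaneously: the count for start node s is the digit at B^s of a single integer. This
   costs O(n^4 k) operations for each of O(n k) thresholds. *)

theory Submission
  imports Defs
begin

text \<open>A cyclic word has no first letter, so a condition on all its readings becomes a
  condition on closed walks, whose start and end must agree. One dynamic program per start pair
  would multiply the cost by order n^2. Packing all starts into one integer is possible because the
  recursion is linear and never mentions the start, because arithmetic on integers of any size has
  unit cost, and because the base exceeds every stored count, so that no carries occur. What remains
  is n layers, (n+1)^2 pairs of labels per layer and (n+1) k predecessors per pair.

  Ranks suffice as states because a set of suffixes that is closed downwards can be recovered from
  its size.

  The n reflections fall into two classes, given by the parity of the shift, with the same number of
  fixed words within each class. Summing over 2 n shifts instead of n treats even and odd n alike;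
  this is why the evaluated quantity is 4 n times the count instead of 2 n times. The digits are
  found by trying k - 1 increments each, so the running time is O(n^5 k^2), within the required
  bound without any use of the logarithm.\<close>

section \<open>Words as numbers and suffix ranks\<close>

text \<open>The most significant digit comes first, so that comparing numbers below
  \<open>k ^ m\<close> is comparing words of length \<open>m\<close> lexicographically.\<close>

definition num :: "nat \<Rightarrow> nat \<Rightarrow> (nat \<Rightarrow> nat) \<Rightarrow> nat" where
  "num k m f = (\<Sum>t<m. f t * k ^ (m - 1 - t))"

lemma num_0 [simp]: "num k 0 f = 0"
  by (simp add: num_def)

lemma num_Suc_last: "num k (Suc m) f = k * num k m f + f m"
proof -
  have "(\<Sum>t<m. f t * k ^ (m - t)) = (\<Sum>t<m. k * (f t * k ^ (m - 1 - t)))"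
  proof (rule sum.cong)
    fix t assume "t \<in> {..<m}"
    then have "m - t = Suc (m - 1 - t)" by auto
    then show "f t * k ^ (m - t) = k * (f t * k ^ (m - 1 - t))" by simp
  qed simp
  then show ?thesis by (simp add: num_def sum_distrib_left)
qed

lemma num_Suc_first: "num k (Suc m) f = f 0 * k ^ m + num k m (\<lambda>t. f (Suc t))"
  unfolding num_def by (subst sum.lessThan_Suc_shift) simp

lemma num_cong: "(\<And>t. t < m \<Longrightarrow> f t = g t) \<Longrightarrow> num k m f = num k m g"
  by (simp add: num_def)

lemma num_less: "(\<And>t. t < m \<Longrightarrow> f t < k) \<Longrightarrow> num k m f < k ^ m"
proof (induction m)
  case (Suc m)
  then have "num k m f + 1 \<le> k ^ m" "f m < k" by (simp_all add: Suc_leI)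
  then have "k * (num k m f + 1) \<le> k * k ^ m" by (meson mult_le_mono2)
  with \<open>f m < k\<close> show ?case by (simp add: num_Suc_last)
qed simp

lemma lex_le_iff:
  fixes a b p q M :: nat
  assumes "p < M" "q < M"
  shows "a * M + p \<le> b * M + q \<longleftrightarrow> a < b \<or> (a = b \<and> p \<le> q)"
proof -
  have 1: "a * M + p < b * M + q" if "a < b" "p < M" for a b p q :: nat
  proof -
    have "a * M + M \<le> b * M" using that(1) by (metis Suc_leI add.commute mult_Suc mult_le_mono1)
    then show ?thesis using that by simp
  qed
  show ?thesis
    using 1[of a b p q] 1[of b a q p] assms by (cases a b rule: linorder_cases) auto
qed

section \<open>Suffixes of the threshold word and their ranks\<close>

locale threshold =
  fixes n k x :: nat
  assumes n_pos: "0 < n" and k_pos: "0 < k" and x_less: "x < k ^ n"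
begin

definition dig :: "nat \<Rightarrow> nat" where
  "dig j = x div k ^ (n - 1 - j) mod k"

text \<open>The suffix of the threshold word starting at position \<open>j\<close>, padded with zeros to length \<open>n\<close>.\<close>

definition V :: "nat \<Rightarrow> nat" where
  "V j = x mod k ^ (n - j) * k ^ j"

text \<open>Written as a sum of zeros and ones, like \<open>del\<close> below, because this is the
  shape that the table programs evaluate.\<close>

definition R :: "nat \<Rightarrow> nat" where
  "R j = (\<Sum>i<n. if V i \<le> V j then 1 else 0)"

text \<open>The transition of the automaton. Prepending \<open>c\<close> to a past \<open>X\<close>
  gives something at least suffix \<open>j\<close> iff \<open>dig j < c\<close>, or
  \<open>dig j = c\<close> and \<open>X\<close> is at least suffix \<open>Suc j\<close>; the last
  comparison is read off the rank \<open>a\<close> of \<open>X\<close>.\<close>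

definition del :: "nat \<Rightarrow> nat \<Rightarrow> nat" where
  "del a c = (\<Sum>j<n. if dig j < c \<or> dig j = c \<and> R (Suc j) \<le> a then 1 else 0)"

lemma R_card: "R j = card {i. i < n \<and> V i \<le> V j}"
  by (simp add: R_def sum.If_cases Int_def lessThan_def conj_commute)

lemma del_card: "del a c = card {j. j < n \<and> (dig j < c \<or> dig j = c \<and> R (Suc j) \<le> a)}"
  by (simp add: del_def sum.If_cases Int_def lessThan_def)

lemma del_le: "del a c \<le> n"
proof -
  have "card {j. j < n \<and> (dig j < c \<or> dig j = c \<and> R (Suc j) \<le> a)} \<le> card {..<n}"
    by (intro card_mono) auto
  then show ?thesis by (simp add: del_card)
qed

lemma V_0 [simp]: "V 0 = x"
  using x_less by (simp add: V_def)

lemma V_n [simp]: "V n = 0"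
  by (simp add: V_def)

lemma V_less: "j \<le> n \<Longrightarrow> V j < k ^ n"
proof -
  assume "j \<le> n"
  have "V j < k ^ (n - j) * k ^ j"
    using k_pos by (simp add: V_def)
  with \<open>j \<le> n\<close> show ?thesis by (simp flip: power_add)
qed

lemma V_Suc_dvd: "k * (V (Suc j) div k) = V (Suc j)"
  by (simp add: V_def)

lemma V_Suc: "j < n \<Longrightarrow> V j = dig j * k ^ (n - 1) + V (Suc j) div k"
proof -
  assume "j < n"
  define m where "m = n - 1 - j"
  have m: "n - j = Suc m" "n - Suc j = m" "n - Suc 0 = m + j" using \<open>j < n\<close> by (auto simp: m_def)
  have "x mod k ^ Suc m = k ^ m * (x div k ^ m mod k) + x mod k ^ m"
    by (metis mod_mult2_eq power_Suc2)
  then show ?thesis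
    using k_pos by (simp add: V_def dig_def m m_def[symmetric] algebra_simps power_add del: power_Suc)
      (simp add: algebra_simps)
qed

lemma div_k_less: "X < k ^ n \<Longrightarrow> X div k < k ^ (n - 1)"
  using n_pos by (metis less_mult_imp_div_less power_minus_mult)

text \<open>The number on the right is \<open>X\<close> with \<open>c\<close> put in front and its
  last digit dropped. Dropping that digit is harmless: the padding makes \<open>V (Suc j)\<close> a
  multiple of \<open>k\<close>, so its comparison with \<open>X\<close> does not depend on the last
  digit of \<open>X\<close>. A window of \<open>n\<close> letters is therefore enough.\<close>

lemma V_le_shift:
  assumes "j < n" "X < k ^ n"
  shows "V j \<le> c * k ^ (n - 1) + X div k \<longleftrightarrow> dig j < c \<or> dig j = c \<and> V (Suc j) \<le> X"
proof -
  have "V (Suc j) div k \<le> X div k \<longleftrightarrow> V (Suc j) \<le> X"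
    by (metis V_Suc_dvd div_le_mono k_pos less_eq_div_iff_mult_less_eq mult.commute)
  then show ?thesis
    using assms V_less[of "Suc j"] div_k_less by (simp add: V_Suc lex_le_iff)
qed

lemma V_le_iff:
  assumes "i < n" "j < n"
  shows "V i \<le> V j \<longleftrightarrow> dig i < dig j \<or> dig i = dig j \<and> V (Suc i) \<le> V (Suc j)"
  using V_le_shift[OF assms(1), of "V (Suc j)" "dig j"] V_Suc[OF assms(2)] V_less[of "Suc j"] assms
  by simp

lemma R_mono: "V i \<le> V j \<Longrightarrow> R i \<le> R j"
  unfolding R_card by (intro card_mono) auto

text \<open>If \<open>j\<close> is outside the down-closed set \<open>C\<close>, then all of
  \<open>C\<close> lies below \<open>V j\<close>, so \<open>C\<close> together with \<open>j\<close>
  is counted by \<open>R j\<close> and \<open>card C < R j\<close>. Thus the size of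
  \<open>C\<close> alone answers every membership question.\<close>

lemma R_le_card_iff:
  assumes sub: "C \<subseteq> {..<n}" and down: "\<And>i j. j \<in> C \<Longrightarrow> i < n \<Longrightarrow> V i \<le> V j \<Longrightarrow> i \<in> C"
    and j: "j < n"
  shows "R j \<le> card C \<longleftrightarrow> j \<in> C"
proof
  have fin: "finite C" using sub finite_subset by blast
  {
    assume "j \<in> C"
    then have "{i. i < n \<and> V i \<le> V j} \<subseteq> C" using down by auto
    then show "R j \<le> card C" unfolding R_card by (rule card_mono[OF fin])
  next
    assume le: "R j \<le> card C"
    show "j \<in> C"
    proof (rule ccontr)
      assume nj: "j \<notin> C"
      have "V i \<le> V j" if "i \<in> C" for i
        using down[OF that j] nj by (meson linorder_linear)
      then have "C \<subset> {i. i < n \<and> V i \<le> V j}" using sub nj j by auto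
      then have "card C < R j" unfolding R_card by (intro psubset_card_mono) auto
      with le show False by simp
    qed
  }
qed

text \<open>The set counted by \<open>del a c\<close> is down-closed for every number
  \<open>a\<close>, also when \<open>a\<close> is not known to be a rank.
  \<open>labelling_unique\<close> depends on this, since its labels are arbitrary.\<close>

lemma R_le_del_iff:
  assumes "j < n"
  shows "R j \<le> del a c \<longleftrightarrow> dig j < c \<or> dig j = c \<and> R (Suc j) \<le> a"
proof -
  have "R j \<le> card {j. j < n \<and> (dig j < c \<or> dig j = c \<and> R (Suc j) \<le> a)} \<longleftrightarrow>
      j \<in> {j. j < n \<and> (dig j < c \<or> dig j = c \<and> R (Suc j) \<le> a)}"
  proof (rule R_le_card_iff[OF _ _ assms])
    fix i j assume j: "j \<in> {j. j < n \<and> (dig j < c \<or> dig j = c \<and> R (Suc j) \<le> a)}"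
      and i: "i < n" "V i \<le> V j"
    then have "dig i < dig j \<or> dig i = dig j \<and> R (Suc i) \<le> R (Suc j)"
      using V_le_iff[of i j] R_mono by auto
    with i j show "i \<in> {j. j < n \<and> (dig j < c \<or> dig j = c \<and> R (Suc j) \<le> a)}" by auto
  qed auto
  then show ?thesis using assms by (simp add: del_card)
qed

section \<open>Ranks of pasts in a bi-infinite word\<close>

definition rk :: "nat \<Rightarrow> nat" where
  "rk X = card {j. j < n \<and> V j \<le> X}"

lemma rk_le: "rk X \<le> n"
proof -
  have "rk X \<le> card {..<n}" unfolding rk_def by (intro card_mono) auto
  then show ?thesis by simp
qed

text \<open>The assumption \<open>x \<le> X\<close> covers \<open>j = n\<close>: the empty suffix
  lies below everything, and its rank satisfies \<open>R n \<le> R 0 \<le> rk X\<close>.\<close>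

lemma R_le_rk_iff:
  assumes "j \<le> n" "x \<le> X"
  shows "R j \<le> rk X \<longleftrightarrow> V j \<le> X"
proof -
  have *: "R j \<le> rk X \<longleftrightarrow> V j \<le> X" if "j < n" for j
    unfolding rk_def using R_le_card_iff[of "{j. j < n \<and> V j \<le> X}" j] that by auto
  show ?thesis
  proof (cases "j = n")
    case True
    have "R n \<le> R 0" by (rule R_mono) simp
    also have "R 0 \<le> rk X" using *[of 0] assms(2) n_pos by simp
    finally show ?thesis using True by simp
  qed (use * assms in auto)
qed

text \<open>Gap \<open>i\<close> lies between the letters \<open>i - 1\<close> and \<open>i\<close>.
  Reading backwards makes the newest letter the most significant one, so that moving one gap to the
  right prepends a letter (\<open>past_Suc\<close>).\<close>

definition past :: "(int \<Rightarrow> nat) \<Rightarrow> int \<Rightarrow> nat" where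
  "past q i = num k n (\<lambda>t. q (i - 1 - int t))"

lemma past_less: "(\<And>i. q i < k) \<Longrightarrow> past q i < k ^ n"
  unfolding past_def by (rule num_less) simp

lemma past_Suc:
  assumes "\<And>i. q i < k"
  shows "past q (i + 1) = q i * k ^ (n - 1) + past q i div k"
proof -
  have last: "num k n f = k * num k (n - 1) f + f (n - 1)"
    and first: "num k n f = f 0 * k ^ (n - 1) + num k (n - 1) (\<lambda>t. f (Suc t))" for f
    using num_Suc_last[of k "n - 1" f] num_Suc_first[of k "n - 1" f] n_pos by simp_all
  have "past q i div k = num k (n - 1) (\<lambda>t. q (i - 1 - int t))"
    using assms k_pos by (simp add: past_def last)
  moreover have "past q (i + 1) = q i * k ^ (n - 1) + num k (n - 1) (\<lambda>t. q (i - 1 - int t))"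
    by (simp add: past_def first algebra_simps)
  ultimately show ?thesis by simp
qed

lemma rk_past_Suc:
  assumes q: "\<And>i. q i < k" and le: "x \<le> past q i"
  shows "rk (past q (i + 1)) = del (rk (past q i)) (q i)"
proof -
  have "V j \<le> past q (i + 1) \<longleftrightarrow> dig j < q i \<or> dig j = q i \<and> R (Suc j) \<le> rk (past q i)" if "j < n" for j
    using V_le_shift[OF that past_less[of q, OF q]] R_le_rk_iff[OF _ le, of "Suc j"] that
    by (simp add: past_Suc[of q, OF q])
  then show ?thesis unfolding rk_def[of "past q (i + 1)"] del_card by (metis (no_types, lifting))
qed

text \<open>A labelling of a bi-infinite word by states above the rank of the threshold is
  necessarily the labelling by the ranks of its pasts, since the comparison with a suffix
  of the threshold is decided after at most \<open>n\<close> steps.\<close>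

lemma labelling_unique:
  assumes q: "\<And>i. q i < k" and A: "\<And>i. R 0 \<le> A i" and step: "\<And>i. A (i + 1) = del (A i) (q i)"
  shows "x \<le> past q i" "A i = rk (past q i)"
proof -
  \<comment> \<open>Downward induction on \<open>j\<close> from the empty suffix
    \<open>j = n\<close>, where both sides hold because \<open>R n \<le> R 0 \<le> A i\<close>. Each
    step moves one letter along the suffix and one gap to the left, so the claim is proved for all
    \<open>i\<close> at once.\<close>
  have iff: "R j \<le> A i \<longleftrightarrow> V j \<le> past q i" if "j \<le> n" for i j
    using that
  proof (induction j arbitrary: i rule: inc_induct)
    case base
    have "R n \<le> R 0" by (rule R_mono) simp
    then show ?case using A[of i] by simp
  next
    case (step j)
    have "R j \<le> A i \<longleftrightarrow> dig j < q (i - 1) \<or> dig j = q (i - 1) \<and> R (Suc j) \<le> A (i - 1)"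
      using R_le_del_iff[OF step.hyps(2)] assms(3)[of "i - 1"] by simp
    also have "\<dots> \<longleftrightarrow> V j \<le> past q i"
      using step.IH[of "i - 1"] V_le_shift[OF step.hyps(2) past_less[of q, OF q, of "i - 1"], of "q (i - 1)"]
        past_Suc[of q, OF q, of "i - 1"] by simp
    finally show ?case .
  qed
  show *: "x \<le> past q i" for i using iff[of 0 i] A by simp
  \<comment> \<open>\<open>del\<close> sees its argument only through the comparisons with
    \<open>R (Suc j)\<close>, and these are settled by \<open>iff\<close>; one transition turns
    equal comparisons into equal labels.\<close>
  have "A i = del (A (i - 1)) (q (i - 1))" using step[of "i - 1"] by simp
  also have "\<dots> = del (rk (past q (i - 1))) (q (i - 1))"
  proof -
    have "R (Suc j) \<le> A (i - 1) \<longleftrightarrow> R (Suc j) \<le> rk (past q (i - 1))" if "j < n" for j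
      using iff[of "Suc j" "i - 1"] R_le_rk_iff[OF _ *, of "Suc j" "i - 1"] that by simp
    then show ?thesis unfolding del_card by (metis (no_types, lifting))
  qed
  also have "\<dots> = rk (past q i)" using rk_past_Suc[of q, OF q *, of "i - 1"] by simp
  finally show "A i = rk (past q i)" .
qed

end

section \<open>Counting walks\<close>

definition ext :: "nat list \<Rightarrow> int \<Rightarrow> nat" where
  "ext v i = v ! nat (i mod int (length v))"

lemma ext_in: "v \<noteq> [] \<Longrightarrow> ext v i \<in> set v"
  by (simp add: ext_def nat_less_iff)

lemma ext_periodic: "ext v (i + int (length v)) = ext v i"
  by (simp add: ext_def)

lemma ext_nth: "j < length v \<Longrightarrow> ext v (int j) = v ! j"
  by (simp add: ext_def)

text \<open>Every coefficient is below the base, so there are no carries and the coefficients are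
  the digits.\<close>

lemma digit_sum:
  fixes c :: "nat \<Rightarrow> nat"
  assumes "\<And>s. s < M \<Longrightarrow> c s < B" "t < M"
  shows "(\<Sum>s<M. c s * B ^ s) div B ^ t mod B = c t"
  using assms
proof (induction t arbitrary: c M)
  case 0
  then obtain M' where "M = Suc M'" by (cases M) auto
  then have "(\<Sum>s<M. c s * B ^ s) = c 0 + B * (\<Sum>s<M'. c (Suc s) * B ^ s)"
    by (simp only: sum.lessThan_Suc_shift) (simp add: sum_distrib_left mult.left_commute)
  then show ?case using 0 by simp
next
  case (Suc t)
  then obtain M' where M: "M = Suc M'" by (cases M) auto
  then have "(\<Sum>s<M. c s * B ^ s) = c 0 + B * (\<Sum>s<M'. c (Suc s) * B ^ s)"
    by (simp only: sum.lessThan_Suc_shift) (simp add: sum_distrib_left mult.left_commute)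
  moreover have "c 0 < B" using Suc.prems by simp
  ultimately have "(\<Sum>s<M. c s * B ^ s) div B = (\<Sum>s<M'. c (Suc s) * B ^ s)"
    by (cases "B = 0") auto
  then show ?case
    using Suc.IH[of M' "\<lambda>s. c (Suc s)"] Suc.prems M by (simp add: div_mult2_eq)
qed

section \<open>Walks of labels along a word\<close>

context threshold
begin

text \<open>This covers the readings in backward direction; those in forward direction are
  \<open>cyc (rev v)\<close>.\<close>

definition cyc :: "nat list \<Rightarrow> bool" where
  "cyc v \<longleftrightarrow> (\<forall>i. x \<le> past (ext v) i)"

text \<open>The condition \<open>R 0 \<le> a\<close> at every visited state, both ends included,
  says that each past met on the way is at least the threshold.\<close>

primrec vpath :: "nat \<Rightarrow> nat list \<Rightarrow> nat \<Rightarrow> bool" where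
  "vpath a [] b \<longleftrightarrow> a = b \<and> R 0 \<le> a"
| "vpath a (c # u) b \<longleftrightarrow> R 0 \<le> a \<and> vpath (del a c) u b"

lemma vpath_append: "vpath a (u @ v) c \<longleftrightarrow> (\<exists>b. vpath a u b \<and> vpath b v c)"
proof (induction u arbitrary: a)
  case Nil
  have "R 0 \<le> a" if "vpath a v c" using that by (cases v) auto
  then show ?case by auto
qed auto

lemma vpath_foldl: "vpath a u b \<Longrightarrow> foldl del a u = b"
  by (induction u arbitrary: a) auto

lemma vpath_ends: "vpath a u b \<Longrightarrow> R 0 \<le> a \<and> R 0 \<le> b"
  by (induction u arbitrary: a) auto

lemma vpath_le: "vpath a u b \<Longrightarrow> a \<le> n \<Longrightarrow> b \<le> n"
  by (induction u arbitrary: a) (auto simp: del_le)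

lemma vpath_take: "vpath a u b \<Longrightarrow> i \<le> length u \<Longrightarrow> R 0 \<le> foldl del a (take i u)"
proof (induction u arbitrary: a i)
  case (Cons c u)
  then show ?case by (cases i) auto
qed auto

lemma vpath_labels:
  assumes "\<And>i. i \<le> length u \<Longrightarrow> R 0 \<le> A i" "\<And>i. i < length u \<Longrightarrow> A (Suc i) = del (A i) (u ! i)"
  shows "vpath (A 0) u (A (length u))"
  using assms
proof (induction u arbitrary: A)
  case (Cons c u)
  have "vpath (A (Suc 0)) u (A (Suc (length u)))"
    using Cons.IH[of "\<lambda>i. A (Suc i)"] Cons.prems by fastforce
  moreover have "A (Suc 0) = del (A 0) c" using Cons.prems(2)[of 0] by simp
  ultimately show ?case using Cons.prems(1)[of 0] by simp
qed auto

lemma ext_less: "v \<noteq> [] \<Longrightarrow> set v \<subseteq> {..<k} \<Longrightarrow> ext v i < k"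
  using ext_in[of v i] by auto

text \<open>Running round a closed walk for ever labels all gaps of \<open>ext v\<close>, and
  \<open>labelling_unique\<close> says that this is the labelling by ranks. Conversely the ranks of
  the pasts have period \<open>length v\<close>. So counting closed walks counts words. The length
  of \<open>v\<close> need not be \<open>n\<close>: periodic words are later replaced by a
  prefix.\<close>

lemma closed_vpath_iff:
  assumes ne: "v \<noteq> []" and v: "set v \<subseteq> {..<k}"
  shows "vpath a v a \<longleftrightarrow> cyc v \<and> a = rk (past (ext v) 0)"
proof
  note q = ext_less[OF ne v]
  let ?m = "int (length v)"
  {
    assume a: "vpath a v a"
    define A where "A i = foldl del a (take (nat (i mod ?m)) v)" for i
    have R: "R 0 \<le> A i" for i
      unfolding A_def by (rule vpath_take[OF a]) (simp add: nat_le_iff ne less_imp_le)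
    have step: "A (i + 1) = del (A i) (ext v i)" for i
    proof -
      define j where "j = nat (i mod ?m)"
      have j: "i mod ?m = int j" "j < length v"
        using ne by (auto simp: j_def nat_less_iff)
      have eq: "foldl del a (take (Suc j) v) = del (A i) (ext v i)"
        using j by (simp add: take_Suc_conv_app_nth A_def ext_def)
      \<comment> \<open>After the last letter the index wraps round to 0, where the closed walk is
        back in state \<open>a\<close>.\<close>
      have "(i + 1) mod ?m = (int j + 1) mod ?m"
        using j(1) by (metis mod_add_left_eq)
      also have "\<dots> = int (Suc j mod length v)"
        by (simp add: zmod_int add.commute)
      finally have "(i + 1) mod ?m = int (Suc j mod length v)" .
      moreover have "nat (1 + int j) = Suc j" by simp
      ultimately show ?thesis
        using j(2) eq vpath_foldl[OF a] by (cases "Suc j = length v") (auto simp: A_def)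
    qed
    note * = labelling_unique[of "ext v" A, OF q R step]
    show "cyc v \<and> a = rk (past (ext v) 0)"
      using * [of 0] *(1) by (auto simp: cyc_def A_def)
  next
    assume c: "cyc v \<and> a = rk (past (ext v) 0)"
    define A where "A i = rk (past (ext v) i)" for i
    have "vpath (A (int 0)) v (A (int (length v)))"
    proof (rule vpath_labels[of v "\<lambda>i. A (int i)"])
      fix i
      show "R 0 \<le> A (int i)"
        using c R_le_rk_iff[of 0 "past (ext v) (int i)"] by (simp add: A_def cyc_def)
      assume "i < length v"
      then show "A (int (Suc i)) = del (A (int i)) (v ! i)"
        using rk_past_Suc[of "ext v", OF q, of "int i"] c
        by (simp add: A_def cyc_def ext_nth add.commute)
    qed
    moreover have "ext v (int (length v) - 1 - int t) = ext v (0 - 1 - int t)" for t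
      using ext_periodic[of v "0 - 1 - int t"] by (simp add: algebra_simps)
    then have "A (int (length v)) = A 0"
      unfolding A_def past_def by (simp cong: num_cong)
    ultimately show "vpath a v a" using c by (simp add: A_def)
  }
qed

lemma closed_vpath_unique:
  "vpath a v a \<Longrightarrow> vpath b v b \<Longrightarrow> v \<noteq> [] \<Longrightarrow> set v \<subseteq> {..<k} \<Longrightarrow> a = b"
  by (simp add: closed_vpath_iff)

lemma closed_vpath_le: "vpath a v a \<Longrightarrow> v \<noteq> [] \<Longrightarrow> set v \<subseteq> {..<k} \<Longrightarrow> a \<le> n"
  by (simp add: closed_vpath_iff rk_le)

lemma cyc_iff_ex: "v \<noteq> [] \<Longrightarrow> set v \<subseteq> {..<k} \<Longrightarrow> cyc v \<longleftrightarrow> (\<exists>a. vpath a v a)"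
  by (simp add: closed_vpath_iff)

text \<open>A pair \<open>(a, b)\<close> of states for the past and the future is coded as \<open>a * N + b\<close>.\<close>

definition N :: nat where "N = n + 1"

lemma N_pos [simp]: "0 < N" by (simp add: N_def)

lemma le_n_iff: "a \<le> n \<longleftrightarrow> a < N" by (auto simp: N_def)

lemma del_less_N: "del a c < N"
  using del_le by (simp add: le_n_iff)

lemma del_N [simp]: "del a c div N = 0" "del a c mod N = del a c"
  using del_less_N by simp_all

lemma code_less: "a < N \<Longrightarrow> b < N \<Longrightarrow> a * N + b < N * N"
proof -
  assume "a < N" "b < N"
  then have "Suc a * N \<le> N * N" by (intro mult_le_mono1) simp
  with \<open>b < N\<close> show ?thesis by simp
qed

lemma code_parts: "s < N * N \<Longrightarrow> s div N < N" "s mod N < N"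
  by (simp_all add: less_mult_imp_div_less)

lemma code_eqI: "s div N = t div N \<Longrightarrow> s mod N = t mod N \<Longrightarrow> s = t"
  by (metis div_mult_mod_eq)

section \<open>Walks on pairs of labels and their packed counts\<close>

abbreviation words_of :: "nat \<Rightarrow> nat list set" where
  "words_of l \<equiv> words {..<k} l"

lemma finite_words_of [simp]: "finite (words_of l)"
  by (simp add: finite_words)

lemma card_words_of: "card (words_of l) = k ^ l"
  using card_lists_length_eq[of "{..<k}" l] by (simp add: words_def conj_commute)

text \<open>The past label is carried along \<open>u\<close> from left to right, the future label
  along \<open>rev u\<close> from right to left. A walk is thus driven from its left end in the
  first component and from its right end in the second.\<close>

definition W :: "nat \<Rightarrow> nat \<Rightarrow> nat \<Rightarrow> nat list set" where
  "W l s t = {u \<in> words_of l. vpath (s div N) u (t div N) \<and> vpath (t mod N) (rev u) (s mod N)}"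

lemma finite_W [simp]: "finite (W l s t)"
  by (simp add: W_def)

lemma card_W_le: "card (W l s t) \<le> k ^ l"
  unfolding card_words_of[symmetric] by (rule card_mono) (auto simp: W_def)

definition valid :: "nat \<Rightarrow> bool" where
  "valid t \<longleftrightarrow> R 0 \<le> t div N \<and> R 0 \<le> t mod N"

lemma W_0: "W 0 s t = (if valid t \<and> s = t then {[]} else {})"
  by (auto simp: W_def words_def valid_def intro: code_eqI)

text \<open>Split off the last letter. The index \<open>m\<close> codes a past label
  \<open>m div k\<close> before that letter, which has to be guessed, and the letter
  \<open>m mod k\<close>; the future label before it is determined by the one after it. The cases
  are disjoint because the remaining word and \<open>s\<close> determine the guessed label.\<close>

lemma card_W_Suc:
  assumes s: "s < N * N"
  shows "card (W (Suc l) s t) =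
    (\<Sum>m<N*k. if valid t \<and> del (m div k) (m mod k) = t div N
       then card (W l s (m div k * N + del (t mod N) (m mod k))) else 0)"
proof -
  let ?ok = "\<lambda>m. valid t \<and> del (m div k) (m mod k) = t div N"
  let ?t = "\<lambda>m. m div k * N + del (t mod N) (m mod k)"
  let ?I = "{m \<in> {..<N*k}. ?ok m}"
  let ?A = "\<lambda>m. (\<lambda>u. u @ [m mod k]) ` W l s (?t m)"
  have t: "?t m div N = m div k" "?t m mod N = del (t mod N) (m mod k)" for m
    by simp_all
  have "W (Suc l) s t = (\<Union>m\<in>?I. ?A m)"
  proof (intro equalityI subsetI)
    fix w assume w: "w \<in> W (Suc l) s t"
    then obtain u c where u: "w = u @ [c]" by (cases w rule: rev_cases) (auto simp: W_def words_def)
    with w obtain a' where a': "vpath (s div N) u a'" "del a' c = t div N" "R 0 \<le> t div N"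
      "vpath (del (t mod N) c) (rev u) (s mod N)" "R 0 \<le> t mod N" "c < k" "u \<in> words_of l"
      by (auto simp: W_def words_def vpath_append)
    have "a' < N" using vpath_le[OF a'(1)] code_parts(1)[OF s] by (simp add: le_n_iff)
    define m where "m = a' * k + c"
    have m: "m div k = a'" "m mod k = c" using \<open>c < k\<close> by (auto simp: m_def)
    have "Suc a' * k \<le> N * k" using \<open>a' < N\<close> by (intro mult_le_mono1) simp
    then have "m < N * k" using \<open>c < k\<close> by (simp add: m_def)
    moreover have "u \<in> W l s (?t m)" using a' by (simp add: W_def m)
    ultimately show "w \<in> (\<Union>m\<in>?I. ?A m)"
      using a' by (intro UN_I[of m]) (auto simp: valid_def m u)
  next
    fix w assume "w \<in> (\<Union>m\<in>?I. ?A m)"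
    then obtain m u where m: "m < N * k" "?ok m" "u \<in> W l s (?t m)" "w = u @ [m mod k]" by auto
    then show "w \<in> W (Suc l) s t"
      using k_pos vpath_ends by (auto simp: W_def t valid_def words_def vpath_append intro!: exI[of _ "m div k"])
  qed
  then have "card (W (Suc l) s t) = card (\<Union>m\<in>?I. ?A m)" by (rule arg_cong)
  also have "\<dots> = (\<Sum>m\<in>?I. card (?A m))"
  proof (rule card_UN_disjoint)
    show "finite ?I" by simp
    show "\<forall>m\<in>?I. finite (?A m)" by (intro ballI finite_imageI finite_W)
    show "\<forall>m\<in>?I. \<forall>m'\<in>?I. m \<noteq> m' \<longrightarrow> ?A m \<inter> ?A m' = {}"
    proof (intro ballI impI)
    fix m m' assume "m \<in> ?I" "m' \<in> ?I" "m \<noteq> m'"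
    show "?A m \<inter> ?A m' = {}"
    proof (rule ccontr)
      assume "?A m \<inter> ?A m' \<noteq> {}"
      then obtain u where u: "u \<in> W l s (?t m)" "u \<in> W l s (?t m')" and "m mod k = m' mod k"
        by blast
      have "vpath (s div N) u (m div k)" using u(1) unfolding W_def t by blast
      moreover have "vpath (s div N) u (m' div k)" using u(2) unfolding W_def t by blast
      ultimately have "m div k = m' div k" using vpath_foldl by metis
      then show False using \<open>m \<noteq> m'\<close> \<open>m mod k = m' mod k\<close> by (metis div_mult_mod_eq)
    qed
    qed
  qed
  also have "\<dots> = (\<Sum>m\<in>?I. card (W l s (?t m)))"
  proof (rule sum.cong[OF HOL.refl])
    fix m
    have "inj_on (\<lambda>u. u @ [m mod k]) (W l s (?t m))" by (rule inj_onI) (rule append_same_eq[THEN iffD1])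
    then show "card (?A m) = card (W l s (?t m))" by (rule card_image)
  qed
  also have "\<dots> = (\<Sum>m<N*k. if ?ok m then card (W l s (?t m)) else 0)"
    by (rule sum.inter_filter) simp
  finally show ?thesis .
qed

text \<open>Larger than every count that is stored as a digit in base \<open>B\<close> below.\<close>

definition B :: nat where
  "B = N * N * k * k ^ n + 1"

lemma less_B: "c \<le> N * N * k * k ^ n \<Longrightarrow> c < B"
  by (simp add: B_def)

text \<open>The generating integer of the counts \<open>card (W l s t)\<close> in the variable
  \<open>s\<close>. The recursion of \<open>card_W_Suc\<close> has the same guard and the same
  predecessors for all \<open>s\<close>, so it can be run on packed integers.\<close>

primrec D :: "nat \<Rightarrow> nat \<Rightarrow> nat" where
  "D 0 t = (if valid t then B ^ t else 0)"
| "D (Suc l) t = (\<Sum>m<N*k. if valid t \<and> del (m div k) (m mod k) = t div N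
     then D l (m div k * N + del (t mod N) (m mod k)) else 0)"

lemma D_eq: "t < N * N \<Longrightarrow> D l t = (\<Sum>s<N*N. card (W l s t) * B ^ s)"
proof (induction l arbitrary: t)
  case 0
  have "(\<Sum>s<N*N. card (W 0 s t) * B ^ s) = (\<Sum>s<N*N. if s = t then (if valid t then B ^ s else 0) else 0)"
    by (intro sum.cong) (auto simp: W_0)
  then show ?case using 0 by (simp add: sum.delta)
next
  case (Suc l)
  let ?ok = "\<lambda>m. valid t \<and> del (m div k) (m mod k) = t div N"
  let ?t = "\<lambda>m. m div k * N + del (t mod N) (m mod k)"
  have t: "?t m < N * N" if "m < N * k" for m
    using that del_less_N by (intro code_less) (auto simp: less_mult_imp_div_less)
  have "D (Suc l) t = (\<Sum>m<N*k. \<Sum>s<N*N. (if ?ok m then card (W l s (?t m)) else 0) * B ^ s)"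
    unfolding D.simps by (intro sum.cong HOL.refl) (auto simp: Suc.IH t)
  also have "\<dots> = (\<Sum>s<N*N. (\<Sum>m<N*k. if ?ok m then card (W l s (?t m)) else 0) * B ^ s)"
    by (subst sum.swap) (simp add: sum_distrib_right)
  also have "\<dots> = (\<Sum>s<N*N. card (W (Suc l) s t) * B ^ s)"
  proof (rule sum.cong[OF HOL.refl])
    fix s assume "s \<in> {..<N*N}"
    then show "(\<Sum>m<N*k. if ?ok m then card (W l s (?t m)) else 0) * B ^ s = card (W (Suc l) s t) * B ^ s"
      using card_W_Suc[of s l t] by simp
  qed
  finally show ?case .
qed

text \<open>Only the digit of start \<open>t\<close> is taken from the integer of end
  \<open>t\<close>: this is the trace of the \<open>l\<close>-th power of the transfer
  matrix.\<close>

definition tr :: "nat \<Rightarrow> nat" where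
  "tr l = (\<Sum>t<N*N. D l t div B ^ t mod B)"

lemma card_W_less_B: "l \<le> n \<Longrightarrow> card (W l s t) < B"
proof (rule less_B)
  assume "l \<le> n"
  have "card (W l s t) \<le> k ^ n"
    using card_W_le[of l s t] power_increasing[of l n k] \<open>l \<le> n\<close> k_pos by simp
  also have "\<dots> \<le> N * N * k * k ^ n" using k_pos by (simp add: N_def)
  finally show "card (W l s t) \<le> N * N * k * k ^ n" .
qed

text \<open>A walk from a pair to itself closes both labels. Each closed label is unique for its
  word, so the sets \<open>W l t t\<close> are disjoint and nothing is counted twice.\<close>

lemma tr_eq:
  assumes l: "0 < l" "l \<le> n"
  shows "tr l = card {u \<in> words_of l. cyc u \<and> cyc (rev u)}"
proof -
  have "tr l = (\<Sum>t<N*N. card (W l t t))"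
    unfolding tr_def
  proof (rule sum.cong[OF HOL.refl])
    fix t assume "t \<in> {..<N*N}"
    then show "D l t div B ^ t mod B = card (W l t t)"
      using digit_sum[of "N*N" "\<lambda>s. card (W l s t)" B t] l by (simp add: D_eq card_W_less_B)
  qed
  also have "\<dots> = card (\<Union>t<N*N. W l t t)"
  proof (rule card_UN_disjoint[symmetric]; (intro ballI impI)?)
    fix t t' assume "t \<in> {..<N*N}" "t' \<in> {..<N*N}" "t \<noteq> t'"
    show "W l t t \<inter> W l t' t' = {}"
    proof (rule ccontr)
      assume "W l t t \<inter> W l t' t' \<noteq> {}"
      then obtain u where u: "u \<in> W l t t" "u \<in> W l t' t'" by auto
      then have "u \<noteq> []" "set u \<subseteq> {..<k}" using l by (auto simp: W_def words_def)
      then have "t div N = t' div N" "t mod N = t' mod N"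
        using u closed_vpath_unique[of _ u] closed_vpath_unique[of _ "rev u"] by (auto simp: W_def)
      then show False using \<open>t \<noteq> t'\<close> code_eqI by blast
    qed
  qed auto
  also have "(\<Union>t<N*N. W l t t) = {u \<in> words_of l. cyc u \<and> cyc (rev u)}"
  proof (intro equalityI subsetI)
    fix u assume "u \<in> (\<Union>t<N*N. W l t t)"
    then obtain t where "u \<in> W l t t" by auto
    moreover from this have "u \<noteq> []" "set u \<subseteq> {..<k}" using l by (auto simp: W_def words_def)
    ultimately show "u \<in> {u \<in> words_of l. cyc u \<and> cyc (rev u)}"
      by (auto simp: W_def cyc_iff_ex)
  next
    fix u assume u: "u \<in> {u \<in> words_of l. cyc u \<and> cyc (rev u)}"
    then have ne: "u \<noteq> []" "set u \<subseteq> {..<k}" using l by (auto simp: words_def)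
    with u obtain a b where ab: "vpath a u a" "vpath b (rev u) b" by (auto simp: cyc_iff_ex)
    then have "a < N" "b < N" using ne closed_vpath_le[of _ u] closed_vpath_le[of _ "rev u"]
      by (auto simp: le_n_iff)
    then have "a * N + b < N * N" "u \<in> W l (a * N + b) (a * N + b)"
      using u ab by (auto simp: W_def code_less)
    then show "u \<in> (\<Union>t<N*N. W l t t)" by blast
  qed
  finally show ?thesis .
qed

text \<open>By \<open>U_eq\<close>, the number of ways to fill an end of the axis that carries
  \<open>\<sigma>\<close> letters, in a form that a table program can evaluate.\<close>

definition U :: "nat \<Rightarrow> nat \<Rightarrow> nat" where
  "U \<sigma> t = (if \<sigma> = 0 then (if t div N = t mod N then 1 else 0)
     else (\<Sum>c<k. if del (t mod N) c = t div N then 1 else 0))"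

text \<open>With \<open>\<sigma>\<close> letters on one end of the axis, each half has
  \<open>(n - \<sigma>) div 2\<close> letters and the other end carries
  \<open>(n - \<sigma>) mod 2\<close>. At that other end the walk turns from the past label to the
  future label, opposite to the first end; hence the code of \<open>t\<close> with its components
  exchanged.\<close>

definition H :: "nat \<Rightarrow> nat" where
  "H \<sigma> = (\<Sum>t<N*N. U ((n - \<sigma>) mod 2) (t mod N * N + t div N) * D ((n - \<sigma>) div 2) t)"

text \<open>The index \<open>m\<close> codes \<open>\<sigma>\<close> together with a start code, so
  that a single sum covers both classes of reflections.\<close>

definition E :: nat where
  "E = (\<Sum>m<2*(N*N). U (m div (N*N)) (m mod (N*N)) * (H (m div (N*N)) div B ^ (m mod (N*N)) mod B))"

text \<open>The letter (if any) on a reflection axis leads from the state of its past to the state of its future.\<close>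

definition axis :: "nat \<Rightarrow> nat \<Rightarrow> nat list set" where
  "axis \<sigma> t = {e \<in> words_of \<sigma>. foldl del (t mod N) e = t div N}"

lemma finite_axis [simp]: "finite (axis \<sigma> t)"
  by (simp add: axis_def)

lemma U_eq: "\<sigma> < 2 \<Longrightarrow> U \<sigma> t = card (axis \<sigma> t)"
proof -
  assume "\<sigma> < 2"
  then consider "\<sigma> = 0" | "\<sigma> = 1" by linarith
  then show ?thesis
  proof cases
    case 1
    then have "axis \<sigma> t = (if t div N = t mod N then {[]} else {})"
      by (auto simp: axis_def words_def)
    then show ?thesis using 1 by (simp add: U_def)
  next
    case 2
    have "axis 1 t = (\<lambda>c. [c]) ` {c. c < k \<and> del (t mod N) c = t div N}"
      by (auto simp: axis_def words_def length_Suc_conv)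
    then have "card (axis 1 t) = card {c. c < k \<and> del (t mod N) c = t div N}"
      by (simp add: card_image inj_on_def)
    then show ?thesis using 2 by (simp add: U_def sum.If_cases Int_def lessThan_def)
  qed
qed

lemma card_axis_le: "\<sigma> < 2 \<Longrightarrow> card (axis \<sigma> t) \<le> k"
proof -
  assume "\<sigma> < 2"
  have "card (axis \<sigma> t) \<le> card (words_of \<sigma>)" by (rule card_mono) (auto simp: axis_def)
  also have "\<dots> \<le> k" using \<open>\<sigma> < 2\<close> k_pos by (cases "\<sigma> = 0") (auto simp: card_words_of less_Suc_eq numeral_2_eq_2)
  finally show ?thesis .
qed

end

section \<open>Counting orbits\<close>

lemma sum_lessThan_add: "(\<Sum>i<a + b. f i) = (\<Sum>i<a. f i) + (\<Sum>i<b. f (a + i :: nat))"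
  for f :: "nat \<Rightarrow> 'a::comm_monoid_add"
  by (induction b) (simp_all add: add.assoc)

lemma sum_shift_periodic:
  fixes f :: "nat \<Rightarrow> nat"
  assumes "\<And>r. f (r + n) = f r"
  shows "(\<Sum>r<n. f (r + m)) = (\<Sum>r<n. f r)"
proof (induction m)
  case (Suc m)
  have "(\<Sum>r<Suc n. f (r + m)) = f m + (\<Sum>r<n. f (r + Suc m))"
    by (subst sum.lessThan_Suc_shift) simp
  moreover have "(\<Sum>r<Suc n. f (r + m)) = (\<Sum>r<n. f (r + m)) + f m"
    using assms[of m] by (simp add: add.commute)
  ultimately show ?case using Suc by simp
qed simp

lemma ext_rev: "v \<noteq> [] \<Longrightarrow> ext (rev v) i = ext v (- 1 - i)"
proof -
  assume v: "v \<noteq> []"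
  let ?m = "int (length v)"
  define j where "j = nat (i mod ?m)"
  have j: "i mod ?m = int j" "j < length v" using v by (auto simp: j_def nat_less_iff)
  have "(- 1 - i) mod ?m = (?m - 1 - i) mod ?m"
    by (metis diff_add_eq mod_add_self2 add.commute diff_conv_add_uminus uminus_add_conv_diff)
  also have "\<dots> = (?m - 1 - i mod ?m) mod ?m"
    by (simp add: mod_diff_right_eq)
  also have "\<dots> = int (length v - Suc j)"
    using j by simp
  finally have "nat ((- 1 - i) mod ?m) = length v - Suc j" by simp
  then show ?thesis using j by (simp add: ext_def rev_nth)
qed

lemma ext_rotate: "v \<noteq> [] \<Longrightarrow> ext (rotate r v) i = ext v (i + int r)"
proof -
  assume v: "v \<noteq> []"
  let ?m = "int (length v)"
  define j where "j = nat (i mod ?m)"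
  have j: "i mod ?m = int j" "j < length v" using v by (auto simp: j_def nat_less_iff)
  have "(i + int r) mod ?m = (int j + int r) mod ?m"
    by (metis j(1) mod_add_left_eq)
  also have "\<dots> = int ((r + j) mod length v)"
    by (simp add: zmod_int add.commute)
  finally show ?thesis using j by (simp add: ext_def nth_rotate)
qed

lemma ext_eqI: "length u = length v \<Longrightarrow> ext u = ext v \<Longrightarrow> u = v"
  by (metis ext_nth nth_equalityI)

lemma periodic_multiple:
  fixes f :: "int \<Rightarrow> 'a"
  assumes "\<And>i. f (i + r) = f i"
  shows "f (i + r * z) = f i"
proof (induction z rule: int_induct[where k = 0])
  case (step1 z)
  then show ?case using assms[of "i + r * z"] by (simp add: algebra_simps)
next
  case (step2 z)
  then show ?case using assms[of "i + r * (z - 1)"] by (simp add: algebra_simps)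
qed simp

text \<open>By Bezout, \<open>gcd r n\<close> is an integer combination of the two periods.\<close>

lemma periodic_gcd:
  fixes f :: "int \<Rightarrow> 'a"
  assumes "\<And>i. f (i + int r) = f i" "\<And>i. f (i + int n) = f i"
  shows "f (i + int (gcd r n)) = f i"
proof -
  obtain a b where "a * int r + b * int n = gcd (int r) (int n)"
    using bezout_int by blast
  then have "i + int (gcd r n) = (i + int r * a) + int n * b"
    by (simp add: algebra_simps)
  then show ?thesis
    using periodic_multiple[of f "int r", OF assms(1)] periodic_multiple[of f "int n", OF assms(2)] by metis
qed

lemma ext_periodic_dvd: "int (length v) dvd m \<Longrightarrow> ext v (i + m) = ext v i"
  by (auto simp: ext_def)

section \<open>The dihedral action and orbit counting\<close>

lemma rev_rotate: "\<exists>s. rev (rotate r v) = rotate s (rev v)"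
proof (cases "v = [] \<or> r mod length v = 0")
  case True
  then have "rev (rotate r v) = rotate 0 (rev v)" by (auto simp: rotate_id)
  then show ?thesis ..
next
  case False
  then have lt: "r mod length v < length v" by simp
  have "rotate (length v - r mod length v) (rev v) = rev (rotate (r mod length v) v)"
    using False lt by (simp add: rotate_rev)
  then show ?thesis by (metis rotate_conv_mod)
qed

lemma bracelet_equiv_iff:
  "bracelet_equiv v u \<longleftrightarrow> (\<exists>r. u = rotate r v \<or> u = rotate r (rev v))"
proof
  show "bracelet_equiv v u \<Longrightarrow> \<exists>r. u = rotate r v \<or> u = rotate r (rev v)"
  proof (induction rule: bracelet_equiv.induct)
    case (refl u)
    show ?case by (rule exI[of _ 0]) simp
  next
    case (rotation u v r)
    then show ?case by (auto simp: rotate_rotate)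
  next
    case (reversal u v)
    then show ?case using rev_rotate by (metis rev_rev_ident)
  qed
qed (auto intro: bracelet_equiv.intros)

lemma bracelet_equiv_in_words: "bracelet_equiv v u \<Longrightarrow> u \<in> words S n \<longleftrightarrow> v \<in> words S n"
  by (auto simp: bracelet_equiv_iff words_def)

text \<open>The number of the \<open>2 * n\<close> dihedral maps that send \<open>u\<close> to
  \<open>v\<close>; for \<open>u = v\<close>, the size of the stabiliser.\<close>

definition hits :: "nat \<Rightarrow> 'a list \<Rightarrow> 'a list \<Rightarrow> nat" where
  "hits n u v = (\<Sum>r<n. of_bool (rotate r u = v)) + (\<Sum>r<n. of_bool (rotate r (rev u) = v))"

lemma rotate_add_length: "rotate (r + length u) u = rotate r u"
  by (metis mod_add_self2 rotate_conv_mod)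

text \<open>A rotation of \<open>u\<close> shifts both sums cyclically, and a reversal exchanges
  them.\<close>

lemma hits_invariant:
  assumes "bracelet_equiv u u'" "length u = n"
  shows "hits n u' v = hits n u v"
proof -
  have shift: "(\<Sum>r<n. of_bool (rotate r (rotate s w) = v)) = (\<Sum>r<n. of_bool (rotate r w = v) :: nat)"
    if "length w = n" for s w
    using sum_shift_periodic[of "\<lambda>r. of_bool (rotate r w = v)" n s] rotate_add_length[of _ w] that
    by (simp add: rotate_rotate)
  have rot: "hits n (rotate s w) v = hits n w v" if "length w = n" for s w
  proof -
    obtain s' where "rev (rotate s w) = rotate s' (rev w)" using rev_rotate by blast
    then show ?thesis using shift[of w s] shift[of "rev w" s'] that by (simp add: hits_def)
  qed
  have rev: "hits n (rev w) v = hits n w v" for w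
    by (simp add: hits_def)
  show ?thesis
    using assms rot rev by (auto simp: bracelet_equiv_iff)
qed

definition val :: "nat \<Rightarrow> nat list \<Rightarrow> nat" where
  "val k v = num k (length v) (\<lambda>t. v ! t)"

lemma val_Nil [simp]: "val k [] = 0"
  by (simp add: val_def)

lemma val_Cons: "val k (c # v) = c * k ^ length v + val k v"
  by (simp add: val_def num_Suc_first)

lemma val_less: "set v \<subseteq> {..<k} \<Longrightarrow> val k v < k ^ length v"
  unfolding val_def by (intro num_less) (use nth_mem in blast)

lemma val_less_iff:
  fixes f :: "nat \<Rightarrow> 'a::linorder"
  assumes "length u = length v" "set u \<subseteq> {..<k}" "set v \<subseteq> {..<k}" "strict_mono_on {..<k} f"
  shows "map f u < map f v \<longleftrightarrow> val k u < val k v"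
  using assms(1-3)
proof (induction u v rule: list_induct2)
  case (Cons a u b v)
  have "val k u < k ^ length v" "val k v < k ^ length v"
    using Cons val_less[of u k] val_less[of v k] by simp_all
  then have "val k (a # u) < val k (b # v) \<longleftrightarrow> a < b \<or> a = b \<and> val k u < val k v"
    using lex_le_iff[of "val k v" "k ^ length v" "val k u" b a] Cons.hyps
    by (auto simp: val_Cons not_le[symmetric])
  moreover have "f a < f b \<longleftrightarrow> a < b" "f a = f b \<longleftrightarrow> a = b"
    using Cons.prems assms(4) by (auto simp: strict_mono_on_less strict_mono_on_eq)
  ultimately show ?case using Cons by simp
qed simp

lemma val_inj:
  assumes "u \<in> words {..<k} n" "v \<in> words {..<k} n" "val k u = val k v"
  shows "u = v"
proof -
  have "strict_mono_on {..<k} (\<lambda>c. c)" by (simp add: strict_mono_on_def)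
  then show ?thesis
    using val_less_iff[of u v k "\<lambda>c. c"] val_less_iff[of v u k "\<lambda>c. c"] assms
    by (auto simp: words_def)
qed

text \<open>The bracelet representatives on the level of symbol indices, with \<open>val\<close> in
  place of the lexicographic order.\<close>

definition canonical :: "nat \<Rightarrow> nat \<Rightarrow> nat list set" where
  "canonical k n = {v \<in> words {..<k} n. \<forall>u. bracelet_equiv v u \<longrightarrow> val k v \<le> val k u}"

lemma finite_canonical: "finite (canonical k n)"
  by (simp add: canonical_def finite_words)

text \<open>Inside the orbit of \<open>v\<close>, \<open>hits n u u\<close> equals
  \<open>hits n v u\<close> by invariance, and summing this over \<open>u\<close> gives
  \<open>2 * n\<close> because each dihedral map sends \<open>v\<close> to exactly one word of the
  orbit. Each orbit in \<open>T\<close> contains exactly one canonical word.\<close>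

lemma burnside:
  assumes T: "T \<subseteq> words {..<k} n" and closed: "\<And>u v. u \<in> T \<Longrightarrow> bracelet_equiv u v \<Longrightarrow> v \<in> T"
  shows "(\<Sum>v\<in>T. hits n v v) = 2 * n * card (T \<inter> canonical k n)"
proof -
  let ?O = "\<lambda>v. {u. bracelet_equiv v u}"
  have fin: "finite (?O v)" if "v \<in> T" for v
  proof (rule finite_subset)
    show "?O v \<subseteq> T" using closed[OF that] by blast
    show "finite T" using T finite_subset[OF _ finite_words] by blast
  qed
  have "T = (\<Union>v\<in>T \<inter> canonical k n. ?O v)"
  proof (intro equalityI subsetI)
    fix u assume u: "u \<in> T"
    obtain v where v: "bracelet_equiv u v" "\<And>w. bracelet_equiv u w \<Longrightarrow> val k v \<le> val k w"
      using ex_has_least_nat[of "bracelet_equiv u" u "val k", OF bracelet_equiv.refl] by blast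
    have "v \<in> T \<inter> canonical k n"
      using closed[OF u v(1)] v(2)[OF bracelet_equiv_trans[OF _ v(1)]] T by (auto simp: canonical_def)
    with v(1) show "u \<in> (\<Union>v\<in>T \<inter> canonical k n. ?O v)"
      using bracelet_equiv_sym by blast
  qed (use closed in auto)
  then have "(\<Sum>v\<in>T. hits n v v) = (\<Sum>u\<in>(\<Union>v\<in>T \<inter> canonical k n. ?O v). hits n u u)"
    by (rule arg_cong[of _ _ "sum (\<lambda>v. hits n v v)"])
  also have "\<dots> = (\<Sum>v\<in>T \<inter> canonical k n. \<Sum>u\<in>?O v. hits n u u)"
  proof (rule sum.UNION_disjoint)
    show "finite (T \<inter> canonical k n)" by (simp add: finite_canonical)
    show "\<forall>v\<in>T \<inter> canonical k n. \<forall>w\<in>T \<inter> canonical k n. v \<noteq> w \<longrightarrow> ?O v \<inter> ?O w = {}"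
    proof (intro ballI impI, rule ccontr)
      fix v w assume v: "v \<in> T \<inter> canonical k n" and w: "w \<in> T \<inter> canonical k n" and "v \<noteq> w"
        "?O v \<inter> ?O w \<noteq> {}"
      then have vw: "bracelet_equiv v w" "bracelet_equiv w v"
        using bracelet_equiv_sym bracelet_equiv_trans by blast+
      then have "val k v = val k w" using v w by (auto simp: canonical_def intro: antisym)
      then show False using val_inj[of v k n w] v w \<open>v \<noteq> w\<close> by (auto simp: canonical_def)
    qed
  qed (use fin in auto)
  also have "\<dots> = (\<Sum>v\<in>T \<inter> canonical k n. 2 * n)"
  proof (rule sum.cong[OF HOL.refl])
    fix v assume "v \<in> T \<inter> canonical k n"
    then have v: "v \<in> T" "length v = n" using T by (auto simp: words_def)
    have one: "(\<Sum>u\<in>?O v. of_bool (w = u)) = (1 :: nat)" if "bracelet_equiv v w" for w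
    proof -
      have "(\<Sum>u\<in>?O v. of_bool (w = u)) = (\<Sum>u\<in>?O v. if w = u then 1 else 0 :: nat)"
        by (intro sum.cong) auto
      then show ?thesis using that fin[OF v(1)] by simp
    qed
    have "(\<Sum>u\<in>?O v. hits n u u) = (\<Sum>u\<in>?O v. hits n v u)"
      by (intro sum.cong HOL.refl) (use v hits_invariant in auto)
    also have "\<dots> = (\<Sum>r<n. \<Sum>u\<in>?O v. of_bool (rotate r v = u)) + (\<Sum>r<n. \<Sum>u\<in>?O v. of_bool (rotate r (rev v) = u))"
      by (simp only: hits_def sum.distrib) (simp only: sum.swap[of _ "{..<n}" "?O v"])
    also have "\<dots> = (\<Sum>r<n. 1) + (\<Sum>r<n. 1)"
      by (intro arg_cong2[of _ _ _ _ "(+)"] sum.cong HOL.refl one) (auto simp: bracelet_equiv_iff)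
    finally show "(\<Sum>u\<in>?O v. hits n u u) = 2 * n" by simp
  qed
  finally show ?thesis by simp
qed

text \<open>\<open>n\<close> divides \<open>i * r\<close> iff \<open>n div gcd r n\<close> divides
  \<open>i\<close>. This lets a summing program compute the gcd without the Euclidean
  algorithm.\<close>

lemma count_multiples_gcd:
  fixes n r :: nat
  assumes "0 < n"
  shows "(\<Sum>i<n. if i * r mod n = 0 then 1 else 0) = gcd r n"
proof -
  define g where "g = gcd r n"
  have g: "0 < g" using assms by (simp add: g_def)
  define m s where "m = n div g" and "s = r div g"
  have ms: "n = m * g" "r = s * g" "coprime s m"
    using assms g by (auto simp: m_def s_def g_def intro: div_gcd_coprime)
  have "m > 0" using assms ms(1) by (cases m) auto
  have "n dvd i * r \<longleftrightarrow> m dvd i" for i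
  proof -
    have "n dvd i * r \<longleftrightarrow> m dvd i * s" using g by (simp add: ms(1,2) mult.assoc[symmetric])
    also have "\<dots> \<longleftrightarrow> m dvd i" using ms(3) by (simp add: coprime_commute coprime_dvd_mult_left_iff)
    finally show ?thesis .
  qed
  then have "{i. i < n \<and> i * r mod n = 0} = (\<lambda>j. m * j) ` {..<g}"
    using \<open>m > 0\<close> ms(1) by (auto simp: mod_eq_0_iff_dvd elim!: dvdE)
  then have "card {i. i < n \<and> i * r mod n = 0} = g"
    using \<open>m > 0\<close> by (simp add: card_image inj_on_def)
  then show ?thesis by (simp add: g_def sum.If_cases Int_def lessThan_def)
qed

section \<open>Words fixed by a reflection\<close>

context threshold
begin

text \<open>The other direction, \<open>cyc (rev v)\<close>, follows for words fixed by a reflection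
  (\<open>F_eq_reflected\<close>).\<close>

definition reflected :: "nat \<Rightarrow> nat list set" where
  "reflected \<sigma> = {v \<in> words_of n. rotate \<sigma> (rev v) = v \<and> cyc v}"

lemma vpath_short:
  "length f \<le> 1 \<Longrightarrow> R 0 \<le> a \<Longrightarrow> R 0 \<le> b \<Longrightarrow> foldl del a f = b \<Longrightarrow> vpath a f b"
  by (cases f) auto

text \<open>A word fixed by a reflection is \<open>u f u\<^sup>R e\<close> with \<open>e\<close>, \<open>f\<close> the letters on the two ends of the axis.\<close>

lemma card_reflected:
  assumes \<sigma>: "\<sigma> < 2" and l: "l = (n - \<sigma>) div 2" and \<tau>: "\<tau> = (n - \<sigma>) mod 2"
  shows "card (reflected \<sigma>) =
    (\<Sum>s<N*N. \<Sum>t<N*N. card (axis \<sigma> s) * (card (axis \<tau> (t mod N * N + t div N)) * card (W l s t)))"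
proof -
  let ?ax = "\<lambda>t. axis \<tau> (t mod N * N + t div N)"
  let ?S = "SIGMA s:{..<N*N}. SIGMA t:{..<N*N}. axis \<sigma> s \<times> ?ax t \<times> W l s t"
  let ?h = "\<lambda>(s, t, e, f, u). u @ f @ rev u @ e :: nat list"
  have len: "2 * l + \<tau> + \<sigma> = n" using \<sigma> n_pos by (simp add: l \<tau>)
  have \<tau>2: "\<tau> < 2" by (simp add: \<tau>)
  have revs: "rev e = e" if "length e < 2" for e :: "nat list"
    using that by (cases e) auto
  have Sd: "length e = \<sigma> \<and> set e \<subseteq> {..<k} \<and> foldl del (s mod N) e = s div N \<and>
     length f = \<tau> \<and> set f \<subseteq> {..<k} \<and> foldl del (t div N) f = t mod N \<and>
     length u = l \<and> set u \<subseteq> {..<k} \<and> vpath (s div N) u (t div N) \<and> vpath (t mod N) (rev u) (s mod N)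
     \<and> s < N * N \<and> t < N * N"
    if "(s, t, e, f, u) \<in> ?S" for s t e f u
    using that code_parts[of t] by (auto simp: axis_def W_def words_def)
  have path: "vpath (s div N) (u @ f @ rev u @ e) (s div N)" if S: "(s, t, e, f, u) \<in> ?S" for s t e f u
  proof -
    note d = Sd[OF S]
    then have ends: "R 0 \<le> s div N" "R 0 \<le> s mod N" "R 0 \<le> t div N" "R 0 \<le> t mod N"
      using vpath_ends by blast+
    have "vpath (t div N) f (t mod N)" using d ends \<tau>2 by (intro vpath_short) auto
    moreover have "vpath (s mod N) e (s div N)" using d ends \<sigma> by (intro vpath_short) auto
    ultimately show ?thesis using d by (auto simp: vpath_append)
  qed
  have "bij_betw ?h ?S (reflected \<sigma>)"
  proof (rule bij_betw_imageI)
    show "inj_on ?h ?S"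
    proof (rule inj_onI)
      fix z z' assume zz: "z \<in> ?S" "z' \<in> ?S" "?h z = ?h z'"
      obtain s t e f u where z: "z = (s, t, e, f, u)" by (cases z)
      obtain s' t' e' f' u' where z': "z' = (s', t', e', f', u')" by (cases z')
      have S: "(s, t, e, f, u) \<in> ?S" "(s', t', e', f', u') \<in> ?S" using zz(1,2) unfolding z z' by blast+
      note d = Sd[OF S(1)] and d' = Sd[OF S(2)]
      have eq: "u @ f @ rev u @ e = u' @ f' @ rev u' @ e'" using zz(3) by (simp add: z z')
      then have "u = u'" using d d' by (metis append_eq_append_conv)
      then have "f @ rev u @ e = f' @ rev u @ e'" using eq by simp
      then have "f = f'" using d d' by (metis append_eq_append_conv)
      then have "e = e'" using eq \<open>u = u'\<close> by simp
      let ?v = "u @ f @ rev u @ e"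
      have "length ?v = n" using d len by simp
      then have v: "?v \<noteq> []" "set ?v \<subseteq> {..<k}" using n_pos d by auto
      \<comment> \<open>The past label at the left end is fixed by uniqueness of closed walks; the
        other three labels follow by running the walk round the word.\<close>
      have "s div N = s' div N"
        using closed_vpath_unique[OF path[OF S(1)] _ v] path[OF S(2)] \<open>u = u'\<close> \<open>f = f'\<close> \<open>e = e'\<close> by simp
      moreover from this have "t div N = t' div N" using d d' \<open>u = u'\<close> vpath_foldl by metis
      moreover from this have "t mod N = t' mod N" using d d' \<open>f = f'\<close> by simp
      moreover from this have "s mod N = s' mod N" using d d' \<open>u = u'\<close> vpath_foldl by metis
      ultimately show "z = z'"
        using z z' \<open>u = u'\<close> \<open>f = f'\<close> \<open>e = e'\<close> code_eqI by blast
    qed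
    show "?h ` ?S = reflected \<sigma>"
    proof (intro equalityI subsetI)
      fix v assume "v \<in> ?h ` ?S"
      then obtain s t e f u where S: "(s, t, e, f, u) \<in> ?S" and v: "v = u @ f @ rev u @ e"
        by (elim imageE) (metis (no_types, lifting) case_prod_conv prod_cases5)
      note d = Sd[OF S]
      have w: "v \<in> words_of n" using d len by (auto simp: v words_def)
      moreover from this have "cyc v"
        using path[OF S] n_pos cyc_iff_ex[of v] by (auto simp: v[symmetric] words_def)
      moreover have "rotate \<sigma> (rev v) = v"
        using d \<sigma> \<tau>2 rotate_append[of e "u @ f @ rev u"] revs[of e] revs[of f] by (simp add: v)
      ultimately show "v \<in> reflected \<sigma>" by (simp add: reflected_def)
    next
      fix v assume "v \<in> reflected \<sigma>"
      then have v: "length v = n" "set v \<subseteq> {..<k}" "rotate \<sigma> (rev v) = v" "cyc v"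
        by (auto simp: reflected_def words_def)
      define u f r e where "u = take l v" and "f = take \<tau> (drop l v)"
        and "r = take l (drop (l + \<tau>) v)" and "e = drop (2 * l + \<tau>) v"
      have split: "v = u @ f @ r @ e"
        by (simp add: u_def f_def r_def e_def flip: take_add drop_drop)
          (metis add.commute append_take_drop_id drop_drop mult_2)
      have lens: "length u = l" "length f = \<tau>" "length r = l" "length e = \<sigma>"
        using v(1) len by (auto simp: u_def f_def r_def e_def)
      have "rev r @ rev f @ rev u @ rev e = u @ f @ r @ e"
      proof -
        have "rev v = rev e @ (rev r @ rev f @ rev u)" by (subst split) simp
        then have "rotate \<sigma> (rev v) = (rev r @ rev f @ rev u) @ rev e"
          using rotate_append[of "rev e" "rev r @ rev f @ rev u"] lens(4) by (simp only: length_rev)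
        then show ?thesis using v(3) split by simp
      qed
      then have "rev r = u" using lens by (metis append_eq_append_conv length_rev)
      then have r: "r = rev u" by auto
      obtain a where "vpath a v a" using v n_pos cyc_iff_ex[of v] by auto
      moreover from this have "a \<le> n" using v n_pos closed_vpath_le[of a v] by auto
      ultimately obtain b c d where p: "vpath a u b" "vpath b f c" "vpath c (rev u) d" "vpath d e a"
        "a \<le> n" "b \<le> n" "c \<le> n" "d \<le> n"
        unfolding split r vpath_append using vpath_le by metis
      \<comment> \<open>The closed walk passes from \<open>a\<close> along \<open>u\<close> to
        \<open>b\<close>, along \<open>f\<close> to \<open>c\<close>, along \<open>rev u\<close> to
        \<open>d\<close> and along \<open>e\<close> back to \<open>a\<close>. In a mirror-symmetric
        word the pasts on the way back are the futures on the way out, so \<open>d\<close> and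
        \<open>c\<close> are the future labels.\<close>
      have "(a * N + d, b * N + c, e, f, u) \<in> ?S"
        using p lens v(2) code_less[of a d] code_less[of b c]
        by (auto simp: le_n_iff axis_def W_def words_def split vpath_foldl)
      then show "v \<in> ?h ` ?S" unfolding split r by (rule rev_image_eqI) simp
    qed
  qed
  then have "card (reflected \<sigma>) = card ?S" by (simp add: bij_betw_same_card)
  also have "\<dots> = (\<Sum>s<N*N. \<Sum>t<N*N. card (axis \<sigma> s) * (card (?ax t) * card (W l s t)))"
    by (simp add: card_cartesian_product)
  finally show ?thesis .
qed

lemma E_eq: "E = card (reflected 0) + card (reflected 1)"
proof -
  have part: "(\<Sum>s<N*N. U \<sigma> s * (H \<sigma> div B ^ s mod B)) = card (reflected \<sigma>)" if \<sigma>: "\<sigma> < 2" for \<sigma>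
  proof -
    define l \<tau> where l: "l = (n - \<sigma>) div 2" and \<tau>: "\<tau> = (n - \<sigma>) mod 2"
    have "\<tau> < 2" "l \<le> n" by (simp_all add: l \<tau>)
    let ?ax = "\<lambda>t. card (axis \<tau> (t mod N * N + t div N))"
    define c where "c s = (\<Sum>t<N*N. ?ax t * card (W l s t))" for s
    have "H \<sigma> = (\<Sum>t<N*N. \<Sum>s<N*N. ?ax t * card (W l s t) * B ^ s)"
      using \<open>\<tau> < 2\<close> unfolding H_def
      by (intro sum.cong HOL.refl) (simp add: U_eq D_eq l[symmetric] \<tau>[symmetric] sum_distrib_left mult.assoc)
    also have "\<dots> = (\<Sum>s<N*N. c s * B ^ s)"
      by (subst sum.swap) (simp add: c_def sum_distrib_right)
    finally have H: "H \<sigma> = (\<Sum>s<N*N. c s * B ^ s)" .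
    have "c s < B" for s
    proof (rule less_B)
      \<comment> \<open>The origin of \<open>B\<close>: there are \<open>N * N\<close> codes
        \<open>t\<close>, at most \<open>k\<close> fillings of the axis end and at most
        \<open>k ^ n\<close> words for each.\<close>
      have "c s \<le> (\<Sum>t<N*N. k * k ^ n)" unfolding c_def
      proof (rule sum_mono)
        fix t
        have "card (W l s t) \<le> k ^ n"
          using card_W_le[of l s t] power_increasing[of l n k] \<open>l \<le> n\<close> k_pos by simp
        then show "?ax t * card (W l s t) \<le> k * k ^ n"
          using card_axis_le[OF \<open>\<tau> < 2\<close>] by (intro mult_le_mono)
      qed
      then show "c s \<le> N * N * k * k ^ n" by simp
    qed
    then have "(\<Sum>s<N*N. U \<sigma> s * (H \<sigma> div B ^ s mod B)) = (\<Sum>s<N*N. card (axis \<sigma> s) * c s)"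
      unfolding H by (intro sum.cong HOL.refl) (simp add: digit_sum U_eq \<sigma>)
    also have "\<dots> = card (reflected \<sigma>)"
      unfolding card_reflected[OF \<sigma> l \<tau>] c_def sum_distrib_left ..
    finally show ?thesis .
  qed
  have "0 < N * N" by simp
  then have "E = (\<Sum>s<N*N. U 0 s * (H 0 div B ^ s mod B)) + (\<Sum>s<N*N. U 1 s * (H 1 div B ^ s mod B))"
    unfolding E_def mult_2 sum_lessThan_add
    by (intro arg_cong2[of _ _ _ _ "(+)"] sum.cong HOL.refl) simp_all
  then show ?thesis using part[of 0] part[of 1] by simp
qed

section \<open>Words fixed by a rotation, and the total over the dihedral group\<close>

definition above :: "nat list set" where
  "above = {v \<in> words_of n. cyc v \<and> cyc (rev v)}"

lemma above_ne: "v \<in> words_of n \<Longrightarrow> v \<noteq> []"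
  using n_pos by (auto simp: words_def)

lemma past_ext:
  assumes v: "v \<in> words_of n"
  shows "past (ext v) i = val k (rev (rotate (nat (i mod int n)) v))"
proof -
  let ?w = "rev (rotate (nat (i mod int n)) v)"
  have len: "length v = n" "v \<noteq> []" using v above_ne by (auto simp: words_def)
  have "?w ! t = ext v (i - 1 - int t)" if "t < n" for t
  proof -
    have "?w ! t = ext v (- 1 - int t + i mod int n)"
      using ext_nth[of t ?w] that len n_pos by (simp add: ext_rev ext_rotate)
    also have "\<dots> = ext v (i - 1 - int t)"
      using len by (simp add: ext_def) (metis (no_types, lifting) mod_add_right_eq
        ab_semigroup_add_class.add_ac(1) add.commute diff_conv_add_uminus uminus_add_conv_diff)
    finally show ?thesis .
  qed
  moreover have "length ?w = n" using len by simp
  ultimately show ?thesis unfolding past_def val_def by (metis (no_types, lifting) num_cong)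
qed

lemma cyc_iff_val: "v \<in> words_of n \<Longrightarrow> cyc v \<longleftrightarrow> (\<forall>r. x \<le> val k (rotate r (rev v)))"
proof -
  assume v: "v \<in> words_of n"
  have len: "length v = n" using v by (simp add: words_def)
  have "cyc v \<longleftrightarrow> (\<forall>r. x \<le> val k (rev (rotate r v)))"
  proof
    assume c: "cyc v"
    show "\<forall>r. x \<le> val k (rev (rotate r v))"
    proof
      fix r
      have "rotate r v = rotate (nat (int r mod int n)) v"
        using len by (simp add: rotate_conv_mod[of r] nat_mod_distrib)
      then show "x \<le> val k (rev (rotate r v))"
        using c past_ext[OF v, of "int r"] unfolding cyc_def by metis
    qed
  qed (simp add: cyc_def past_ext[OF v])
  also have "\<dots> \<longleftrightarrow> (\<forall>r. x \<le> val k (rotate r (rev v)))"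
    by (metis rev_rotate rev_rev_ident)
  finally show ?thesis .
qed

text \<open>The two directions of cyclic readings together are all dihedral images. This links the
  automaton to orbits and makes \<open>above\<close> a union of orbits.\<close>

lemma above_iff: "v \<in> above \<longleftrightarrow> v \<in> words_of n \<and> (\<forall>u. bracelet_equiv v u \<longrightarrow> x \<le> val k u)"
proof -
  have "rev v \<in> words_of n" if "v \<in> words_of n" using that by (simp add: words_def)
  moreover have "(\<forall>u. bracelet_equiv v u \<longrightarrow> x \<le> val k u) \<longleftrightarrow>
      (\<forall>r. x \<le> val k (rotate r v)) \<and> (\<forall>r. x \<le> val k (rotate r (rev v)))"
    unfolding bracelet_equiv_iff by blast
  ultimately show ?thesis
    by (auto simp: above_def cyc_iff_val)
qed

lemma above_closed: "u \<in> above \<Longrightarrow> bracelet_equiv u v \<Longrightarrow> v \<in> above"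
  using bracelet_equiv_in_words[of u v] bracelet_equiv_trans[of v _ u] by (auto simp: above_iff)

lemma finite_above [simp]: "finite above"
  by (simp add: above_def)

text \<open>A fixed word has period \<open>gcd r n\<close> and is a power of its prefix of that
  length. The condition \<open>cyc\<close> mentions a word only through its periodic extension,
  which the word and the prefix share.\<close>

lemma card_rotation_fixed:
  "card {v \<in> above. rotate r v = v} = tr (gcd r n)"
proof -
  define d where "d = gcd r n"
  have d: "0 < d" "d \<le> n" "d dvd n" "d dvd r" using n_pos by (auto simp: d_def intro: dvd_imp_le)
  have ext_take: "ext (take d v) = ext v" if v: "v \<in> words_of n" "rotate r v = v" for v
  proof
    fix i
    have len: "length v = n" "v \<noteq> []" using v above_ne by (auto simp: words_def)
    have "ext v (i + int d) = ext v i" for i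
      unfolding d_def
      by (rule periodic_gcd) (use len v(2) ext_rotate[of v r] ext_periodic[of v] in auto)
    then have "ext v (i mod int d + int d * (i div int d)) = ext v (i mod int d)"
      by (rule periodic_multiple)
    then have "ext v i = ext v (int (nat (i mod int d)))" using d by simp
    also have "\<dots> = v ! nat (i mod int d)"
      using d len by (intro ext_nth) (simp add: nat_less_iff less_le_trans[of _ "int d"])
    also have "\<dots> = ext (take d v) i"
      using d len by (simp add: ext_def min_absorb2 nat_less_iff)
    finally show "ext (take d v) i = ext v i" by simp
  qed
  have cyc_ext: "cyc u \<longleftrightarrow> cyc v" "cyc (rev u) \<longleftrightarrow> cyc (rev v)"
    if "ext u = ext v" "u \<noteq> []" "v \<noteq> []" for u v
  proof -
    have "ext (rev u) = ext (rev v)" using that by (auto simp: ext_rev)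
    then show "cyc u \<longleftrightarrow> cyc v" "cyc (rev u) \<longleftrightarrow> cyc (rev v)" using that by (simp_all add: cyc_def)
  qed
  have "bij_betw (take d) {v \<in> above. rotate r v = v} {u \<in> words_of d. cyc u \<and> cyc (rev u)}"
  proof (rule bij_betw_imageI)
    show "inj_on (take d) {v \<in> above. rotate r v = v}"
    proof (rule inj_onI)
      fix v w assume "v \<in> {v \<in> above. rotate r v = v}" "w \<in> {v \<in> above. rotate r v = v}" "take d v = take d w"
      then show "v = w"
        using ext_take[of v] ext_take[of w] by (intro ext_eqI) (auto simp: above_def words_def)
    qed
    show "take d ` {v \<in> above. rotate r v = v} = {u \<in> words_of d. cyc u \<and> cyc (rev u)}"
    proof (intro equalityI subsetI)
      fix u assume "u \<in> take d ` {v \<in> above. rotate r v = v}"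
      then obtain v where v: "v \<in> words_of n" "cyc v" "cyc (rev v)" "rotate r v = v" "u = take d v"
        by (auto simp: above_def)
      moreover have "u \<in> words_of d" using v d set_take_subset[of d v] by (auto simp: words_def)
      moreover have "u \<noteq> []" "v \<noteq> []" using v d above_ne by auto
      ultimately show "u \<in> {u \<in> words_of d. cyc u \<and> cyc (rev u)}"
        using cyc_ext[of u v] ext_take[of v] by auto
    next
      fix u assume u: "u \<in> {u \<in> words_of d. cyc u \<and> cyc (rev u)}"
      \<comment> \<open>The word \<open>u\<close> repeated up to length \<open>n\<close>; since
        \<open>d\<close> divides \<open>n\<close>, the extension stays the same, and since
        \<open>d\<close> divides \<open>r\<close>, the rotation fixes it.\<close>
      define v where "v = map (\<lambda>j. ext u (int j)) [0..<n]"
      have len: "length u = d" "u \<noteq> []" using u d by (auto simp: words_def)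
      have lenv: "length v = n" "v \<noteq> []" using n_pos by (auto simp: v_def)
      have ext: "ext v = ext u"
      proof
        fix i
        have "ext v i = v ! nat (i mod int n)" by (simp add: ext_def lenv)
        also have "\<dots> = ext u (i mod int n)" using n_pos by (simp add: v_def nat_less_iff)
        also have "\<dots> = ext u (i mod int n + int n * (i div int n))"
          using len d by (intro ext_periodic_dvd[symmetric]) simp
        finally show "ext v i = ext u i" by simp
      qed
      have "v \<in> words_of n"
        using ext_less[of u] u len by (auto simp: words_def v_def)
      then have "v \<in> above" using u cyc_ext[OF ext] len lenv by (simp add: above_def)
      moreover have "rotate r v = v"
      proof (rule ext_eqI)
        show "ext (rotate r v) = ext v"
          using lenv ext_periodic_dvd[of u "int r"] len d by (auto simp: ext_rotate ext)
      qed simp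
      moreover have "take d v = u"
        by (rule nth_equalityI) (use len lenv d in \<open>auto simp: v_def ext_nth\<close>)
      ultimately show "u \<in> take d ` {v \<in> above. rotate r v = v}" by force
    qed
  qed
  then show ?thesis using tr_eq[of d] d by (simp add: bij_betw_same_card d_def)
qed

definition F :: "nat \<Rightarrow> nat" where
  "F s = card {v \<in> above. rotate s (rev v) = v}"

text \<open>A word fixed by a reflection is a rotation of its reversal, so both directions have the
  same readings.\<close>

lemma F_eq_reflected: "F \<sigma> = card (reflected \<sigma>)"
proof -
  have "cyc (rev v)" if v: "v \<in> words_of n" "rotate \<sigma> (rev v) = v" "cyc v" for v
  proof -
    have rv: "rev v \<in> words_of n" using v by (simp add: words_def)
    obtain s where "rotate s v = rev v" using rotate_back[of \<sigma> "rev v"] v(2) by auto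
    then have "rotate r v = rotate (r + \<sigma>) (rev v)" for r
      using v(2) by (metis rotate_rotate)
    then show ?thesis using v(3) by (simp add: cyc_iff_val[OF v(1)] cyc_iff_val[OF rv])
  qed
  then have "{v \<in> above. rotate \<sigma> (rev v) = v} = reflected \<sigma>"
    by (auto simp: above_def reflected_def)
  then show ?thesis by (simp add: F_def)
qed

lemma F_add_n: "F (s + n) = F s"
proof -
  have "{v \<in> above. rotate (s + n) (rev v) = v} = {v \<in> above. rotate s (rev v) = v}"
  proof (rule Collect_cong)
    fix v
    show "v \<in> above \<and> rotate (s + n) (rev v) = v \<longleftrightarrow> v \<in> above \<and> rotate s (rev v) = v"
      using rotate_add_length[of s "rev v"] by (auto simp: above_def words_def)
  qed
  then show ?thesis by (simp add: F_def)
qed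

text \<open>Reflections in axes two apart are conjugate under a rotation by one.\<close>

lemma F_le_add_2: "F s \<le> F (s + 2)"
  unfolding F_def
proof (rule card_inj_on_le[of "rotate 1"])
  show "inj_on (rotate 1) {v \<in> above. rotate s (rev v) = v}"
    by (rule inj_on_inverseI[of _ "\<lambda>v. rotate (n - 1) v"])
      (use n_pos rotate_add_length[of 0] in \<open>auto simp: rotate_rotate above_def words_def simp del: One_nat_def\<close>)
  show "rotate 1 ` {v \<in> above. rotate s (rev v) = v} \<subseteq> {v \<in> above. rotate (s + 2) (rev v) = v}"
  proof (rule image_subsetI)
    fix v assume v: "v \<in> {v \<in> above. rotate s (rev v) = v}"
    then have len: "length v = n" by (auto simp: above_def words_def)
    have "rotate 1 (rev (rotate 1 v)) = rev v"
      using len n_pos by (cases v) (simp_all add: rotate1_rotate_swap)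
    then have "rotate (s + 2) (rev (rotate 1 v)) = rotate (s + 1) (rev v)"
      by (metis add.assoc one_add_one rotate_rotate)
    also have "\<dots> = rotate 1 (rotate s (rev v))" by (simp only: rotate_rotate add.commute)
    also have "\<dots> = rotate 1 v" using v by simp
    finally have "rotate (s + 2) (rev (rotate 1 v)) = rotate 1 v" .
    moreover have "rotate 1 v \<in> above"
      using v above_closed bracelet_equiv.intros by blast
    ultimately show "rotate 1 v \<in> {v \<in> above. rotate (s + 2) (rev v) = v}" by blast
  qed
qed simp

text \<open>The reverse inequality comes from going on round the circle: \<open>s + 2 * n\<close> is
  reached from \<open>s + 2\<close> in steps of two, and \<open>F\<close> has period
  \<open>n\<close>.\<close>

lemma F_add_2: "F (s + 2) = F s"
proof -
  have mono: "F t \<le> F (t + 2 * j)" for t j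
    by (induction j) (use F_le_add_2 in \<open>auto simp: add.assoc intro: order_trans\<close>)
  have "F (s + 2) \<le> F (s + 2 + 2 * (n - 1))" by (rule mono)
  also have "s + 2 + 2 * (n - 1) = s + n + n" using n_pos by simp
  finally show ?thesis using mono[of s 1] by (simp add: F_add_n)
qed

text \<open>Among \<open>2 * n\<close> consecutive shifts each parity occurs \<open>n\<close> times,
  whatever the parity of \<open>n\<close>.\<close>

lemma sum_F: "2 * (\<Sum>s<n. F s) = n * (F 0 + F 1)"
proof -
  have "(\<Sum>s<2*m. F s) = m * (F 0 + F 1)" for m
  proof (induction m)
    case (Suc m)
    have "F (2 * m) = F 0" "F (2 * m + 1) = F 1"
    proof (induction m)
      case (Suc m)
      { case 1 then show ?case using Suc F_add_2[of "2 * m"] by simp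
      next case 2 then show ?case using Suc F_add_2[of "2 * m + 1"] by simp }
    qed auto
    then show ?case using Suc by (simp add: algebra_simps)
  qed simp
  moreover have "(\<Sum>s<2*n. F s) = 2 * (\<Sum>s<n. F s)"
  proof -
    have "F (n + s) = F s" for s using F_add_n[of s] by (simp add: add.commute)
    then show ?thesis unfolding mult_2 sum_lessThan_add by simp
  qed
  ultimately show ?thesis by simp
qed

text \<open>Twice the orbit-counting sum: by \<open>sum_F\<close>, \<open>n * E\<close> is twice the
  sum over the reflections.\<close>

definition Q :: nat where
  "Q = 2 * (\<Sum>r<n. tr (gcd r n)) + n * E"

theorem Q_eq: "Q = 4 * n * card {v \<in> canonical k n. x \<le> val k v}"
proof -
  have one: "(\<Sum>v\<in>above. of_bool (P v)) = card {v \<in> above. P v}" for P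
    by (simp add: of_bool_def sum.If_cases Int_def)
  have K: "above \<inter> canonical k n = {v \<in> canonical k n. x \<le> val k v}"
  proof (intro equalityI subsetI)
    fix v assume "v \<in> {v \<in> canonical k n. x \<le> val k v}"
    then show "v \<in> above \<inter> canonical k n"
      using le_trans by (auto simp: above_iff canonical_def)
  qed (use bracelet_equiv.refl in \<open>auto simp: above_iff\<close>)
  have "above \<subseteq> words {..<k} n" by (auto simp: above_def)
  then have "(\<Sum>v\<in>above. hits n v v) = 2 * n * card (above \<inter> canonical k n)"
    by (rule burnside) (rule above_closed)
  then have "2 * n * card {v \<in> canonical k n. x \<le> val k v} = (\<Sum>v\<in>above. hits n v v)"
    unfolding K by (rule sym)
  also have "\<dots> = (\<Sum>r<n. card {v \<in> above. rotate r v = v}) + (\<Sum>s<n. F s)"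
    by (simp only: hits_def sum.distrib F_def one[symmetric]) (simp only: sum.swap[of _ above])
  finally have "2 * (2 * n * card {v \<in> canonical k n. x \<le> val k v}) = Q"
    using sum_F by (simp add: Q_def card_rotation_fixed E_eq F_eq_reflected algebra_simps)
  then show ?thesis by simp
qed

end

section \<open>Thresholds and representatives\<close>

definition cnt :: "nat \<Rightarrow> nat \<Rightarrow> nat \<Rightarrow> nat" where
  "cnt k n x = card {v \<in> canonical k n. x \<le> val k v}"

lemma cnt_0: "cnt k n 0 = card (canonical k n)"
  by (simp add: cnt_def)

lemma val_digit:
  assumes "set v \<subseteq> {..<k}" "j < length v"
  shows "val k v div k ^ (length v - 1 - j) mod k = v ! j"
  using assms
proof (induction v arbitrary: j)
  case (Cons c v)
  have k: "0 < k" "c < k" using Cons.prems by auto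
  have less: "val k v < k ^ length v" using Cons.prems by (intro val_less) auto
  show ?case
  proof (cases j)
    case 0
    then show ?thesis using k less by (simp add: val_Cons)
  next
    case (Suc i)
    define m where "m = length v - 1 - i"
    have len: "length v = Suc i + m" using Cons.prems Suc by (simp add: m_def)
    have "c * k ^ length v = c * k ^ i * k * k ^ m"
      by (simp add: len power_add)
    then have "(c * k ^ length v + val k v) div k ^ m = c * k ^ i * k + val k v div k ^ m"
      using k div_mult_self3[of "k ^ m" "c * k ^ i * k" "val k v"] by (simp only:) simp
    then have "val k (c # v) div k ^ m mod k = val k v div k ^ m mod k"
      by (simp add: val_Cons)
    then show ?thesis using Cons Suc by (simp add: m_def)
  qed
qed simp

text \<open>The number of canonical words from \<open>x\<close> on drops exactly at the values of canonical words.\<close>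

lemma canonical_of_threshold:
  assumes pass: "cnt k n 0 < cnt k n x + z" and fail: "\<not> cnt k n 0 < cnt k n (x + 1) + z"
  obtains v where "v \<in> canonical k n" "val k v = x"
    "card {u \<in> canonical k n. val k u < val k v} = z - 1"
proof -
  let ?K = "canonical k n"
  have lt: "cnt k n (x + 1) < cnt k n x" using pass fail by linarith
  have "\<exists>v\<in>?K. val k v = x"
  proof (rule ccontr)
    assume "\<not> ?thesis"
    then have "{v \<in> ?K. x \<le> val k v} = {v \<in> ?K. x + 1 \<le> val k v}"
      by (auto simp: Suc_le_eq order.order_iff_strict)
    then show False using lt by (simp add: cnt_def)
  qed
  then obtain v where v: "v \<in> ?K" "val k v = x" by blast
  have "{v \<in> ?K. x \<le> val k v} = insert v {v \<in> ?K. x + 1 \<le> val k v}"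
  proof (intro equalityI subsetI)
    fix u assume u: "u \<in> {v \<in> ?K. x \<le> val k v}"
    show "u \<in> insert v {v \<in> ?K. x + 1 \<le> val k v}"
    proof (cases "val k u = x")
      case True
      then have "u = v" using val_inj[of u k n v] u v by (simp add: canonical_def)
      then show ?thesis by simp
    qed (use u in auto)
  qed (use v in auto)
  then have "cnt k n x = Suc (cnt k n (x + 1))"
    using v by (simp add: cnt_def finite_canonical)
  moreover have "?K = {u \<in> ?K. val k u < x} \<union> {u \<in> ?K. x \<le> val k u}" by auto
  then have "card ?K = card {u \<in> ?K. val k u < x} + cnt k n x"
    unfolding cnt_def
    by (subst card_Un_disjoint[symmetric]) (auto simp: finite_canonical)
  \<comment> \<open>Fewer than \<open>z\<close> canonical words lie below \<open>x\<close> and at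
    least \<open>z\<close> below \<open>x + 1\<close>. The two counts differ only by
    \<open>v\<close>, so exactly \<open>z - 1\<close> lie below \<open>x\<close>.\<close>
  ultimately have "card {u \<in> ?K. val k u < x} = z - 1"
    using pass fail by (simp add: cnt_0)
  with v that show ?thesis by blast
qed

section \<open>Transfer from symbol indices to symbols\<close>

context
  fixes \<Sigma> :: "'a::linorder set"
  assumes fin: "finite \<Sigma>"
begin

definition sym :: "nat \<Rightarrow> 'a" where
  "sym i = sorted_list_of_set \<Sigma> ! i"

definition class_of :: "nat \<Rightarrow> nat list \<Rightarrow> 'a list set" where
  "class_of n v = bracelet_rel \<Sigma> n `` {map sym v}"

lemma sym_mono: "strict_mono_on {..<card \<Sigma>} sym"
  by (rule strict_mono_onI)
    (simp add: sym_def sorted_wrt_nth_less[OF strict_sorted_list_of_set])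

lemma sym_range: "sym ` {..<card \<Sigma>} = \<Sigma>"
proof -
  have "set (sorted_list_of_set \<Sigma>) = sym ` {..<card \<Sigma>}"
    unfolding set_conv_nth by (auto simp: sym_def)
  then show ?thesis using fin by simp
qed

lemma sym_in: "i < card \<Sigma> \<Longrightarrow> sym i \<in> \<Sigma>"
  using sym_range by blast

lemma map_sym_words: "map sym ` words {..<card \<Sigma>} n = words \<Sigma> n"
proof (intro equalityI subsetI)
  fix w assume w: "w \<in> words \<Sigma> n"
  then have "set w \<subseteq> sym ` {..<card \<Sigma>}" by (simp add: sym_range words_def)
  then have "w \<in> lists (sym ` {..<card \<Sigma>})" by auto
  then obtain v where "w = map sym v" "v \<in> lists {..<card \<Sigma>}"
    unfolding lists_image by auto
  then show "w \<in> map sym ` words {..<card \<Sigma>} n" using w by (force simp: words_def)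
qed (fastforce simp: words_def intro: sym_in)

lemma class_of_iff:
  "v \<in> words {..<card \<Sigma>} n \<Longrightarrow> w \<in> class_of n v \<longleftrightarrow> (\<exists>u. bracelet_equiv v u \<and> w = map sym u)"
proof -
  assume v: "v \<in> words {..<card \<Sigma>} n"
  then have mv: "map sym v \<in> words \<Sigma> n" using map_sym_words by blast
  have "bracelet_equiv (map sym v) w \<longleftrightarrow> (\<exists>u. bracelet_equiv v u \<and> w = map sym u)"
    by (auto simp: bracelet_equiv_iff rotate_map rev_map)
  then show ?thesis using mv bracelet_equiv_in_words[of "map sym v" w \<Sigma> n]
    by (auto simp: class_of_def bracelet_rel_def)
qed

lemma class_of_in: "v \<in> words {..<card \<Sigma>} n \<Longrightarrow> class_of n v \<in> bracelets \<Sigma> n"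
  unfolding class_of_def bracelets_def by (rule quotientI) (use map_sym_words in blast)

lemma map_sym_less_iff:
  "u \<in> words {..<card \<Sigma>} n \<Longrightarrow> v \<in> words {..<card \<Sigma>} n \<Longrightarrow>
    map sym u < map sym v \<longleftrightarrow> val (card \<Sigma>) u < val (card \<Sigma>) v"
  by (rule val_less_iff[OF _ _ _ sym_mono]) (auto simp: words_def)

lemma representative_class_of:
  assumes v: "v \<in> canonical (card \<Sigma>) n"
  shows "representative (class_of n v) = map sym v"
proof -
  have vw: "v \<in> words {..<card \<Sigma>} n" using v by (simp add: canonical_def)
  have le: "map sym v \<le> w" if w: "w \<in> class_of n v" for w
  proof -
    obtain u where u: "bracelet_equiv v u" "w = map sym u" using w unfolding class_of_iff[OF vw] by blast
    then have "u \<in> words {..<card \<Sigma>} n" using vw bracelet_equiv_in_words[OF u(1), of "{..<card \<Sigma>}" n] by simp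
    then show ?thesis
      using map_sym_less_iff[of u n v] v u vw by (simp add: canonical_def not_less[symmetric])
  qed
  have "map sym v \<in> class_of n v" unfolding class_of_iff[OF vw] using bracelet_equiv.refl[of v] by blast
  moreover have "finite (class_of n v)"
    by (rule finite_subset[OF _ finite_words[OF fin, of n]]) (auto simp: class_of_def bracelet_rel_def)
  ultimately show ?thesis unfolding representative_def by (intro Min_eqI) (use le in auto)
qed

lemma bracelets_eq: "bracelets \<Sigma> n = class_of n ` canonical (card \<Sigma>) n"
proof (intro equalityI subsetI)
  fix b assume b: "b \<in> bracelets \<Sigma> n"
  note r = representative_in[OF fin b]
  have sub: "b \<subseteq> words \<Sigma> n" using b by (auto simp: bracelets_def quotient_def bracelet_rel_def)
  then have finb: "finite b" using finite_words[OF fin] finite_subset by blast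
  obtain v where v: "v \<in> words {..<card \<Sigma>} n" "representative b = map sym v"
    using r sub map_sym_words[of n] by blast
  have beq: "b = class_of n v"
  proof -
    from b obtain a where a: "b = bracelet_rel \<Sigma> n `` {a}"
      unfolding bracelets_def by (rule quotientE)
    then have "(a, map sym v) \<in> bracelet_rel \<Sigma> n" using r v(2) by simp
    then show ?thesis unfolding a class_of_def by (rule equiv_class_eq[OF equiv_bracelet_rel])
  qed
  have "val (card \<Sigma>) v \<le> val (card \<Sigma>) u" if u: "bracelet_equiv v u" for u
  proof -
    have uw: "u \<in> words {..<card \<Sigma>} n" using v(1) bracelet_equiv_in_words[OF u, of "{..<card \<Sigma>}" n] by simp
    have "map sym u \<in> b" unfolding beq class_of_iff[OF v(1)] using u by blast
    then have "map sym v \<le> map sym u" using finb v(2) by (metis Min_le representative_def)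
    then show ?thesis using map_sym_less_iff[OF uw v(1)] by auto
  qed
  then have "v \<in> canonical (card \<Sigma>) n" using v by (simp add: canonical_def)
  then show "b \<in> class_of n ` canonical (card \<Sigma>) n" using beq by blast
qed (auto intro: class_of_in simp: canonical_def)

lemma inj_on_class_of: "inj_on (class_of n) (canonical (card \<Sigma>) n)"
proof (rule inj_onI)
  fix u v assume uv: "u \<in> canonical (card \<Sigma>) n" "v \<in> canonical (card \<Sigma>) n" "class_of n u = class_of n v"
  then have "map sym u = map sym v" using representative_class_of by metis
  then have "\<not> val (card \<Sigma>) u < val (card \<Sigma>) v" "\<not> val (card \<Sigma>) v < val (card \<Sigma>) u"
    using map_sym_less_iff[of u n v] map_sym_less_iff[of v n u] uv(1,2) by (simp_all add: canonical_def)
  then show "u = v" using uv(1,2) val_inj[of u "card \<Sigma>" n v] by (simp add: canonical_def)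
qed

lemma card_bracelets: "card (bracelets \<Sigma> n) = card (canonical (card \<Sigma>) n)"
  unfolding bracelets_eq by (rule card_image[OF inj_on_class_of])

lemma is_zth_class_of:
  assumes v: "v \<in> canonical (card \<Sigma>) n" and "1 \<le> z"
    and card: "card {u \<in> canonical (card \<Sigma>) n. val (card \<Sigma>) u < val (card \<Sigma>) v} = z - 1"
  shows "is_zth_bracelet \<Sigma> n z (class_of n v)"
proof -
  let ?K = "canonical (card \<Sigma>) n"
  have "{b \<in> bracelets \<Sigma> n. representative b < representative (class_of n v)} =
      class_of n ` {u \<in> ?K. val (card \<Sigma>) u < val (card \<Sigma>) v}"
    using v map_sym_less_iff unfolding bracelets_eq
    by (auto simp: representative_class_of canonical_def)
  then have "card {b \<in> bracelets \<Sigma> n. representative b < representative (class_of n v)} = z - 1"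
    using card by (simp add: card_image inj_on_subset[OF inj_on_class_of])
  then show ?thesis
    using v \<open>1 \<le> z\<close> by (auto simp: is_zth_bracelet_def bracelets_eq)
qed

end

section \<open>Programs that fill tables\<close>

text \<open>Upper bounds instead of exact costs, so that both branches of a conditional and all
  rounds of a loop can share one bound.\<close>

definition runs :: "com \<Rightarrow> state \<Rightarrow> nat \<Rightarrow> state \<Rightarrow> bool" where
  "runs c s t s' \<longleftrightarrow> (\<exists>u\<le>t. exec c s u s')"

abbreviation setv :: "state \<Rightarrow> string \<Rightarrow> int \<Rightarrow> state" where
  "setv s x v \<equiv> s\<lparr>vars := (vars s)(x := v)\<rparr>"

lemma runs_mono: "runs c s t s' \<Longrightarrow> t \<le> t' \<Longrightarrow> runs c s t' s'"
  unfolding runs_def by (meson le_trans)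

lemma runs_Skip: "runs Skip s 1 s"
  unfolding runs_def using exec.Skip by blast

lemma runs_Assign: "runs (Assign x e) s (acost e + 1) (setv s x (aval e s))"
  unfolding runs_def using exec.Assign by blast

lemma runs_Write: "runs (Write a i e) s (acost i + acost e + 1)
    (s\<lparr>arrs := (arrs s)(a := (arrs s a)(aval i s := aval e s))\<rparr>)"
  unfolding runs_def using exec.Write by blast

lemma runs_Seq: "runs c1 s t1 s1 \<Longrightarrow> runs c2 s1 t2 s2 \<Longrightarrow> runs (Seq c1 c2) s (t1 + t2) s2"
  unfolding runs_def using exec.Seq add_mono by meson

lemma runs_If:
  assumes "bval b s \<Longrightarrow> runs c1 s t s'" "\<not> bval b s \<Longrightarrow> runs c2 s t s'"
  shows "runs (If b c1 c2) s (bcost b + t + 1) s'"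
proof (cases "bval b s")
  case True
  then obtain u where "u \<le> t" "exec c1 s u s'" using assms by (auto simp: runs_def)
  then show ?thesis
    using exec.IfTrue[OF True, of c1 u s' c2] unfolding runs_def by (intro exI[of _ "bcost b + u + 1"]) auto
next
  case False
  then obtain u where "u \<le> t" "exec c2 s u s'" using assms by (auto simp: runs_def)
  then show ?thesis
    using exec.IfFalse[OF False, of c2 u s' c1] unfolding runs_def by (intro exI[of _ "bcost b + u + 1"]) auto
qed

lemma runs_While_step:
  assumes b: "bval b s" and "runs c s t1 s1" "runs (While b c) s1 t2 s2"
  shows "runs (While b c) s (bcost b + t1 + t2 + 1) s2"
proof -
  obtain u1 u2 where "u1 \<le> t1" "exec c s u1 s1" "u2 \<le> t2" "exec (While b c) s1 u2 s2"
    using assms by (auto simp: runs_def)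
  then show ?thesis
    using exec.WhileTrue[OF b, of c u1 s1 u2 s2] unfolding runs_def
    by (intro exI[of _ "bcost b + u1 + u2 + 1"]) auto
qed

definition For :: "string \<Rightarrow> aexp \<Rightarrow> com \<Rightarrow> com" where
  "For i e c = Seq (Assign i (Const 0))
     (While (Less (Var i) e) (Seq c (Assign i (Op Plus (Var i) (Const 1)))))"

text \<open>The invariant speaks about the state after the increment, counter included. One round
  costs \<open>T\<close> for the body, 4 for the increment and \<open>acost e + 3\<close> for the
  test with its control step; the constant 8 is rounded up.\<close>

lemma runs_For:
  assumes start: "I 0 (setv s i 0)"
    and var: "\<And>j r. j \<le> M \<Longrightarrow> I j r \<Longrightarrow> vars r i = int j \<and> aval e r = int M"
    and step: "\<And>j r. j < M \<Longrightarrow> I j r \<Longrightarrow> \<exists>r'. runs c r T r' \<and> I (Suc j) (setv r' i (vars r' i + 1))"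
  shows "\<exists>s'. runs (For i e c) s (M * (T + acost e + 8) + acost e + 8) s' \<and> I M s'"
proof -
  let ?b = "Less (Var i) e"
  let ?c = "Seq c (Assign i (Op Plus (Var i) (Const 1)))"
  have loop: "\<exists>s'. runs (While ?b ?c) r ((M - j) * (T + acost e + 8) + acost e + 3) s' \<and> I M s'"
    if "j \<le> M" "I j r" for j r
    using that
  proof (induction j arbitrary: r rule: inc_induct)
    case base
    then have "\<not> bval ?b r" using var[of M r] by simp
    then have "runs (While ?b ?c) r (bcost ?b + 1) r"
      using exec.WhileFalse[of ?b r ?c] unfolding runs_def by blast
    then have "runs (While ?b ?c) r (acost e + 3) r" by (rule runs_mono) simp
    then show ?case using base by auto
  next
    case (step j)
    obtain r1 where r1: "runs c r T r1" "I (Suc j) (setv r1 i (vars r1 i + 1))"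
      using assms(3)[of j r] step by blast
    have "runs ?c r (T + 4) (setv r1 i (vars r1 i + 1))"
      using runs_Seq[OF r1(1) runs_Assign[of i "Op Plus (Var i) (Const 1)" r1]]
      by (simp add: eval_nat_numeral)
    moreover obtain s' where s': "runs (While ?b ?c) (setv r1 i (vars r1 i + 1))
        ((M - Suc j) * (T + acost e + 8) + acost e + 3) s'" "I M s'"
      using step.IH[OF r1(2)] by blast
    moreover have "bval ?b r" using var[of j r] step by simp
    ultimately have "runs (While ?b ?c) r (bcost ?b + (T + 4) + ((M - Suc j) * (T + acost e + 8) + acost e + 3) + 1) s'"
      by (intro runs_While_step)
    moreover have "M - j = Suc (M - Suc j)" using step.hyps by simp
    ultimately have "runs (While ?b ?c) r ((M - j) * (T + acost e + 8) + acost e + 3) s'"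
      by (elim runs_mono) simp
    with s'(2) show ?case by blast
  qed
  obtain s' where s': "runs (While ?b ?c) (setv s i 0) (M * (T + acost e + 8) + acost e + 3) s'" "I M s'"
    using loop[OF _ start] by auto
  have "runs (Assign i (Const 0)) s 2 (setv s i 0)"
    using runs_Assign[of i "Const 0" s] by (simp add: numeral_2_eq_2)
  from runs_Seq[OF this s'(1)] have "runs (For i e c) s (M * (T + acost e + 8) + acost e + 8) s'"
    unfolding For_def by (rule runs_mono) simp
  with s'(2) show ?thesis by blast
qed

text \<open>Nearly every stage fills an array segment with guarded sums, so one correctness proof
  covers them. A sum of length one serves as a plain assignment.\<close>

definition Table :: "string \<Rightarrow> aexp \<Rightarrow> aexp \<Rightarrow> aexp \<Rightarrow> bexp \<Rightarrow> aexp \<Rightarrow> com" where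
  "Table a base em en g e = For ''i'' em (Seq (Assign ''acc'' (Const 0))
     (Seq (For ''m'' en (If g (Assign ''acc'' (Op Plus (Var ''acc'') e)) Skip))
       (Write a (Op Plus base (Var ''i'')) (Var ''acc''))))"

definition sim :: "state \<Rightarrow> state \<Rightarrow> bool" where
  "sim s r \<longleftrightarrow> (\<forall>v. v \<notin> {''i'', ''m'', ''acc''} \<longrightarrow> vars r v = vars s v)"

definition filled :: "state \<Rightarrow> string \<Rightarrow> int \<Rightarrow> (nat \<Rightarrow> int) \<Rightarrow> nat \<Rightarrow> state \<Rightarrow> bool" where
  "filled s a b F i r \<longleftrightarrow> sim s r \<and> (\<forall>a'. a' \<noteq> a \<longrightarrow> arrs r a' = arrs s a') \<and>
     (\<forall>j<i. arrs r a (b + int j) = F j) \<and> (\<forall>j. j < b \<or> b + int i \<le> j \<longrightarrow> arrs r a j = arrs s a j)"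

lemma filled_setv: "v \<in> {''i'', ''m'', ''acc''} \<Longrightarrow> filled s a b F i (setv r v y) = filled s a b F i r"
  by (auto simp: filled_def sim_def)

definition table_const :: "aexp \<Rightarrow> aexp \<Rightarrow> aexp \<Rightarrow> bexp \<Rightarrow> aexp \<Rightarrow> nat" where
  "table_const base em en g e = acost base + acost em + acost en + bcost g + acost e + 40"

text \<open>The assumption on a cell may use that all cells before it are filled. Hence tables
  defined by a recurrence, such as powers and the dynamic program, fall under the same
  lemma.\<close>

lemma runs_Table:
  assumes em: "\<And>r. sim s r \<Longrightarrow> aval em r = int M" and en: "\<And>r. sim s r \<Longrightarrow> aval en r = int K"
    and base: "\<And>r. sim s r \<Longrightarrow> aval base r = b"
    and cell: "\<And>i m r. i < M \<Longrightarrow> m < K \<Longrightarrow> filled s a b F i r \<Longrightarrow>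
      vars r ''i'' = int i \<Longrightarrow> vars r ''m'' = int m \<Longrightarrow> (if bval g r then aval e r else 0) = f i m"
    and F: "\<And>i. i < M \<Longrightarrow> F i = (\<Sum>m<K. f i m)"
  shows "\<exists>s'. runs (Table a base em en g e) s (table_const base em en g e * ((M + 1) * (K + 1))) s'
    \<and> filled s a b F M s'"
proof -
  define \<kappa> where "\<kappa> = bcost g + acost e + 10"
  let ?If = "If g (Assign ''acc'' (Op Plus (Var ''acc'') e)) Skip"
  let ?inner = "For ''m'' en ?If"
  let ?write = "Write a (Op Plus base (Var ''i'')) (Var ''acc'')"
  define I where "I i r \<longleftrightarrow> filled s a b F i r \<and> vars r ''i'' = int i" for i r
  define J where "J i m r \<longleftrightarrow> I i r \<and> vars r ''m'' = int m \<and> vars r ''acc'' = (\<Sum>l<m. f i l)" for i m r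
  have inner: "\<exists>r'. runs ?inner r (K * (\<kappa> + acost en + 8) + acost en + 8) r' \<and> J i K r'"
    if i: "i < M" and r: "I i r" "vars r ''acc'' = 0" for i r
  proof (rule runs_For)
    show "J i 0 (setv r ''m'' 0)" using r by (simp add: J_def I_def filled_setv)
    show "vars r ''m'' = int m \<and> aval en r = int K" if "J i m r" for m r
      using that en by (auto simp: J_def I_def filled_def)
    show "\<exists>r'. runs ?If r \<kappa> r' \<and> J i (Suc m) (setv r' ''m'' (vars r' ''m'' + 1))"
      if m: "m < K" and r: "J i m r" for m r
    proof -
      have c: "(if bval g r then aval e r else 0) = f i m"
        using cell[OF i m] r by (simp add: J_def I_def)
      let ?r = "if bval g r then setv r ''acc'' (vars r ''acc'' + aval e r) else r"
      have "runs ?If r (bcost g + (acost e + 3) + 1) ?r"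
      proof (rule runs_If)
        assume "bval g r"
        then show "runs (Assign ''acc'' (Op Plus (Var ''acc'') e)) r (acost e + 3) ?r"
          using runs_Assign[of "''acc''" "Op Plus (Var ''acc'') e" r] by (simp add: numeral_3_eq_3)
      next
        assume "\<not> bval g r"
        then show "runs Skip r (acost e + 3) ?r" using runs_mono[OF runs_Skip] by simp
      qed
      then have "runs ?If r \<kappa> ?r" by (rule runs_mono) (simp add: \<kappa>_def)
      moreover have "J i (Suc m) (setv ?r ''m'' (vars ?r ''m'' + 1))"
        using r c by (cases "bval g r") (simp_all add: J_def I_def filled_def sim_def)
      ultimately show ?thesis by blast
    qed
  qed
  let ?T = "2 + (K * (\<kappa> + acost en + 8) + acost en + 8 + (acost base + 4))"
  have "\<exists>s'. runs (Table a base em en g e) s (M * (?T + acost em + 8) + acost em + 8) s' \<and> I M s'"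
    unfolding Table_def
  proof (rule runs_For)
    show "I 0 (setv s ''i'' 0)" by (simp add: I_def filled_def sim_def)
    show "vars r ''i'' = int i \<and> aval em r = int M" if "I i r" for i r
      using that em by (auto simp: I_def filled_def)
    show "\<exists>r'. runs (Seq (Assign ''acc'' (Const 0)) (Seq ?inner ?write)) r ?T r' \<and>
        I (Suc i) (setv r' ''i'' (vars r' ''i'' + 1))"
      if i: "i < M" and r: "I i r" for i r
    proof -
      have 1: "runs (Assign ''acc'' (Const 0)) r 2 (setv r ''acc'' 0)"
        using runs_Assign[of "''acc''" "Const 0" r] by (simp add: numeral_2_eq_2)
      have "I i (setv r ''acc'' 0)" using r by (simp add: I_def filled_setv)
      then obtain r2 where r2: "runs ?inner (setv r ''acc'' 0) (K * (\<kappa> + acost en + 8) + acost en + 8) r2" "J i K r2"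
        using inner[OF i, of "setv r ''acc'' 0"] by auto
      have "sim s r2" using r2(2) by (simp add: J_def I_def filled_def)
      then have av: "aval (Op Plus base (Var ''i'')) r2 = b + int i" "aval (Var ''acc'') r2 = F i"
        using base r2(2) F[OF i] by (simp_all add: J_def I_def)
      let ?r3 = "r2\<lparr>arrs := (arrs r2)(a := (arrs r2 a)(b + int i := F i))\<rparr>"
      have 3: "runs ?write r2 (acost base + 4) ?r3"
        using runs_Write[of a "Op Plus base (Var ''i'')" "Var ''acc''" r2] unfolding av
        by (rule runs_mono) simp
      have "runs (Seq (Assign ''acc'' (Const 0)) (Seq ?inner ?write)) r ?T ?r3"
        by (rule runs_Seq[OF 1 runs_Seq[OF r2(1) 3]])
      moreover have "I (Suc i) (setv ?r3 ''i'' (vars ?r3 ''i'' + 1))"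
        using r2(2) by (auto simp: J_def I_def filled_def sim_def less_Suc_eq)
      ultimately show ?thesis by blast
    qed
  qed
  then obtain s' where s': "runs (Table a base em en g e) s (M * (?T + acost em + 8) + acost em + 8) s'" "I M s'"
    by blast
  have "M * (?T + acost em + 8) + acost em + 8 \<le> table_const base em en g e * ((M + 1) * (K + 1))"
    unfolding table_const_def \<kappa>_def by (simp add: algebra_simps)
  then show ?thesis using runs_mono[OF s'(1)] s'(2) by (auto simp: I_def)
qed

section \<open>Evaluating one threshold\<close>

abbreviation (input) op_add (infixl "\<oplus>" 65) where "a \<oplus> b \<equiv> Op Plus a b"
abbreviation (input) op_sub (infixl "\<ominus>" 65) where "a \<ominus> b \<equiv> Op Minus a b"
abbreviation (input) op_mul (infixl "\<otimes>" 70) where "a \<otimes> b \<equiv> Op Times a b"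
abbreviation (input) op_div (infixl "\<oslash>" 70) where "a \<oslash> b \<equiv> Op Div a b"
abbreviation (input) op_mod (infixl "\<odot>" 70) where "a \<odot> b \<equiv> Op Mod a b"

abbreviation (input) "v_n \<equiv> Var ''n''"
abbreviation (input) "v_k \<equiv> Var ''k''"
abbreviation (input) "v_y \<equiv> Var ''y''"
abbreviation (input) "v_i \<equiv> Var ''i''"
abbreviation (input) "v_m \<equiv> Var ''m''"
abbreviation (input) "always \<equiv> Less (Const 0) (Const 1)"

definition e_N where "e_N = v_n \<oplus> Const 1"
definition e_NN where "e_NN = e_N \<otimes> e_N"
definition e_B where "e_B = e_NN \<otimes> v_k \<otimes> Read ''pw'' v_n \<oplus> Const 1"

definition upd :: "state \<Rightarrow> string \<Rightarrow> state \<Rightarrow> bool" where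
  "upd s a s' \<longleftrightarrow> sim s s' \<and> (\<forall>a'. a' \<noteq> a \<longrightarrow> arrs s' a' = arrs s a')"

definition holds :: "string \<Rightarrow> nat \<Rightarrow> (nat \<Rightarrow> nat) \<Rightarrow> state \<Rightarrow> bool" where
  "holds a L F s \<longleftrightarrow> (\<forall>j<L. arrs s a (int j) = int (F j))"

lemma holds_upd: "holds b L F s \<Longrightarrow> upd s a s' \<Longrightarrow> b \<noteq> a \<Longrightarrow> holds b L F s'"
  by (simp add: holds_def upd_def)

lemma holds_read: "holds a L F s \<Longrightarrow> j < L \<Longrightarrow> arrs s a (int j) = int (F j)"
  by (simp add: holds_def)

text \<open>Wrapping the equation lets \<open>ev_intros\<close> evaluate expressions by resolution
  along their syntax; the only side conditions are that differences are nonnegative and that array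
  indices are in range.\<close>

definition ev :: "aexp \<Rightarrow> state \<Rightarrow> nat \<Rightarrow> bool" where
  "ev e r p \<longleftrightarrow> aval e r = int p"

definition bev :: "bexp \<Rightarrow> state \<Rightarrow> bool \<Rightarrow> bool" where
  "bev b r P \<longleftrightarrow> bval b r = P"

lemma ev_Var: "vars r v = int p \<Longrightarrow> ev (Var v) r p"
  by (simp add: ev_def)

lemma ev_Read: "holds a L F r \<Longrightarrow> ev e r j \<Longrightarrow> j < L \<Longrightarrow> ev (Read a e) r (F j)"
  by (simp add: ev_def holds_def)

lemma ev_intros:
  "ev (Const 0) r 0" "ev (Const 1) r 1" "ev (Const 2) r 2"
  "ev a r p \<Longrightarrow> ev b r q \<Longrightarrow> ev (a \<oplus> b) r (p + q)"
  "ev a r p \<Longrightarrow> ev b r q \<Longrightarrow> q \<le> p \<Longrightarrow> ev (a \<ominus> b) r (p - q)"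
  "ev a r p \<Longrightarrow> ev b r q \<Longrightarrow> ev (a \<otimes> b) r (p * q)"
  "ev a r p \<Longrightarrow> ev b r q \<Longrightarrow> ev (a \<oslash> b) r (p div q)"
  "ev a r p \<Longrightarrow> ev b r q \<Longrightarrow> ev (a \<odot> b) r (p mod q)"
  "ev a r p \<Longrightarrow> ev b r q \<Longrightarrow> bev (Less a b) r (p < q)"
  "ev a r p \<Longrightarrow> ev b r q \<Longrightarrow> bev (Equal a b) r (p = q)"
  "bev b1 r P \<Longrightarrow> bev (Not b1) r (\<not> P)"
  "bev b1 r P \<Longrightarrow> bev b2 r P' \<Longrightarrow> bev (And b1 b2) r (P \<and> P')"
  by (simp_all add: ev_def bev_def zdiv_int zmod_int)

lemma cellI:
  "bev g r P \<Longrightarrow> ev e r p \<Longrightarrow> (if P then p else 0) = f \<Longrightarrow> (if bval g r then aval e r else 0) = int f"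
  by (auto simp: bev_def ev_def)

text \<open>The part below \<open>b\<close> is assumed to be correct already, so a table can be
  continued by a second program. The constant 300 is a common bound for all tables.\<close>

lemma runs_Table_nat:
  assumes em: "\<And>r. sim s r \<Longrightarrow> ev em r M" and en: "\<And>r. sim s r \<Longrightarrow> ev en r K"
    and base: "\<And>r. sim s r \<Longrightarrow> ev base r b"
    and const: "table_const base em en g e \<le> 300"
    and F: "\<And>i. i < M \<Longrightarrow> F (b + i) = (\<Sum>m<K. f i m)"
    and init: "holds a b F s"
    and cell: "\<And>i m r. i < M \<Longrightarrow> m < K \<Longrightarrow> upd s a r \<Longrightarrow> holds a (b + i) F r \<Longrightarrow>
      vars r ''i'' = int i \<Longrightarrow> vars r ''m'' = int m \<Longrightarrow> (if bval g r then aval e r else 0) = int (f i m)"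
  shows "\<exists>s'. runs (Table a base em en g e) s (300 * ((M + 1) * (K + 1))) s'
    \<and> upd s a s' \<and> holds a (b + M) F s'"
proof -
  have holds: "holds a (b + i) F r" if "filled s a (int b) (\<lambda>i. int (F (b + i))) i r" for i r
    unfolding holds_def
  proof (intro allI impI)
    fix j assume "j < b + i"
    show "arrs r a (int j) = int (F j)"
    proof (cases "j < b")
      case True
      then show ?thesis using that init by (simp add: filled_def holds_def)
    next
      case False
      then obtain l where "j = b + l" by (metis le_Suc_ex not_less)
      then show ?thesis using that \<open>j < b + i\<close> by (simp add: filled_def)
    qed
  qed
  have "\<exists>s'. runs (Table a base em en g e) s (table_const base em en g e * ((M + 1) * (K + 1))) s'
      \<and> filled s a (int b) (\<lambda>i. int (F (b + i))) M s'"
    by (rule runs_Table[OF em[unfolded ev_def] en[unfolded ev_def] base[unfolded ev_def], where f = "\<lambda>i m. int (f i m)"])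
      (use cell holds F in \<open>auto simp: filled_def upd_def\<close>)
  moreover have "table_const base em en g e * ((M + 1) * (K + 1)) \<le> 300 * ((M + 1) * (K + 1))"
    by (rule mult_le_mono1[OF const])
  ultimately obtain s' where s': "runs (Table a base em en g e) s (300 * ((M + 1) * (K + 1))) s'"
      "filled s a (int b) (\<lambda>i. int (F (b + i))) M s'"
    using runs_mono by blast
  then show ?thesis using holds[OF s'(2)] by (auto simp: filled_def upd_def)
qed

definition "c_R = Table ''R'' (Const 0) e_N v_n
  (Not (Less (v_y \<odot> Read ''pw'' (v_n \<ominus> v_i) \<otimes> Read ''pw'' v_i)
    (v_y \<odot> Read ''pw'' (v_n \<ominus> v_m) \<otimes> Read ''pw'' v_m))) (Const 1)"

definition "e_dig = v_y \<oslash> Read ''pw'' (v_n \<ominus> Const 1 \<ominus> v_m) \<odot> v_k"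

text \<open>The nested negations are a disjunction, which the guards can only express by De
  Morgan.\<close>

definition "c_del = Table ''del'' (Const 0) (e_N \<otimes> v_k) v_n
  (Not (And (Not (Less e_dig (v_i \<odot> v_k)))
    (Not (And (Equal e_dig (v_i \<odot> v_k)) (Not (Less (v_i \<oslash> v_k) (Read ''R'' (v_m \<oplus> Const 1)))))))) (Const 1)"

definition "c_U0 = Table ''U'' (Const 0) e_NN (Const 1) (Equal (v_i \<oslash> e_N) (v_i \<odot> e_N)) (Const 1)"

definition "c_U1 = Table ''U'' e_NN e_NN v_k
  (Equal (Read ''del'' (v_i \<odot> e_N \<otimes> v_k \<oplus> v_m)) (v_i \<oslash> e_N)) (Const 1)"

definition valid_b :: "aexp \<Rightarrow> bexp" where
  "valid_b e = And (Not (Less (e \<oslash> e_N) (Read ''R'' (Const 0)))) (Not (Less (e \<odot> e_N) (Read ''R'' (Const 0))))"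

definition "c_D0 = Table ''D'' (Const 0) e_NN (Const 1) (valid_b v_i) (Read ''bp'' v_i)"

text \<open>This table determines the running time. Since writing starts at offset
  \<open>N * N\<close>, the cell with counter \<open>i\<close> belongs to layer
  \<open>Suc (i div (N * N))\<close>, and \<open>i div (N * N)\<close> is the layer to read
  from.\<close>

definition "c_D = Table ''D'' e_NN (v_n \<otimes> e_NN) (e_N \<otimes> v_k)
  (And (valid_b (v_i \<odot> e_NN)) (Equal (Read ''del'' v_m) (v_i \<odot> e_NN \<oslash> e_N)))
  (Read ''D'' (v_i \<oslash> e_NN \<otimes> e_NN \<oplus> (v_m \<oslash> v_k \<otimes> e_N
    \<oplus> Read ''del'' (v_i \<odot> e_NN \<odot> e_N \<otimes> v_k \<oplus> v_m \<odot> v_k))))"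

definition "c_tr = Table ''tr'' (Const 0) e_N e_NN always
  (Read ''D'' (v_i \<otimes> e_NN \<oplus> v_m) \<oslash> Read ''bp'' v_m \<odot> e_B)"

definition "c_H = Table ''H'' (Const 0) (Const 2) e_NN always
  (Read ''U'' ((v_n \<ominus> v_i) \<odot> Const 2 \<otimes> e_NN \<oplus> (v_m \<odot> e_N \<otimes> e_N \<oplus> v_m \<oslash> e_N))
    \<otimes> Read ''D'' ((v_n \<ominus> v_i) \<oslash> Const 2 \<otimes> e_NN \<oplus> v_m))"

definition "c_Q0 = Table ''q'' (Const 0) (Const 1) v_n always (Const 2 \<otimes> Read ''tr'' (Read ''gcd'' v_m))"

definition "c_Q1 = Table ''q'' (Const 1) (Const 1) (Const 2 \<otimes> e_NN) always
  (v_n \<otimes> (Read ''U'' v_m \<otimes> (Read ''H'' (v_m \<oslash> e_NN) \<oslash> Read ''bp'' (v_m \<odot> e_NN) \<odot> e_B)))"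


section \<open>Correctness of the tables for one threshold\<close>

context threshold
begin

definition env :: "state \<Rightarrow> bool" where
  "env s \<longleftrightarrow> vars s ''n'' = int n \<and> vars s ''k'' = int k \<and> vars s ''y'' = int x \<and>
     holds ''pw'' N (\<lambda>j. k ^ j) s \<and> holds ''bp'' (N*N) (\<lambda>t. B ^ t) s \<and> holds ''gcd'' n (\<lambda>r. gcd r n) s"

lemma env_upd: "env s \<Longrightarrow> upd s a s' \<Longrightarrow> a \<notin> {''pw'', ''bp'', ''gcd''} \<Longrightarrow> env s'"
  by (auto simp: env_def intro: holds_upd) (auto simp: upd_def sim_def)

lemma sim_ev:
  assumes "env s" "sim s r"
  shows "ev v_n r n" "ev v_k r k" "ev e_N r N" "ev e_NN r (N * N)"
  using assms by (simp_all add: env_def sim_def ev_def e_N_def e_NN_def N_def algebra_simps)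

lemma env_ev:
  assumes "env r"
  shows "ev v_n r n" "ev v_k r k" "ev v_y r x" "ev e_N r N" "ev e_NN r (N * N)" "ev e_B r B"
    "holds ''pw'' N (\<lambda>j. k ^ j) r" "holds ''bp'' (N*N) (\<lambda>t. B ^ t) r" "holds ''gcd'' n (\<lambda>r. gcd r n) r"
proof -
  show *: "ev v_n r n" "ev v_k r k" "ev v_y r x" "holds ''pw'' N (\<lambda>j. k ^ j) r"
    "holds ''bp'' (N*N) (\<lambda>t. B ^ t) r" "holds ''gcd'' n (\<lambda>r. gcd r n) r"
    using assms by (simp_all add: env_def ev_def)
  have "sim r r" by (simp add: sim_def)
  from sim_ev[OF assms this] show **: "ev e_N r N" "ev e_NN r (N * N)" by simp_all
  show "ev e_B r B"
    unfolding e_B_def B_def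
    by (intro ev_intros ** * ev_Read[OF *(4)]) (simp add: N_def)
qed


definition del_tab :: "nat \<Rightarrow> nat" where
  "del_tab i = del (i div k) (i mod k)"

definition U_tab :: "nat \<Rightarrow> nat" where
  "U_tab i = U (i div (N*N)) (i mod (N*N))"

definition D_tab :: "nat \<Rightarrow> nat" where
  "D_tab i = D (i div (N*N)) (i mod (N*N))"

definition q_tab :: "nat \<Rightarrow> nat" where
  "q_tab i = (if i = 0 then 2 * (\<Sum>r<n. tr (gcd r n)) else n * E)"

lemma del_tab: "c < k \<Longrightarrow> del_tab (a * k + c) = del a c"
  by (simp add: del_tab_def)

lemma U_tab: "t < N * N \<Longrightarrow> U_tab (\<sigma> * (N * N) + t) = U \<sigma> t"
  unfolding U_tab_def by simp

lemma D_tab: "t < N * N \<Longrightarrow> D_tab (l * (N * N) + t) = D l t"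
  unfolding D_tab_def by simp

lemma pair_less: "a < p \<Longrightarrow> c < q \<Longrightarrow> a * q + c < p * q" for a c p q :: nat
proof -
  assume "a < p" "c < q"
  then have "Suc a * q \<le> p * q" by (intro mult_le_mono1) simp
  with \<open>c < q\<close> show ?thesis by simp
qed

lemma sim_refl: "sim s s"
  by (simp add: sim_def)

lemma cost_eqs: "acost e_N = 3" "acost e_NN = 7" "acost e_B = 14" "acost e_dig = 10"
  "bcost (valid_b e) = 2 * acost e + 17"
  by (simp_all add: e_N_def e_NN_def e_B_def e_dig_def valid_b_def)

lemma ev_Suc_0: "ev (Const 1) r (Suc 0)"
  by (simp add: ev_def)

lemmas const_simps = table_const_def cost_eqs ev_Suc_0

lemma stage_R:
  assumes s: "env s"
  shows "\<exists>s'. runs c_R s (300 * ((N + 1) * (n + 1))) s' \<and> upd s ''R'' s' \<and> holds ''R'' (0 + N) R s'"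
  unfolding c_R_def
proof (rule runs_Table_nat[where f = "\<lambda>i m. if V m \<le> V i then 1 else 0"])
  fix i m r assume i: "i < N" "m < n" and u: "upd s ''R'' r"
    and "vars r ''i'' = int i" "vars r ''m'' = int m"
  note im = this(4,5)[THEN ev_Var]
  have r: "env r" using env_upd[OF s u] by simp
  have sd: "i \<le> n" "m \<le> n" "n - i < N" "n - m < N" "i < N" "m < N" using i by (auto simp: N_def)
  show "(if bval (Not (Less (v_y \<odot> Read ''pw'' (v_n \<ominus> v_i) \<otimes> Read ''pw'' v_i)
    (v_y \<odot> Read ''pw'' (v_n \<ominus> v_m) \<otimes> Read ''pw'' v_m))) r then aval (Const 1) r else 0) =
    int (if V m \<le> V i then 1 else 0)"
    by (rule cellI, (rule ev_intros im env_ev[OF r] ev_Read sd)+) (simp add: V_def not_less)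
qed (simp_all add: sim_ev[OF s] ev_intros holds_def R_def const_simps)

lemma stage_del:
  assumes s: "env s" and R: "holds ''R'' N R s"
  shows "\<exists>s'. runs c_del s (300 * ((N * k + 1) * (n + 1))) s' \<and> upd s ''del'' s' \<and>
    holds ''del'' (0 + N * k) del_tab s'"
  unfolding c_del_def
proof (rule runs_Table_nat[where f = "\<lambda>i m. if dig m < i mod k \<or> dig m = i mod k \<and> R (Suc m) \<le> i div k then 1 else 0"])
  fix i m r assume i: "i < N * k" "m < n" and u: "upd s ''del'' r"
    and "vars r ''i'' = int i" "vars r ''m'' = int m"
  note im = this(4,5)[THEN ev_Var]
  have r: "env r" using env_upd[OF s u] by simp
  have Rr: "holds ''R'' N R r" using holds_upd[OF R u] by simp
  have sd: "1 \<le> n" "m \<le> n - 1" "n - 1 - m < N" "m + 1 < N" using i by (auto simp: N_def)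
  have dig: "ev e_dig r (dig m)" unfolding e_dig_def dig_def
    by (rule ev_intros im env_ev[OF r] ev_Read sd)+
  show "(if bval (Not (And (Not (Less e_dig (v_i \<odot> v_k)))
    (Not (And (Equal e_dig (v_i \<odot> v_k)) (Not (Less (v_i \<oslash> v_k) (Read ''R'' (v_m \<oplus> Const 1)))))))) r
      then aval (Const 1) r else 0) =
    int (if dig m < i mod k \<or> dig m = i mod k \<and> R (Suc m) \<le> i div k then 1 else 0)"
    by (rule cellI, (rule ev_intros im env_ev[OF r] dig Rr ev_Read sd)+) auto
qed (simp_all add: sim_ev[OF s] ev_intros holds_def del_def del_tab_def const_simps)

lemma stage_U0:
  assumes s: "env s"
  shows "\<exists>s'. runs c_U0 s (300 * ((N * N + 1) * (1 + 1))) s' \<and> upd s ''U'' s' \<and>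
    holds ''U'' (0 + N * N) U_tab s'"
  unfolding c_U0_def
proof (rule runs_Table_nat[where f = "\<lambda>i m. if i div N = i mod N then 1 else 0"])
  fix i m r assume i: "i < N * N" "m < 1" and u: "upd s ''U'' r"
    and "vars r ''i'' = int i" "vars r ''m'' = int m"
  note im = this(4,5)[THEN ev_Var]
  have r: "env r" using env_upd[OF s u] by simp
  show "(if bval (Equal (v_i \<oslash> e_N) (v_i \<odot> e_N)) r then aval (Const 1) r else 0) =
    int (if i div N = i mod N then 1 else 0)"
    by (rule cellI, (rule ev_intros im env_ev[OF r])+) simp
qed (use U_tab[of _ 0] in \<open>simp_all add: sim_ev[OF s] ev_intros holds_def U_def const_simps\<close>)

lemma stage_U1:
  assumes s: "env s" and del: "holds ''del'' (N * k) del_tab s" and U: "holds ''U'' (N * N) U_tab s"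
  shows "\<exists>s'. runs c_U1 s (300 * ((N * N + 1) * (k + 1))) s' \<and> upd s ''U'' s' \<and>
    holds ''U'' (N * N + N * N) U_tab s'"
  unfolding c_U1_def
proof (rule runs_Table_nat[where f = "\<lambda>i c. if del (i mod N) c = i div N then 1 else 0"])
  fix i m r assume i: "i < N * N" "m < k" and u: "upd s ''U'' r"
    and "vars r ''i'' = int i" "vars r ''m'' = int m"
  note im = this(4,5)[THEN ev_Var]
  have r: "env r" using env_upd[OF s u] by simp
  have delr: "holds ''del'' (N * k) del_tab r" using holds_upd[OF del u] by simp
  have sd: "i mod N * k + m < N * k" using i by (intro pair_less) simp_all
  show "(if bval (Equal (Read ''del'' (v_i \<odot> e_N \<otimes> v_k \<oplus> v_m)) (v_i \<oslash> e_N)) r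
      then aval (Const 1) r else 0) = int (if del (i mod N) m = i div N then 1 else 0)"
    by (rule cellI, (rule ev_intros im env_ev[OF r] delr ev_Read sd)+) (simp add: del_tab i)
next
  fix i assume "i < N * N"
  then show "U_tab (N * N + i) = (\<Sum>c<k. if del (i mod N) c = i div N then 1 else 0)"
    using U_tab[of i 1] by (simp add: U_def)
qed (use U in \<open>simp_all add: sim_ev[OF s] ev_intros const_simps\<close>)

lemma ev_valid_b:
  assumes r: "env r" and R: "holds ''R'' N R r" and e: "ev e r t"
  shows "bev (valid_b e) r (valid t)"
proof -
  have sd: "0 < N" by simp
  have "bev (valid_b e) r (\<not> t div N < R 0 \<and> \<not> t mod N < R 0)"
    unfolding valid_b_def by (rule ev_intros e env_ev[OF r] R ev_Read sd)+
  then show ?thesis by (simp add: valid_def not_less)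
qed

lemma stage_D0:
  assumes s: "env s" and R: "holds ''R'' N R s"
  shows "\<exists>s'. runs c_D0 s (300 * ((N * N + 1) * (1 + 1))) s' \<and> upd s ''D'' s' \<and>
    holds ''D'' (0 + N * N) D_tab s'"
  unfolding c_D0_def
proof (rule runs_Table_nat[where f = "\<lambda>i m. if valid i then B ^ i else 0"])
  fix i m r assume i: "i < N * N" "m < 1" and u: "upd s ''D'' r"
    and "vars r ''i'' = int i" "vars r ''m'' = int m"
  note im = this(4,5)[THEN ev_Var]
  have r: "env r" using env_upd[OF s u] by simp
  have Rr: "holds ''R'' N R r" using holds_upd[OF R u] by simp
  show "(if bval (valid_b v_i) r then aval (Read ''bp'' v_i) r else 0) = int (if valid i then B ^ i else 0)"
    by (rule cellI, (rule ev_valid_b[OF r Rr] ev_intros im env_ev[OF r] ev_Read i)+) simp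
qed (use D_tab[of _ 0] in \<open>simp_all add: sim_ev[OF s] ev_intros holds_def const_simps\<close>)

lemma stage_D:
  assumes s: "env s" and R: "holds ''R'' N R s" and del: "holds ''del'' (N * k) del_tab s"
    and D: "holds ''D'' (N * N) D_tab s"
  shows "\<exists>s'. runs c_D s (300 * ((n * (N * N) + 1) * (N * k + 1))) s' \<and> upd s ''D'' s' \<and>
    holds ''D'' (N * N + n * (N * N)) D_tab s'"
  unfolding c_D_def
proof (rule runs_Table_nat[where f = "\<lambda>i m. if valid (i mod (N*N)) \<and> del (m div k) (m mod k) = i mod (N*N) div N
     then D (i div (N*N)) (m div k * N + del (i mod (N*N) mod N) (m mod k)) else 0"])
  fix i m r assume i: "i < n * (N * N)" "m < N * k" and u: "upd s ''D'' r"
    and Dr: "holds ''D'' (N * N + i) D_tab r"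
    and "vars r ''i'' = int i" "vars r ''m'' = int m"
  note im = this(5,6)[THEN ev_Var]
  have r: "env r" using env_upd[OF s u] by simp
  have Rr: "holds ''R'' N R r" using holds_upd[OF R u] by simp
  have delr: "holds ''del'' (N * k) del_tab r" using holds_upd[OF del u] by simp
  have mk: "m div k < N" "m mod k < k" using i k_pos by (simp_all add: less_mult_imp_div_less)
  let ?c = "i mod (N * N) mod N * k + m mod k"
  have dt: "del_tab ?c = del (i mod (N * N) mod N) (m mod k)" by (rule del_tab[OF mk(2)])
  have code: "m div k * N + del_tab ?c < N * N"
    unfolding dt by (rule code_less[OF mk(1) del_less_N])
  have "i div (N * N) * (N * N) \<le> i" by (simp add: div_times_less_eq_dividend)
  \<comment> \<open>The cell that is read lies one layer below the current one, hence among those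
    already filled.\<close>
  with code have idx: "i div (N * N) * (N * N) + (m div k * N + del_tab ?c) < N * N + i" by linarith
  have c: "?c < N * k" using mk by (intro pair_less) simp_all
  note sd = idx c i(2)
  show "(if bval (And (valid_b (v_i \<odot> e_NN)) (Equal (Read ''del'' v_m) (v_i \<odot> e_NN \<oslash> e_N))) r
     then aval (Read ''D'' (v_i \<oslash> e_NN \<otimes> e_NN \<oplus> (v_m \<oslash> v_k \<otimes> e_N
      \<oplus> Read ''del'' (v_i \<odot> e_NN \<odot> e_N \<otimes> v_k \<oplus> v_m \<odot> v_k)))) r else 0) =
    int (if valid (i mod (N*N)) \<and> del (m div k) (m mod k) = i mod (N*N) div N
     then D (i div (N*N)) (m div k * N + del (i mod (N*N) mod N) (m mod k)) else 0)"
  proof (rule cellI, (rule ev_valid_b[OF r Rr] ev_intros im env_ev[OF r] delr Dr ev_Read sd)+)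
    show "(if valid (i mod (N * N)) \<and> del_tab m = i mod (N * N) div N
      then D_tab (i div (N * N) * (N * N) + (m div k * N + del_tab ?c)) else 0) =
      (if valid (i mod (N*N)) \<and> del (m div k) (m mod k) = i mod (N*N) div N
       then D (i div (N*N)) (m div k * N + del (i mod (N*N) mod N) (m mod k)) else 0)"
      unfolding dt D_tab[OF code[unfolded dt]] by (simp only: del_tab_def)
  qed
next
  fix i assume "i < n * (N * N)"
  have "D_tab (N * N + i) = D (Suc (i div (N * N))) (i mod (N * N))"
    by (simp add: D_tab_def)
  then show "D_tab (N * N + i) = (\<Sum>m<N * k. if valid (i mod (N*N)) \<and> del (m div k) (m mod k) = i mod (N*N) div N
     then D (i div (N*N)) (m div k * N + del (i mod (N*N) mod N) (m mod k)) else 0)"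
    by (simp only: D.simps)
qed (use D in \<open>simp_all add: sim_ev[OF s] ev_intros const_simps\<close>)

lemma ev_always: "bev always r True"
  by (simp add: bev_def)

lemma stage_tr:
  assumes s: "env s" and D: "holds ''D'' (N * N + n * (N * N)) D_tab s"
  shows "\<exists>s'. runs c_tr s (300 * ((N + 1) * (N * N + 1))) s' \<and> upd s ''tr'' s' \<and> holds ''tr'' (0 + N) tr s'"
  unfolding c_tr_def
proof (rule runs_Table_nat[where f = "\<lambda>i m. D i m div B ^ m mod B"])
  fix i m r assume i: "i < N" "m < N * N" and u: "upd s ''tr'' r"
    and "vars r ''i'' = int i" "vars r ''m'' = int m"
  note im = this(4,5)[THEN ev_Var]
  have r: "env r" using env_upd[OF s u] by simp
  have Dr: "holds ''D'' (N * N + n * (N * N)) D_tab r" using holds_upd[OF D u] by simp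
  have "i * (N * N) + m < N * (N * N)" using i by (intro pair_less)
  then have idx: "i * (N * N) + m < N * N + n * (N * N)" by (simp add: N_def)
  show "(if bval always r then aval (Read ''D'' (v_i \<otimes> e_NN \<oplus> v_m) \<oslash> Read ''bp'' v_m \<odot> e_B) r else 0) =
    int (D i m div B ^ m mod B)"
    by (rule cellI, rule ev_always, (rule ev_intros im env_ev[OF r] Dr ev_Read idx i)+) (simp add: D_tab i)
qed (simp_all add: sim_ev[OF s] ev_intros holds_def tr_def const_simps)

lemma stage_H:
  assumes s: "env s" and D: "holds ''D'' (N * N + n * (N * N)) D_tab s" and U: "holds ''U'' (N * N + N * N) U_tab s"
  shows "\<exists>s'. runs c_H s (300 * ((2 + 1) * (N * N + 1))) s' \<and> upd s ''H'' s' \<and> holds ''H'' (0 + 2) H s'"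
  unfolding c_H_def
proof (rule runs_Table_nat[where f = "\<lambda>\<sigma> t. U ((n - \<sigma>) mod 2) (t mod N * N + t div N) * D ((n - \<sigma>) div 2) t"])
  fix i m r assume i: "i < 2" "m < N * N" and u: "upd s ''H'' r"
    and "vars r ''i'' = int i" "vars r ''m'' = int m"
  note im = this(4,5)[THEN ev_Var]
  have r: "env r" using env_upd[OF s u] by simp
  have Dr: "holds ''D'' (N * N + n * (N * N)) D_tab r" using holds_upd[OF D u] by simp
  have Ur: "holds ''U'' (N * N + N * N) U_tab r" using holds_upd[OF U u] by simp
  have "i \<le> n" using i(1) n_pos by simp
  have "(n - i) div 2 < N" by (simp add: N_def less_Suc_eq_le)
  then have "(n - i) div 2 * (N * N) + m < N * (N * N)" using i by (intro pair_less)
  then have dx: "(n - i) div 2 * (N * N) + m < N * N + n * (N * N)" by (simp add: N_def)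
  have sw: "m mod N * N + m div N < N * N" using i by (intro code_less code_parts) simp_all
  have "(n - i) mod 2 * (N * N) + (m mod N * N + m div N) < 2 * (N * N)" by (rule pair_less[OF _ sw]) simp
  then have ux: "(n - i) mod 2 * (N * N) + (m mod N * N + m div N) < N * N + N * N" by (simp only: mult_2)
  note sd = \<open>i \<le> n\<close> dx ux
  show "(if bval always r then aval (Read ''U'' ((v_n \<ominus> v_i) \<odot> Const 2 \<otimes> e_NN
      \<oplus> (v_m \<odot> e_N \<otimes> e_N \<oplus> v_m \<oslash> e_N)) \<otimes> Read ''D'' ((v_n \<ominus> v_i) \<oslash> Const 2 \<otimes> e_NN \<oplus> v_m)) r else 0) =
    int (U ((n - i) mod 2) (m mod N * N + m div N) * D ((n - i) div 2) m)"
    by (rule cellI, rule ev_always, (rule ev_intros im env_ev[OF r] Dr Ur ev_Read sd)+)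
      (simp only: D_tab[OF i(2)] U_tab[OF sw] if_True)
qed (simp_all add: sim_ev[OF s] ev_intros holds_def H_def const_simps)

lemma stage_Q0:
  assumes s: "env s" and tr: "holds ''tr'' N tr s"
  shows "\<exists>s'. runs c_Q0 s (300 * ((1 + 1) * (n + 1))) s' \<and> upd s ''q'' s' \<and> holds ''q'' (0 + 1) q_tab s'"
  unfolding c_Q0_def
proof (rule runs_Table_nat[where f = "\<lambda>i m. 2 * tr (gcd m n)"])
  fix i m r assume i: "i < 1" "m < n" and u: "upd s ''q'' r"
    and "vars r ''i'' = int i" "vars r ''m'' = int m"
  note im = this(4,5)[THEN ev_Var]
  have r: "env r" using env_upd[OF s u] by simp
  have trr: "holds ''tr'' N tr r" using holds_upd[OF tr u] by simp
  have sd: "gcd m n < N" using n_pos by (simp add: N_def less_Suc_eq_le)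
  show "(if bval always r then aval (Const 2 \<otimes> Read ''tr'' (Read ''gcd'' v_m)) r else 0) = int (2 * tr (gcd m n))"
    by (rule cellI, rule ev_always, (rule ev_intros im env_ev[OF r] trr ev_Read sd i)+) simp
qed (simp_all add: sim_ev[OF s] ev_intros holds_def q_tab_def sum_distrib_left const_simps)

lemma stage_Q1:
  assumes s: "env s" and U: "holds ''U'' (N * N + N * N) U_tab s" and H: "holds ''H'' 2 H s" and q: "holds ''q'' 1 q_tab s"
  shows "\<exists>s'. runs c_Q1 s (300 * ((1 + 1) * (2 * (N * N) + 1))) s' \<and> upd s ''q'' s' \<and> holds ''q'' (1 + 1) q_tab s'"
  unfolding c_Q1_def
proof (rule runs_Table_nat[where f = "\<lambda>i m. n * (U_tab m * (H (m div (N*N)) div B ^ (m mod (N*N)) mod B))"])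
  fix i m r assume i: "i < 1" "m < 2 * (N * N)" and u: "upd s ''q'' r"
    and "vars r ''i'' = int i" "vars r ''m'' = int m"
  note im = this(4,5)[THEN ev_Var]
  have r: "env r" using env_upd[OF s u] by simp
  have Ur: "holds ''U'' (N * N + N * N) U_tab r" using holds_upd[OF U u] by simp
  have Hr: "holds ''H'' 2 H r" using holds_upd[OF H u] by simp
  have sd: "m < N * N + N * N" "m div (N * N) < 2" "m mod (N * N) < N * N"
    using i(2) by (simp_all only: mult_2 less_mult_imp_div_less) simp
  show "(if bval always r then aval (v_n \<otimes> (Read ''U'' v_m \<otimes> (Read ''H'' (v_m \<oslash> e_NN)
      \<oslash> Read ''bp'' (v_m \<odot> e_NN) \<odot> e_B))) r else 0) =
    int (n * (U_tab m * (H (m div (N*N)) div B ^ (m mod (N*N)) mod B)))"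
    by (rule cellI, rule ev_always, (rule ev_intros im env_ev[OF r] Ur Hr ev_Read sd)+) simp
qed (use q in \<open>simp_all add: sim_ev[OF s] ev_intros q_tab_def E_def U_tab_def sum_distrib_left const_simps\<close>)

end

section \<open>Composing the stages, the precomputed tables, and cost bounds\<close>

definition "c_eval = Seq c_R (Seq c_del (Seq c_U0 (Seq c_U1 (Seq c_D0 (Seq c_D (Seq c_tr (Seq c_H (Seq c_Q0 c_Q1))))))))"

definition "c_pw = Seq (Write ''pw'' (Const 0) (Const 1))
  (Table ''pw'' (Const 1) v_n (Const 1) always (Read ''pw'' v_i \<otimes> v_k))"

definition "c_bp = Seq (Write ''bp'' (Const 0) (Const 1))
  (Table ''bp'' (Const 1) e_NN (Const 1) always (Read ''bp'' v_i \<otimes> e_B))"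

definition "c_gcd = Table ''gcd'' (Const 0) v_n v_n (Equal (v_m \<otimes> v_i \<odot> v_n) (Const 0)) (Const 1)"

text \<open>These tables depend on \<open>n\<close> and \<open>k\<close> but not on the threshold,
  so they are computed once.\<close>

definition "c_pre = Seq c_pw (Seq c_bp c_gcd)"

definition only :: "state \<Rightarrow> string set \<Rightarrow> state \<Rightarrow> bool" where
  "only s A s' \<longleftrightarrow> sim s s' \<and> (\<forall>a. a \<notin> A \<longrightarrow> arrs s' a = arrs s a)"

lemma only_refl: "only s A s"
  by (simp add: only_def sim_def)

lemma sim_trans: "sim s r \<Longrightarrow> sim r q \<Longrightarrow> sim s q"
  by (simp add: sim_def)

lemma only_upd:
  assumes "only s A s'" "upd s' a s''" "a \<in> A"
  shows "only s A s''"
proof -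
  have "arrs s'' a' = arrs s a'" if "a' \<notin> A" for a'
  proof -
    have "a' \<noteq> a" using that assms(3) by blast
    then show ?thesis using assms(1,2) that by (simp add: only_def upd_def)
  qed
  moreover have "sim s s''" using assms(1,2) sim_trans unfolding only_def upd_def by blast
  ultimately show ?thesis by (simp add: only_def)
qed

lemma holds_write:
  "holds a 1 F (s\<lparr>arrs := (arrs s)(a := (arrs s a)(0 := int (F 0)))\<rparr>)"
  by (simp add: holds_def)

context threshold
begin

text \<open>\<open>N \<le> 2 * n\<close> turns each table size into a constant times a monomial, and
  every monomial here is at most \<open>n^4 * k\<close> because \<open>n\<close> and
  \<open>k\<close> are positive.\<close>

lemma n4k_bounds:
  shows "(N + 1) * (n + 1) \<le> 6 * (n^4*k)" "(N * k + 1) * (n + 1) \<le> 6 * (n^4*k)"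
    "(N * N + 1) * (1 + 1) \<le> 10 * (n^4*k)" "(N * N + 1) * (k + 1) \<le> 10 * (n^4*k)"
    "(n * (N * N) + 1) * (N * k + 1) \<le> 15 * (n^4*k)" "(N + 1) * (N * N + 1) \<le> 15 * (n^4*k)"
    "(2 + 1) * (N * N + 1) \<le> 15 * (n^4*k)" "(1 + 1) * (n + 1) \<le> 4 * (n^4*k)"
    "(1 + 1) * (2 * (N * N) + 1) \<le> 18 * (n^4*k)" "(n + 1) * (n + 1) \<le> 4 * (n^4*k)" "1 \<le> n^4*k"
proof -
  have N: "N \<le> 2 * n" "1 \<le> n" "1 \<le> k" using n_pos k_pos by (auto simp: N_def)
  have NN: "N * N \<le> 4 * n^2"
    using mult_le_mono[OF N(1) N(1)] by (simp add: power2_eq_square)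
  have p: "n ^ i * k ^ j \<le> n^4*k" if "i \<le> 4" "j \<le> 1" for i j
  proof -
    have "n ^ i \<le> n ^ 4" "k ^ j \<le> k ^ 1"
      using power_increasing[OF that(1) N(2)] power_increasing[OF that(2) N(3)] .
    then show ?thesis using mult_le_mono[of "n ^ i" "n ^ 4" "k ^ j" "k ^ 1"] by simp
  qed
  have n2: "1 \<le> n ^ 2" "1 \<le> n ^ 3" using N by simp_all
  have Nk: "N * k \<le> 2 * n * k" using N(1) by (rule mult_le_mono1)
  have nk: "1 \<le> n * k" using N by simp
  have nNN: "n * (N * N) \<le> 4 * n^3" using mult_le_mono2[OF NN, of n] by (simp add: power3_eq_cube power2_eq_square)
  have a: "N + 1 \<le> 3 * n" "n + 1 \<le> 2 * n" "N * k + 1 \<le> 3 * (n * k)" "N * N + 1 \<le> 5 * n^2"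
    "k + 1 \<le> 2 * k" "n * (N * N) + 1 \<le> 5 * n^3" "2 * (N * N) + 1 \<le> 9 * n^2"
    using N NN n2 Nk nk nNN by linarith+
  have e: "3 * n * (2 * n) = 6 * (n^2 * k^0)" "3 * (n * k) * (2 * n) = 6 * (n^2 * k^1)"
    "5 * n^2 * 2 = 10 * (n^2 * k^0)" "5 * n^2 * (2 * k) = 10 * (n^2 * k^1)"
    "5 * n^3 * (3 * (n * k)) = 15 * (n^4 * k^1)" "3 * n * (5 * n^2) = 15 * (n^3 * k^0)"
    "3 * (5 * n^2) = 15 * (n^2 * k^0)" "2 * (2 * n) = 4 * (n^1 * k^0)" "2 * (9 * n^2) = 18 * (n^2 * k^0)"
    "2 * n * (2 * n) = 4 * (n^2 * k^0)"
    by (simp_all add: power2_eq_square power3_eq_cube power4_eq_xxxx)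
  have two: "1 + 1 \<le> (2::nat)" "2 + 1 \<le> (3::nat)" by simp_all
  note t = le_trans[OF _ mult_le_mono2[OF p]]
  show "(N + 1) * (n + 1) \<le> 6 * (n^4*k)" by (rule t[OF mult_le_mono[OF a(1,2), unfolded e]]) simp_all
  show "(N * k + 1) * (n + 1) \<le> 6 * (n^4*k)" by (rule t[OF mult_le_mono[OF a(3,2), unfolded e]]) simp_all
  show "(N * N + 1) * (1 + 1) \<le> 10 * (n^4*k)" by (rule t[OF mult_le_mono[OF a(4) two(1), unfolded e]]) simp_all
  show "(N * N + 1) * (k + 1) \<le> 10 * (n^4*k)" by (rule t[OF mult_le_mono[OF a(4,5), unfolded e]]) simp_all
  show "(n * (N * N) + 1) * (N * k + 1) \<le> 15 * (n^4*k)" by (rule t[OF mult_le_mono[OF a(6,3), unfolded e]]) simp_all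
  show "(N + 1) * (N * N + 1) \<le> 15 * (n^4*k)" by (rule t[OF mult_le_mono[OF a(1,4), unfolded e]]) simp_all
  show "(2 + 1) * (N * N + 1) \<le> 15 * (n^4*k)" by (rule t[OF mult_le_mono[OF two(2) a(4), unfolded e]]) simp_all
  show "(1 + 1) * (n + 1) \<le> 4 * (n^4*k)" by (rule t[OF mult_le_mono[OF two(1) a(2), unfolded e]]) simp_all
  show "(1 + 1) * (2 * (N * N) + 1) \<le> 18 * (n^4*k)" by (rule t[OF mult_le_mono[OF two(1) a(7), unfolded e]]) simp_all
  show "(n + 1) * (n + 1) \<le> 4 * (n^4*k)" by (rule t[OF mult_le_mono[OF a(2,2), unfolded e]]) simp_all
  show "1 \<le> n^4*k" using p[of 0 0] by simp
qed

lemma runs_eval: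
  assumes s: "env s"
  shows "\<exists>s'. runs c_eval s (33000 * (n^4*k)) s' \<and>
    only s {''R'', ''del'', ''U'', ''D'', ''tr'', ''H'', ''q''} s' \<and>
    arrs s' ''q'' 0 + arrs s' ''q'' 1 = int (4 * n * cnt k n x)"
proof -
  note e = env_upd and h = holds_upd
  obtain s1 where 1: "runs c_R s (300 * ((N + 1) * (n + 1))) s1" "upd s ''R'' s1" "holds ''R'' N R s1"
    using stage_R[OF s] by auto
  have e1: "env s1" using e[OF s 1(2)] by simp
  obtain s2 where 2: "runs c_del s1 (300 * ((N * k + 1) * (n + 1))) s2" "upd s1 ''del'' s2" "holds ''del'' (N * k) del_tab s2"
    using stage_del[OF e1 1(3)] by auto
  have e2: "env s2" "holds ''R'' N R s2" using e[OF e1 2(2)] h[OF 1(3) 2(2)] by simp_all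
  obtain s3 where 3: "runs c_U0 s2 (300 * ((N * N + 1) * (1 + 1))) s3" "upd s2 ''U'' s3" "holds ''U'' (N * N) U_tab s3"
    using stage_U0[OF e2(1)] by auto
  have e3: "env s3" "holds ''R'' N R s3" "holds ''del'' (N * k) del_tab s3"
    using e[OF e2(1) 3(2)] h[OF e2(2) 3(2)] h[OF 2(3) 3(2)] by simp_all
  obtain s4 where 4: "runs c_U1 s3 (300 * ((N * N + 1) * (k + 1))) s4" "upd s3 ''U'' s4" "holds ''U'' (N * N + N * N) U_tab s4"
    using stage_U1[OF e3(1,3) 3(3)] by auto
  have e4: "env s4" "holds ''R'' N R s4" "holds ''del'' (N * k) del_tab s4"
    using e[OF e3(1) 4(2)] h[OF e3(2) 4(2)] h[OF e3(3) 4(2)] by simp_all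
  obtain s5 where 5: "runs c_D0 s4 (300 * ((N * N + 1) * (1 + 1))) s5" "upd s4 ''D'' s5" "holds ''D'' (N * N) D_tab s5"
    using stage_D0[OF e4(1,2)] by auto
  have e5: "env s5" "holds ''R'' N R s5" "holds ''del'' (N * k) del_tab s5" "holds ''U'' (N * N + N * N) U_tab s5"
    using e[OF e4(1) 5(2)] h[OF e4(2) 5(2)] h[OF e4(3) 5(2)] h[OF 4(3) 5(2)] by simp_all
  obtain s6 where 6: "runs c_D s5 (300 * ((n * (N * N) + 1) * (N * k + 1))) s6" "upd s5 ''D'' s6"
    "holds ''D'' (N * N + n * (N * N)) D_tab s6"
    using stage_D[OF e5(1,2,3) 5(3)] by blast
  have e6: "env s6" "holds ''U'' (N * N + N * N) U_tab s6"
    using e[OF e5(1) 6(2)] h[OF e5(4) 6(2)] by simp_all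
  obtain s7 where 7: "runs c_tr s6 (300 * ((N + 1) * (N * N + 1))) s7" "upd s6 ''tr'' s7" "holds ''tr'' N tr s7"
    using stage_tr[OF e6(1) 6(3)] by auto
  have e7: "env s7" "holds ''U'' (N * N + N * N) U_tab s7" "holds ''D'' (N * N + n * (N * N)) D_tab s7"
    using e[OF e6(1) 7(2)] h[OF e6(2) 7(2)] h[OF 6(3) 7(2)] by simp_all
  obtain s8 where 8: "runs c_H s7 (300 * ((2 + 1) * (N * N + 1))) s8" "upd s7 ''H'' s8" "holds ''H'' 2 H s8"
    using stage_H[OF e7(1,3,2), unfolded add_0] by blast
  have e8: "env s8" "holds ''U'' (N * N + N * N) U_tab s8" "holds ''tr'' N tr s8"
    using e[OF e7(1) 8(2)] h[OF e7(2) 8(2)] h[OF 7(3) 8(2)] by simp_all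
  obtain s9 where 9: "runs c_Q0 s8 (300 * ((1 + 1) * (n + 1))) s9" "upd s8 ''q'' s9" "holds ''q'' 1 q_tab s9"
    using stage_Q0[OF e8(1,3)] by auto
  have e9: "env s9" "holds ''U'' (N * N + N * N) U_tab s9" "holds ''H'' 2 H s9"
    using e[OF e8(1) 9(2)] h[OF e8(2) 9(2)] h[OF 8(3) 9(2)] by simp_all
  obtain s' where 10: "runs c_Q1 s9 (300 * ((1 + 1) * (2 * (N * N) + 1))) s'" "upd s9 ''q'' s'" "holds ''q'' (1 + 1) q_tab s'"
    using stage_Q1[OF e9 9(3)] by blast
  have sum: "300 * ((N + 1) * (n + 1)) + (300 * ((N * k + 1) * (n + 1)) + (300 * ((N * N + 1) * (1 + 1)) +
    (300 * ((N * N + 1) * (k + 1)) + (300 * ((N * N + 1) * (1 + 1)) + (300 * ((n * (N * N) + 1) * (N * k + 1)) +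
    (300 * ((N + 1) * (N * N + 1)) + (300 * ((2 + 1) * (N * N + 1)) + (300 * ((1 + 1) * (n + 1)) +
     300 * ((1 + 1) * (2 * (N * N) + 1)))))))))) \<le> 33000 * (n^4*k)"
  proof -
    \<comment> \<open>The coefficients of the ten stages add up to 109, and 300 * 109 =
      32700.\<close>
    have *: "300 * a + (300 * b + (300 * c + (300 * d + (300 * c + (300 * e + (300 * f + (300 * g + (300 * h + 300 * i))))))))
        \<le> 33000 * X"
      if "a \<le> 6 * X" "b \<le> 6 * X" "c \<le> 10 * X" "d \<le> 10 * X" "e \<le> 15 * X" "f \<le> 15 * X"
        "g \<le> 15 * X" "h \<le> 4 * X" "i \<le> 18 * X" for a b c d e f g h i X :: nat
      using that by linarith
    show ?thesis by (rule *) (rule n4k_bounds)+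
  qed
  have "runs c_eval s (33000 * (n^4*k)) s'"
    unfolding c_eval_def
    by (rule runs_mono[OF runs_Seq[OF 1(1) runs_Seq[OF 2(1) runs_Seq[OF 3(1) runs_Seq[OF 4(1) runs_Seq[OF 5(1)
        runs_Seq[OF 6(1) runs_Seq[OF 7(1) runs_Seq[OF 8(1) runs_Seq[OF 9(1) 10(1)]]]]]]]]]])
      (rule sum)
  moreover have "only s {''R'', ''del'', ''U'', ''D'', ''tr'', ''H'', ''q''} s'" (is "only s ?A s'")
  proof -
    note only_refl[of s ?A]
    from only_upd[OF this 1(2)] have "only s ?A s1" by simp
    from only_upd[OF this 2(2)] have "only s ?A s2" by simp
    from only_upd[OF this 3(2)] have "only s ?A s3" by simp
    from only_upd[OF this 4(2)] have "only s ?A s4" by simp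
    from only_upd[OF this 5(2)] have "only s ?A s5" by simp
    from only_upd[OF this 6(2)] have "only s ?A s6" by simp
    from only_upd[OF this 7(2)] have "only s ?A s7" by simp
    from only_upd[OF this 8(2)] have "only s ?A s8" by simp
    from only_upd[OF this 9(2)] have "only s ?A s9" by simp
    from only_upd[OF this 10(2)] show ?thesis by simp
  qed
  moreover have "arrs s' ''q'' 0 + arrs s' ''q'' 1 = int Q"
    using holds_read[OF 10(3), of 0] holds_read[OF 10(3), of 1] by (simp add: q_tab_def Q_def)
  ultimately show ?thesis using Q_eq by (auto simp: cnt_def)
qed

definition pre_env :: "state \<Rightarrow> bool" where
  "pre_env s \<longleftrightarrow> vars s ''n'' = int n \<and> vars s ''k'' = int k \<and>
    holds ''pw'' N (\<lambda>j. k ^ j) s \<and> holds ''bp'' (N*N) (\<lambda>t. B ^ t) s \<and> holds ''gcd'' n (\<lambda>r. gcd r n) s"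

lemma nk_ev:
  assumes "vars s ''n'' = int n" "vars s ''k'' = int k" "sim s r"
  shows "ev v_n r n" "ev v_k r k" "ev e_N r N" "ev e_NN r (N * N)"
proof -
  have "vars r ''n'' = int n" "vars r ''k'' = int k" using assms by (simp_all add: sim_def)
  note v = this[THEN ev_Var]
  show "ev v_n r n" "ev v_k r k" by (rule v)+
  show N: "ev e_N r N" unfolding e_N_def N_def by (rule ev_intros v)+
  show "ev e_NN r (N * N)" unfolding e_NN_def by (rule ev_intros N)+
qed

lemma upd_nk:
  "upd s a r \<Longrightarrow> vars s ''n'' = int n \<Longrightarrow> vars s ''k'' = int k \<Longrightarrow> vars r ''n'' = int n \<and> vars r ''k'' = int k"
  by (simp add: upd_def sim_def)

lemma e_B_ev:
  assumes "ev v_n r n" "ev v_k r k" "ev e_NN r (N * N)" and pw: "holds ''pw'' N (\<lambda>j. k ^ j) r"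
  shows "ev e_B r B"
proof -
  have sd: "n < N" by (simp add: N_def)
  show ?thesis unfolding e_B_def B_def by (rule ev_intros assms ev_Read[OF pw] sd)+
qed

lemma runs_pw:
  assumes s: "vars s ''n'' = int n" "vars s ''k'' = int k"
  shows "\<exists>s'. runs c_pw s (3 + 300 * ((n + 1) * (1 + 1))) s' \<and> upd s ''pw'' s' \<and> holds ''pw'' (1 + n) (\<lambda>j. k ^ j) s'"
proof -
  let ?s = "s\<lparr>arrs := (arrs s)(''pw'' := (arrs s ''pw'')(0 := int (k ^ 0)))\<rparr>"
  have w: "runs (Write ''pw'' (Const 0) (Const 1)) s 3 ?s"
    using runs_Write[of "''pw''" "Const 0" "Const 1" s] by (simp add: numeral_3_eq_3)
  have "\<exists>s'. runs (Table ''pw'' (Const 1) v_n (Const 1) always (Read ''pw'' v_i \<otimes> v_k)) ?s (300 * ((n + 1) * (1 + 1))) s' \<and>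
      upd ?s ''pw'' s' \<and> holds ''pw'' (1 + n) (\<lambda>j. k ^ j) s'"
  proof (rule runs_Table_nat[where f = "\<lambda>i m. k ^ i * k"])
    fix i m r assume i: "i < n" and u: "upd ?s ''pw'' r" and pw: "holds ''pw'' (1 + i) (\<lambda>j. k ^ j) r"
      and "vars r ''i'' = int i"
    note im = this(4)[THEN ev_Var]
    have sd: "i < 1 + i" by simp
    have nk: "vars r ''n'' = int n" "vars r ''k'' = int k" using upd_nk[OF u] s by simp_all
    show "(if bval always r then aval (Read ''pw'' v_i \<otimes> v_k) r else 0) = int (k ^ i * k)"
      by (rule cellI, rule ev_always, (rule ev_intros im nk_ev[OF nk sim_refl] ev_Read pw sd)+) simp
  next
    show "holds ''pw'' 1 (\<lambda>j. k ^ j) ?s" by (rule holds_write)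
  qed (use s in \<open>simp_all add: nk_ev[of ?s] ev_intros const_simps mult.commute\<close>)
  then obtain s' where s': "runs (Table ''pw'' (Const 1) v_n (Const 1) always (Read ''pw'' v_i \<otimes> v_k)) ?s (300 * ((n + 1) * (1 + 1))) s'"
    "upd ?s ''pw'' s'" "holds ''pw'' (1 + n) (\<lambda>j. k ^ j) s'" by blast
  have "upd s ''pw'' s'" using s'(2) by (simp add: upd_def sim_def)
  then show ?thesis using runs_Seq[OF w s'(1)] s'(3) unfolding c_pw_def by blast
qed

lemma runs_bp:
  assumes s: "vars s ''n'' = int n" "vars s ''k'' = int k" and pw: "holds ''pw'' N (\<lambda>j. k ^ j) s"
  shows "\<exists>s'. runs c_bp s (3 + 300 * ((N * N + 1) * (1 + 1))) s' \<and> upd s ''bp'' s' \<and> holds ''bp'' (1 + N * N) (\<lambda>j. B ^ j) s'"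
proof -
  let ?s = "s\<lparr>arrs := (arrs s)(''bp'' := (arrs s ''bp'')(0 := int (B ^ 0)))\<rparr>"
  have w: "runs (Write ''bp'' (Const 0) (Const 1)) s 3 ?s"
    using runs_Write[of "''bp''" "Const 0" "Const 1" s] by (simp add: numeral_3_eq_3)
  have "\<exists>s'. runs (Table ''bp'' (Const 1) e_NN (Const 1) always (Read ''bp'' v_i \<otimes> e_B)) ?s (300 * ((N * N + 1) * (1 + 1))) s' \<and>
      upd ?s ''bp'' s' \<and> holds ''bp'' (1 + N * N) (\<lambda>j. B ^ j) s'"
  proof (rule runs_Table_nat[where f = "\<lambda>i m. B ^ i * B"])
    fix i m r assume i: "i < N * N" and u: "upd ?s ''bp'' r" and bp: "holds ''bp'' (1 + i) (\<lambda>j. B ^ j) r"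
      and "vars r ''i'' = int i"
    note im = this(4)[THEN ev_Var]
    have sd: "i < 1 + i" by simp
    have nk: "vars r ''n'' = int n" "vars r ''k'' = int k" using upd_nk[OF u] s by simp_all
    have "holds ''pw'' N (\<lambda>j. k ^ j) r" using pw u by (simp add: holds_def upd_def)
    note B = e_B_ev[OF nk_ev(1,2,4)[OF nk sim_refl] this]
    show "(if bval always r then aval (Read ''bp'' v_i \<otimes> e_B) r else 0) = int (B ^ i * B)"
      by (rule cellI, rule ev_always, (rule ev_intros im B ev_Read bp sd)+) simp
  next
    show "holds ''bp'' 1 (\<lambda>j. B ^ j) ?s" by (rule holds_write)
  qed (use s in \<open>simp_all add: nk_ev[of ?s] ev_intros const_simps mult.commute\<close>)
  then obtain s' where s': "runs (Table ''bp'' (Const 1) e_NN (Const 1) always (Read ''bp'' v_i \<otimes> e_B)) ?s (300 * ((N * N + 1) * (1 + 1))) s'"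
    "upd ?s ''bp'' s'" "holds ''bp'' (1 + N * N) (\<lambda>j. B ^ j) s'" by blast
  have "upd s ''bp'' s'" using s'(2) by (simp add: upd_def sim_def)
  then show ?thesis using runs_Seq[OF w s'(1)] s'(3) unfolding c_bp_def by blast
qed

lemma runs_gcd:
  assumes s: "vars s ''n'' = int n" "vars s ''k'' = int k"
  shows "\<exists>s'. runs c_gcd s (300 * ((n + 1) * (n + 1))) s' \<and> upd s ''gcd'' s' \<and> holds ''gcd'' (0 + n) (\<lambda>r. gcd r n) s'"
  unfolding c_gcd_def
proof (rule runs_Table_nat[where f = "\<lambda>i m. if m * i mod n = 0 then 1 else 0"])
  fix i m r assume i: "i < n" "m < n" and u: "upd s ''gcd'' r"
    and "vars r ''i'' = int i" "vars r ''m'' = int m"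
  note im = this(4,5)[THEN ev_Var]
  have nk: "vars r ''n'' = int n" "vars r ''k'' = int k" using upd_nk[OF u] s by simp_all
  show "(if bval (Equal (v_m \<otimes> v_i \<odot> v_n) (Const 0)) r then aval (Const 1) r else 0) = int (if m * i mod n = 0 then 1 else 0)"
    by (rule cellI, (rule ev_intros im nk_ev[OF nk sim_refl])+) simp
next
  fix i
  show "gcd (0 + i) n = (\<Sum>m<n. if m * i mod n = 0 then 1 else 0)"
    unfolding add_0 by (rule count_multiples_gcd[OF n_pos, symmetric])
next
  show "holds ''gcd'' 0 (\<lambda>r. gcd r n) s" by (simp add: holds_def)
qed (simp_all add: nk_ev[OF s] ev_intros const_simps)

lemma runs_pre:
  assumes s: "vars s ''n'' = int n" "vars s ''k'' = int k"
  shows "\<exists>s'. runs c_pre s (10000 * (n^4*k)) s' \<and> only s {''pw'', ''bp'', ''gcd''} s' \<and> pre_env s'"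
proof -
  obtain s1 where 1: "runs c_pw s (3 + 300 * ((n + 1) * (1 + 1))) s1" "upd s ''pw'' s1" "holds ''pw'' N (\<lambda>j. k ^ j) s1"
    using runs_pw[OF s] by (auto simp: N_def)
  have v1: "vars s1 ''n'' = int n" "vars s1 ''k'' = int k" using upd_nk[OF 1(2) s] by simp_all
  obtain s2 where 2: "runs c_bp s1 (3 + 300 * ((N * N + 1) * (1 + 1))) s2" "upd s1 ''bp'' s2" "holds ''bp'' (1 + N * N) (\<lambda>j. B ^ j) s2"
    using runs_bp[OF v1 1(3)] by blast
  have v2: "vars s2 ''n'' = int n" "vars s2 ''k'' = int k" using upd_nk[OF 2(2) v1] by simp_all
  obtain s3 where 3: "runs c_gcd s2 (300 * ((n + 1) * (n + 1))) s3" "upd s2 ''gcd'' s3" "holds ''gcd'' n (\<lambda>r. gcd r n) s3"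
    using runs_gcd[OF v2] by auto
  have v3: "vars s3 ''n'' = int n" "vars s3 ''k'' = int k" using upd_nk[OF 3(2) v2] by simp_all
  have "holds ''bp'' (N * N) (\<lambda>j. B ^ j) s2" using 2(3) by (simp add: holds_def)
  then have "holds ''pw'' N (\<lambda>j. k ^ j) s3" "holds ''bp'' (N * N) (\<lambda>j. B ^ j) s3"
    using holds_upd[OF _ 3(2)] holds_upd[OF 1(3) 2(2)] by simp_all
  then have "pre_env s3" using v3 3(3) by (simp add: pre_env_def)
  moreover have "only s {''pw'', ''bp'', ''gcd''} s3"
    using only_upd[OF only_upd[OF only_upd[OF only_refl 1(2)] 2(2)] 3(2)] by simp
  moreover have sum: "3 + 300 * ((n + 1) * (1 + 1)) + (3 + 300 * ((N * N + 1) * (1 + 1)) + 300 * ((n + 1) * (n + 1)))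
      \<le> 10000 * (n^4*k)"
  proof -
    have *: "3 + 300 * a + (3 + 300 * b + 300 * c) \<le> 10000 * X"
      if "a \<le> 4 * X" "b \<le> 10 * X" "c \<le> 4 * X" "1 \<le> X" for a b c X :: nat
      using that by linarith
    show ?thesis using n4k_bounds(3,8,10,11) by (intro *) (simp_all only: mult.commute)
  qed
  ultimately have ?thesis if "runs c_pre s (10000 * (n^4*k)) s3" using that by blast
  moreover have "runs c_pre s (10000 * (n^4*k)) s3"
    unfolding c_pre_def
    by (rule runs_mono[OF runs_Seq[OF 1(1) runs_Seq[OF 2(1) 3(1)]]], rule sum)
  ultimately show ?thesis by blast
qed

end

section \<open>The search\<close>

definition "e_q = Read ''q'' (Const 0) \<oplus> Read ''q'' (Const 1)"

text \<open>Both sides of the test carry the factor \<open>4 * n\<close>, so no count is ever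
  divided.\<close>

definition "c_step = Seq (Assign ''y'' (Var ''x'' \<oplus> Read ''pw'' (v_n \<ominus> Const 1 \<ominus> Var ''a'')))
  (Seq c_eval (If (Less (Var ''q0'') (e_q \<oplus> Const 4 \<otimes> v_n \<otimes> Var ''z'')) (Assign ''x'' v_y) Skip))"

text \<open>Each digit is raised from 0 by at most \<open>k - 1\<close> increments. The number of
  rounds is fixed, so after a failed trial the remaining rounds repeat it without effect.\<close>

definition "c_search = For ''a'' v_n (For ''c'' (v_k \<ominus> Const 1) c_step)"

definition "c_out = Table ''output'' (Const 0) v_n (Const 1) always
  (Read ''alphabet'' (Var ''x'' \<oslash> Read ''pw'' (v_n \<ominus> Const 1 \<ominus> v_i) \<odot> v_k))"

definition "c_main = Seq c_pre (Seq (Assign ''y'' (Const 0)) (Seq c_eval (Seq (Assign ''q0'' e_q) (Seq c_search c_out))))"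

lemma cnt_ge: "k ^ n \<le> x \<Longrightarrow> cnt k n x = 0"
proof -
  assume "k ^ n \<le> x"
  then have "{v \<in> canonical k n. x \<le> val k v} = {}"
    using val_less[of _ k] by (fastforce simp: canonical_def words_def)
  then show ?thesis by (simp only: cnt_def card.empty)
qed

section \<open>Invariants of the digit search\<close>

locale search =
  fixes n k z :: nat and A :: "int \<Rightarrow> int"
  assumes n_pos: "0 < n" and k_pos: "0 < k" and z_pos: "1 \<le> z" and z_le: "z \<le> cnt k n 0"
begin

definition pass :: "nat \<Rightarrow> bool" where
  "pass y \<longleftrightarrow> cnt k n 0 < cnt k n y + z"

text \<open>A bracket whose left end passes and whose right end fails. Its width is 1 when
  \<open>i = n\<close>, which is the situation of \<open>canonical_of_threshold\<close>.\<close>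

definition outer :: "nat \<Rightarrow> nat \<Rightarrow> bool" where
  "outer i x \<longleftrightarrow> pass x \<and> x + k ^ (n - i) \<le> k ^ n \<and> \<not> pass (x + k ^ (n - i))"

text \<open>After \<open>c\<close> trials with step \<open>w\<close>, either all have succeeded or
  one has failed, and from then on \<open>x + w\<close> is known to fail.\<close>

definition inner :: "nat \<Rightarrow> nat \<Rightarrow> nat \<Rightarrow> nat \<Rightarrow> bool" where
  "inner x0 w c x \<longleftrightarrow> pass x \<and> x \<le> x0 + c * w \<and> (x = x0 + c * w \<or> \<not> pass (x + w))"

lemma outer_0: "outer 0 0"
proof -
  have "cnt k n (k ^ n) = 0" by (rule cnt_ge) simp
  then show ?thesis using z_pos z_le by (simp add: outer_def pass_def)
qed

lemma pow_step: "i < n \<Longrightarrow> k ^ (n - i) = k * k ^ (n - 1 - i)"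
proof -
  assume "i < n"
  then have "n - i = Suc (n - 1 - i)" by simp
  then show ?thesis by (simp only: power_Suc)
qed

text \<open>Keeps every tested threshold below \<open>k ^ n\<close>, as the locale
  \<open>threshold\<close> requires; this is where the limit of \<open>k - 1\<close> trials
  enters.\<close>

lemma inner_less:
  assumes o: "outer i x0" and i: "i < n" and c: "c < k - 1" and "inner x0 (k ^ (n - 1 - i)) c x"
  shows "x + k ^ (n - 1 - i) < k ^ n"
proof -
  let ?w = "k ^ (n - 1 - i)"
  have w: "0 < ?w" using k_pos by simp
  have "x + ?w \<le> x0 + Suc c * ?w" using assms(4) by (simp add: inner_def)
  also have "\<dots> < x0 + k * ?w" using c w by (simp del: mult_Suc)
  also have "\<dots> \<le> k ^ n" using o by (simp add: outer_def pow_step[OF i])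
  finally show ?thesis .
qed

lemma outer_Suc:
  assumes o: "outer i x0" and i: "i < n" and x: "inner x0 (k ^ (n - 1 - i)) (k - 1) x"
  shows "outer (Suc i) x"
proof -
  let ?w = "k ^ (n - 1 - i)"
  have kw: "x0 + (k - 1) * ?w + ?w = x0 + k * ?w"
    using k_pos by (cases k) auto
  have "x + ?w \<le> k ^ n"
    using o x kw by (simp add: outer_def inner_def pow_step[OF i])
  moreover have "\<not> pass (x + ?w)"
  proof (cases "x = x0 + (k - 1) * ?w")
    case True
    then have "x + ?w = x0 + k ^ (n - i)" by (simp only: kw pow_step[OF i])
    then show ?thesis using o by (simp add: outer_def)
  qed (use x in \<open>simp add: inner_def\<close>)
  moreover have "pass x" using x by (simp add: inner_def)
  moreover have e: "n - Suc i = n - 1 - i" by simp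
  ultimately show ?thesis unfolding outer_def e by blast
qed

definition ready :: "nat \<Rightarrow> state \<Rightarrow> bool" where
  "ready x s \<longleftrightarrow> threshold.pre_env n k s \<and> vars s ''z'' = int z \<and> vars s ''q0'' = int (4 * n * cnt k n 0)
    \<and> vars s ''x'' = int x \<and> arrs s ''alphabet'' = A"

text \<open>\<open>N\<close>, \<open>B\<close> and \<open>pre_env\<close> are the same for all
  thresholds, so this instance provides them for every step; it also counts all
  representatives.\<close>

sublocale zero: threshold n k 0
  by unfold_locales (use n_pos k_pos in simp_all)

lemma ready_cong:
  assumes "ready x s" "\<And>v. v \<in> {''n'', ''k'', ''z'', ''q0''} \<Longrightarrow> vars r v = vars s v"
    "vars r ''x'' = int x'" "\<And>a. a \<in> {''pw'', ''bp'', ''gcd'', ''alphabet''} \<Longrightarrow> arrs r a = arrs s a"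
  shows "ready x' r"
proof -
  have v: "vars r ''n'' = vars s ''n''" "vars r ''k'' = vars s ''k''" "vars r ''z'' = vars s ''z''"
    "vars r ''q0'' = vars s ''q0''" by (rule assms(2), simp)+
  have a: "arrs r ''pw'' = arrs s ''pw''" "arrs r ''bp'' = arrs s ''bp''" "arrs r ''gcd'' = arrs s ''gcd''"
    "arrs r ''alphabet'' = arrs s ''alphabet''" by (rule assms(4), simp)+
  show ?thesis using assms(1,3) unfolding ready_def zero.pre_env_def holds_def v a by blast
qed

lemma runs_step:
  assumes s: "ready x s" and a: "vars s ''a'' = int i" "i < n" and less: "x + k ^ (n - 1 - i) < k ^ n"
  shows "\<exists>s'. runs c_step s (40000 * (n^4*k)) s' \<and>
    ready (if pass (x + k ^ (n - 1 - i)) then x + k ^ (n - 1 - i) else x) s' \<and>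
    vars s' ''a'' = vars s ''a'' \<and> vars s' ''c'' = vars s ''c''"
proof -
  define y where "y = x + k ^ (n - 1 - i)"
  interpret y: threshold n k y
    by unfold_locales (use n_pos k_pos less in \<open>simp_all add: y_def\<close>)
  let ?s1 = "setv s ''y'' (int y)"
  have pw: "holds ''pw'' zero.N (\<lambda>j. k ^ j) s" and nk: "vars s ''n'' = int n" "vars s ''k'' = int k" "vars s ''x'' = int x"
    using s by (simp_all add: ready_def zero.pre_env_def)
  have sd: "1 \<le> n" "i \<le> n - 1" "n - 1 - i < zero.N" using a(2) by (auto simp: zero.N_def)
  have "ev (Var ''x'' \<oplus> Read ''pw'' (v_n \<ominus> Const 1 \<ominus> Var ''a'')) s y"
    unfolding y_def by (rule ev_intros nk[THEN ev_Var] a(1)[THEN ev_Var] ev_Read[OF pw] sd)+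
  then have 1: "runs (Assign ''y'' (Var ''x'' \<oplus> Read ''pw'' (v_n \<ominus> Const 1 \<ominus> Var ''a''))) s 9 ?s1"
    using runs_Assign[of "''y''" "Var ''x'' \<oplus> Read ''pw'' (v_n \<ominus> Const 1 \<ominus> Var ''a'')" s]
    by (simp add: ev_def eval_nat_numeral)
  have "y.env ?s1" using s by (simp add: ready_def zero.pre_env_def y.env_def holds_def)
  then obtain s2 where 2: "runs c_eval ?s1 (33000 * (n^4*k)) s2"
    "only ?s1 {''R'', ''del'', ''U'', ''D'', ''tr'', ''H'', ''q''} s2"
    "arrs s2 ''q'' 0 + arrs s2 ''q'' 1 = int (4 * n * cnt k n y)"
    using y.runs_eval by blast
  have v2: "vars s2 v = vars ?s1 v" if "v \<notin> {''i'', ''m'', ''acc''}" for v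
    using 2(2) that by (simp add: only_def sim_def)
  have a2: "arrs s2 b = arrs s b" if "b \<in> {''pw'', ''bp'', ''gcd'', ''alphabet''}" for b
    using that by (elim insertE emptyE) (use 2(2) in \<open>simp_all add: only_def\<close>)
  let ?t = "Less (Var ''q0'') (e_q \<oplus> Const 4 \<otimes> v_n \<otimes> Var ''z'')"
  have "bval ?t s2 \<longleftrightarrow> int (4 * n * cnt k n 0) < int (4 * n * cnt k n y) + 4 * int n * int z"
    using s 2(3) by (simp add: e_q_def v2 ready_def zero.pre_env_def)
  also have "\<dots> \<longleftrightarrow> 4 * n * cnt k n 0 < 4 * n * (cnt k n y + z)"
    unfolding of_nat_less_iff[where ?'a = int, symmetric] by (simp add: algebra_simps)
  also have "\<dots> \<longleftrightarrow> pass y" using n_pos by (simp add: pass_def)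
  finally have t: "bval ?t s2 \<longleftrightarrow> pass y" .
  let ?s3 = "if pass y then setv s2 ''x'' (int y) else s2"
  have "runs (If ?t (Assign ''x'' v_y) Skip) s2 (bcost ?t + 2 + 1) ?s3"
  proof (rule runs_If)
    assume "bval ?t s2"
    moreover have "aval v_y s2 = int y" by (simp add: v2)
    ultimately show "runs (Assign ''x'' v_y) s2 2 ?s3"
      using runs_Assign[of "''x''" v_y s2] t by (simp add: numeral_2_eq_2)
  next
    assume "\<not> bval ?t s2"
    then show "runs Skip s2 2 ?s3" using runs_mono[OF runs_Skip, of 2 s2] t by simp
  qed
  note 3 = this
  have "bcost ?t = 13" by (simp add: e_q_def)
  then have "9 + (33000 * (n^4*k) + (bcost ?t + 2 + 1)) \<le> 40000 * (n^4*k)"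
    using zero.n4k_bounds(11) by linarith
  then have "runs c_step s (40000 * (n^4*k)) ?s3"
    unfolding c_step_def by (rule runs_mono[OF runs_Seq[OF 1 runs_Seq[OF 2(1) 3]]])
  moreover have "ready (if pass y then y else x) ?s3"
  proof (rule ready_cong[OF s])
    show "vars ?s3 v = vars s v" if "v \<in> {''n'', ''k'', ''z'', ''q0''}" for v
      using that by (elim insertE emptyE) (simp_all add: v2)
    show "vars ?s3 ''x'' = int (if pass y then y else x)" using nk(3) by (simp add: v2)
    show "arrs ?s3 b = arrs s b" if "b \<in> {''pw'', ''bp'', ''gcd'', ''alphabet''}" for b
      using a2[OF that] by simp
  qed
  moreover have "vars ?s3 ''a'' = vars s ''a'' \<and> vars ?s3 ''c'' = vars s ''c''"
    by (simp add: v2)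
  ultimately show ?thesis unfolding y_def by blast
qed

lemma runs_inner:
  assumes s: "ready x0 s" and a: "vars s ''a'' = int i" "i < n" and o: "outer i x0"
  shows "\<exists>s'. runs (For ''c'' (v_k \<ominus> Const 1) c_step) s ((k - 1) * (40000 * (n^4*k) + 3 + 8) + 3 + 8) s' \<and>
    (\<exists>x. ready x s' \<and> outer (Suc i) x) \<and> vars s' ''a'' = int i"
proof -
  define w where "w = k ^ (n - 1 - i)"
  define I where "I c r \<longleftrightarrow> (\<exists>x. ready x r \<and> inner x0 w c x) \<and> vars r ''a'' = int i \<and> vars r ''c'' = int c" for c r
  have cost: "acost (v_k \<ominus> Const 1) = 3" by simp
  have "\<exists>s'. runs (For ''c'' (v_k \<ominus> Const 1) c_step) s
      ((k - 1) * (40000 * (n^4*k) + acost (v_k \<ominus> Const 1) + 8) + acost (v_k \<ominus> Const 1) + 8) s' \<and> I (k - 1) s'"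
  proof (rule runs_For)
    have "ready x0 (setv s ''c'' 0)" by (rule ready_cong[OF s]) (use s in \<open>auto simp: ready_def\<close>)
    moreover have "inner x0 w 0 x0" using o by (simp add: inner_def outer_def)
    ultimately show "I 0 (setv s ''c'' 0)" using a by (auto simp: I_def)
  next
    fix c r assume "I c r"
    then show "vars r ''c'' = int c \<and> aval (v_k \<ominus> Const 1) r = int (k - 1)"
      using k_pos by (auto simp: I_def ready_def zero.pre_env_def)
  next
    fix c r assume c: "c < k - 1" and r: "I c r"
    then obtain x where x: "ready x r" "inner x0 w c x" by (auto simp: I_def)
    let ?x = "if pass (x + w) then x + w else x"
    have "x + w < k ^ n" using inner_less[OF o a(2) c] x(2) by (simp add: w_def)
    then obtain r' where r': "runs c_step r (40000 * (n^4*k)) r'" "ready ?x r'"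
      "vars r' ''a'' = vars r ''a''" "vars r' ''c'' = vars r ''c''"
      using runs_step[OF x(1) _ a(2), folded w_def] r unfolding I_def by blast
    have "inner x0 w (Suc c) ?x" using x(2) by (auto simp: inner_def)
    moreover have "ready ?x (setv r' ''c'' (vars r' ''c'' + 1))"
      by (rule ready_cong[OF r'(2)]) (use r'(2) in \<open>auto simp: ready_def\<close>)
    ultimately show "\<exists>r'. runs c_step r (40000 * (n^4*k)) r' \<and> I (Suc c) (setv r' ''c'' (vars r' ''c'' + 1))"
      using r' r by (intro exI[of _ r']) (auto simp: I_def)
  qed
  then obtain s' x where "runs (For ''c'' (v_k \<ominus> Const 1) c_step) s
      ((k - 1) * (40000 * (n^4*k) + 3 + 8) + 3 + 8) s'"
    "ready x s'" "inner x0 w (k - 1) x" "vars s' ''a'' = int i"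
    unfolding cost I_def by blast
  then show ?thesis using outer_Suc[OF o a(2)] unfolding w_def by blast
qed

lemma runs_search:
  assumes s: "ready 0 s"
  shows "\<exists>s' x. runs c_search s (50000 * (n^5*k^2)) s' \<and> ready x s' \<and> pass x \<and> \<not> pass (x + 1)"
proof -
  define I where "I i r \<longleftrightarrow> (\<exists>x. ready x r \<and> outer i x) \<and> vars r ''a'' = int i" for i r
  let ?T = "(k - 1) * (40000 * (n^4*k) + 3 + 8) + 3 + 8"
  have "\<exists>s'. runs c_search s (n * (?T + acost v_n + 8) + acost v_n + 8) s' \<and> I n s'"
    unfolding c_search_def
  proof (rule runs_For)
    have "ready 0 (setv s ''a'' 0)" by (rule ready_cong[OF s]) (use s in \<open>auto simp: ready_def\<close>)
    then show "I 0 (setv s ''a'' 0)" using outer_0 by (auto simp: I_def)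
  next
    fix i r assume "I i r"
    then show "vars r ''a'' = int i \<and> aval v_n r = int n" by (auto simp: I_def ready_def zero.pre_env_def)
  next
    fix i r assume i: "i < n" and "I i r"
    then obtain x where x: "ready x r" "outer i x" "vars r ''a'' = int i" by (auto simp: I_def)
    from runs_inner[OF x(1,3) i x(2)] obtain r' x' where r': "runs (For ''c'' (v_k \<ominus> Const 1) c_step) r ?T r'"
      "ready x' r'" "outer (Suc i) x'" "vars r' ''a'' = int i" by blast
    have "ready x' (setv r' ''a'' (vars r' ''a'' + 1))"
      by (rule ready_cong[OF r'(2)]) (use r'(2) in \<open>auto simp: ready_def\<close>)
    then show "\<exists>r'. runs (For ''c'' (v_k \<ominus> Const 1) c_step) r ?T r' \<and> I (Suc i) (setv r' ''a'' (vars r' ''a'' + 1))"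
      using r' by (intro exI[of _ r']) (auto simp: I_def)
  qed
  then obtain s' x where s': "runs c_search s (n * (?T + acost v_n + 8) + acost v_n + 8) s'" "ready x s'" "outer n x"
    by (auto simp: I_def)
  define X where "X = n^4*k"
  have X: "1 \<le> X" "1 \<le> n" "1 \<le> k" using zero.n4k_bounds(11) n_pos k_pos by (simp_all add: X_def)
  \<comment> \<open>40011 absorbs the loop overhead 3 + 8 of each round. The 11 for leaving the loop
    is then paid by replacing \<open>k - 1\<close> by \<open>k\<close>.\<close>
  have "?T \<le> (k - 1) * (40011 * X) + 11" using X(1) unfolding X_def[symmetric] by simp
  also have "\<dots> \<le> k * (40011 * X)"
  proof -
    have "k * (40011 * X) = (k - 1) * (40011 * X) + 40011 * X" using X(3) by (cases k) auto
    then show ?thesis using X(1) by simp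
  qed
  finally have T: "?T \<le> 40011 * (k * X)" by simp
  have "1 \<le> k * X" using X by simp
  moreover have "acost v_n = 1" by simp
  ultimately have "?T + acost v_n + 8 \<le> 40020 * (k * X)" using T by linarith
  then have "n * (?T + acost v_n + 8) \<le> n * (40020 * (k * X))" by (rule mult_le_mono2)
  moreover have "1 \<le> n * (k * X)" using X by simp
  moreover have "a + acost v_n + 8 \<le> 50000 * (n * (k * X))"
    if "a \<le> n * (40020 * (k * X))" "1 \<le> n * (k * X)" for a
  proof -
    have "n * (40020 * (k * X)) = 40020 * (n * (k * X))" "acost v_n = 1" by simp_all
    then show ?thesis using that by linarith
  qed
  ultimately have "n * (?T + acost v_n + 8) + acost v_n + 8 \<le> 50000 * (n * (k * X))" by blast
  also have "n * (k * X) = n^5*k^2" by (simp add: X_def power2_eq_square eval_nat_numeral)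
  finally have "runs c_search s (50000 * (n^5*k^2)) s'" by (rule runs_mono[OF s'(1)])
  then show ?thesis using s'(2,3) by (auto simp: outer_def)
qed

text \<open>Symbols may be negative integers, so \<open>runs_Table\<close> is applied directly
  instead of its version for natural numbers.\<close>

lemma runs_out:
  assumes s: "ready x s"
  shows "\<exists>s'. runs c_out s (300 * ((n + 1) * (1 + 1))) s' \<and>
    (\<forall>j<n. arrs s' ''output'' (int j) = A (int (x div k ^ (n - 1 - j) mod k)))"
proof -
  let ?F = "\<lambda>i. A (int (x div k ^ (n - 1 - i) mod k))"
  have c: "table_const (Const 0) v_n (Const 1) always
      (Read ''alphabet'' (Var ''x'' \<oslash> Read ''pw'' (v_n \<ominus> Const 1 \<ominus> v_i) \<odot> v_k)) \<le> 300"
    by (simp add: table_const_def)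
  have pw: "holds ''pw'' zero.N (\<lambda>j. k ^ j) s" and nk: "vars s ''n'' = int n" "vars s ''k'' = int k" "vars s ''x'' = int x"
    and A: "arrs s ''alphabet'' = A"
    using s by (simp_all add: ready_def zero.pre_env_def)
  have "\<exists>s'. runs c_out s (table_const (Const 0) v_n (Const 1) always
      (Read ''alphabet'' (Var ''x'' \<oslash> Read ''pw'' (v_n \<ominus> Const 1 \<ominus> v_i) \<odot> v_k)) * ((n + 1) * (1 + 1))) s' \<and>
    filled s ''output'' 0 ?F n s'"
    unfolding c_out_def
  proof (rule runs_Table[where f = "\<lambda>i m. ?F i"])
    fix i m r assume i: "i < n" and f: "filled s ''output'' 0 ?F i r" and im: "vars r ''i'' = int i"
    have sim: "sim s r" and ar: "arrs r ''pw'' = arrs s ''pw''" "arrs r ''alphabet'' = A"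
      using f A by (simp_all add: filled_def)
    have nkr: "vars r ''n'' = int n" "vars r ''k'' = int k" "vars r ''x'' = int x"
      using sim nk by (simp_all add: sim_def)
    have pwr: "holds ''pw'' zero.N (\<lambda>j. k ^ j) r" using pw ar by (simp add: holds_def)
    have sd: "1 \<le> n" "i \<le> n - 1" "n - 1 - i < zero.N" using i by (auto simp: zero.N_def)
    have "ev (Var ''x'' \<oslash> Read ''pw'' (v_n \<ominus> Const 1 \<ominus> v_i) \<odot> v_k) r (x div k ^ (n - 1 - i) mod k)"
      by (rule ev_intros nkr[THEN ev_Var] im[THEN ev_Var] ev_Read[OF pwr] sd)+
    then show "(if bval always r then aval (Read ''alphabet'' (Var ''x'' \<oslash> Read ''pw'' (v_n \<ominus> Const 1 \<ominus> v_i) \<odot> v_k)) r else 0) = ?F i"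
      using ar(2) by (simp only: ev_def aval.simps(3) bval.simps aval.simps(1) if_True zero_less_one)
  qed (use nk in \<open>simp_all add: sim_def\<close>)
  then obtain s' where s': "runs c_out s (table_const (Const 0) v_n (Const 1) always
      (Read ''alphabet'' (Var ''x'' \<oslash> Read ''pw'' (v_n \<ominus> Const 1 \<ominus> v_i) \<odot> v_k)) * ((n + 1) * (1 + 1))) s'"
    "filled s ''output'' 0 ?F n s'" by blast
  have "runs c_out s (300 * ((n + 1) * (1 + 1))) s'"
    by (rule runs_mono[OF s'(1) mult_le_mono1[OF c]])
  then show ?thesis using s'(2) by (auto simp: filled_def)
qed

lemma runs_main:
  assumes s: "vars s ''n'' = int n" "vars s ''k'' = int k" "vars s ''z'' = int z" "vars s ''x'' = 0"
    and A: "arrs s ''alphabet'' = A"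
  shows "\<exists>s' v. runs c_main s (100000 * (n^5*k^2)) s' \<and> v \<in> canonical k n \<and>
    card {u \<in> canonical k n. val k u < val k v} = z - 1 \<and>
    (\<forall>j<n. arrs s' ''output'' (int j) = A (int (v ! j)))"
proof -
  obtain s1 where 1: "runs c_pre s (10000 * (n^4*k)) s1" "only s {''pw'', ''bp'', ''gcd''} s1" "zero.pre_env s1"
    using zero.runs_pre[OF s(1,2)] by blast
  let ?s2 = "setv s1 ''y'' 0"
  have 2: "runs (Assign ''y'' (Const 0)) s1 2 ?s2"
    using runs_Assign[of "''y''" "Const 0" s1] by (simp add: numeral_2_eq_2)
  have "zero.env ?s2" using 1(3) by (simp add: zero.pre_env_def zero.env_def holds_def)
  then obtain s3 where 3: "runs c_eval ?s2 (33000 * (n^4*k)) s3"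
    "only ?s2 {''R'', ''del'', ''U'', ''D'', ''tr'', ''H'', ''q''} s3"
    "arrs s3 ''q'' 0 + arrs s3 ''q'' 1 = int (4 * n * cnt k n 0)"
    using zero.runs_eval by blast
  let ?s4 = "setv s3 ''q0'' (int (4 * n * cnt k n 0))"
  have 4: "runs (Assign ''q0'' e_q) s3 6 ?s4"
    using runs_Assign[of "''q0''" e_q s3] 3(3) by (simp add: e_q_def eval_nat_numeral)
  have v: "vars s3 v = vars s v" if "v \<in> {''n'', ''k'', ''z'', ''x''}" for v
    using that by (elim insertE emptyE) (use 1(2) 3(2) in \<open>simp_all add: only_def sim_def\<close>)
  have a: "arrs s3 b = arrs s1 b" if "b \<in> {''pw'', ''bp'', ''gcd'', ''alphabet''}" for b
    using that by (elim insertE emptyE) (use 3(2) in \<open>simp_all add: only_def\<close>)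
  have "arrs s1 ''alphabet'' = A" using 1(2) A by (simp add: only_def)
  \<comment> \<open>The variable \<open>x\<close> still has its initial value 0, which is the
    threshold that the search starts from.\<close>
  then have "ready 0 ?s4"
    using s 1(3) v a by (simp add: ready_def zero.pre_env_def holds_def)
  then obtain s5 x where 5: "runs c_search ?s4 (50000 * (n^5*k^2)) s5" "ready x s5" "pass x" "\<not> pass (x + 1)"
    using runs_search by blast
  obtain s6 where 6: "runs c_out s5 (300 * ((n + 1) * (1 + 1))) s6"
    "\<forall>j<n. arrs s6 ''output'' (int j) = A (int (x div k ^ (n - 1 - j) mod k))"
    using runs_out[OF 5(2)] by blast
  have "n^4*k \<le> n^5*k^2"
  proof -
    have "n^4 \<le> n^5" "k^1 \<le> k^2" using n_pos k_pos by (intro power_increasing; simp)+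
    then show ?thesis using mult_le_mono[of "n^4" "n^5" "k^1" "k^2"] by simp
  qed
  moreover have "300 * ((n + 1) * (1 + 1)) \<le> 1200 * (n^4*k)" using zero.n4k_bounds(8) by simp
  ultimately have "10000 * (n^4*k) + (2 + (33000 * (n^4*k) + (6 + (50000 * (n^5*k^2) + 300 * ((n + 1) * (1 + 1))))))
      \<le> 100000 * (n^5*k^2)"
    using zero.n4k_bounds(11) by linarith
  then have run: "runs c_main s (100000 * (n^5*k^2)) s6"
    unfolding c_main_def
    by (rule runs_mono[OF runs_Seq[OF 1(1) runs_Seq[OF 2 runs_Seq[OF 3(1) runs_Seq[OF 4 runs_Seq[OF 5(1) 6(1)]]]]]])
  obtain v where v: "v \<in> canonical k n" "val k v = x" "card {u \<in> canonical k n. val k u < val k v} = z - 1"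
    using canonical_of_threshold[of k n x z] 5(3,4) unfolding pass_def by blast
  have "length v = n" "set v \<subseteq> {..<k}" using v(1) by (auto simp: canonical_def words_def)
  then have "x div k ^ (n - 1 - j) mod k = v ! j" if "j < n" for j
    using val_digit[of v k j] v(2) that by simp
  then have "\<forall>j<n. arrs s6 ''output'' (int j) = A (int (v ! j))" using 6(2) by simp
  with run v show ?thesis by blast
qed

end

theorem theorem2:
  shows "\<exists>(P :: com) (C :: real). \<forall>(\<Sigma> :: int set) (n :: nat) (z :: nat).
    finite \<Sigma> \<and> n \<ge> 1 \<and> 1 \<le> z \<and> z \<le> card (bracelets \<Sigma> n) \<longrightarrow>
    (\<exists>t s b. exec P (input_state \<Sigma> n z) t s \<and>
       is_zth_bracelet \<Sigma> n z b \<and> output_word n s = representative b \<and>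
       real t \<le> C * time_bound n (card \<Sigma>))"
proof (intro exI[of _ c_main] exI[of _ "100000 :: real"] allI impI)
  fix \<Sigma> :: "int set" and n z :: nat
  assume asm: "finite \<Sigma> \<and> n \<ge> 1 \<and> 1 \<le> z \<and> z \<le> card (bracelets \<Sigma> n)"
  then have fin: "finite \<Sigma>" and n: "0 < n" and z: "1 \<le> z" "z \<le> card (bracelets \<Sigma> n)" by auto
  define k where "k = card \<Sigma>"
  define A where "A = (\<lambda>i. if 0 \<le> i \<and> i < int k then sorted_list_of_set \<Sigma> ! nat i else 0)"
  have zc: "z \<le> cnt k n 0" using z(2) by (simp add: cnt_0 card_bracelets[OF fin] k_def)
  \<comment> \<open>Over the empty alphabet there are no words of positive length, hence no
    bracelets and no admissible \<open>z\<close>.\<close>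
  have "0 < k"
  proof (rule ccontr)
    assume "\<not> 0 < k"
    then have "canonical k n = {}" using n by (auto simp: canonical_def words_def)
    then show False using zc z(1) by (simp add: cnt_0)
  qed
  interpret search n k z A
    by unfold_locales (use n \<open>0 < k\<close> z(1) zc in simp_all)
  let ?s = "input_state \<Sigma> n z"
  obtain s' v where run: "runs c_main ?s (100000 * (n^5*k^2)) s'" and v: "v \<in> canonical k n"
    "card {u \<in> canonical k n. val k u < val k v} = z - 1"
    and out: "\<forall>j<n. arrs s' ''output'' (int j) = A (int (v ! j))"
    using runs_main[of ?s] by (auto simp: input_state_def k_def A_def)
  obtain t where t: "t \<le> 100000 * (n^5*k^2)" "exec c_main ?s t s'"
    using run by (auto simp: runs_def)
  have len: "length v = n" "set v \<subseteq> {..<k}" using v(1) by (auto simp: canonical_def words_def)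
  have "A (int (v ! j)) = sym \<Sigma> (v ! j)" if "j < n" for j
  proof -
    have "v ! j \<in> set v" using that len(1) by simp
    then have "v ! j < k" using len(2) by blast
    then show ?thesis by (simp add: A_def sym_def[OF fin])
  qed
  then have "output_word n s' = map (sym \<Sigma>) v"
    using out len(1) by (intro nth_equalityI) (simp_all add: output_word_def)
  also have "\<dots> = representative (class_of \<Sigma> n v)"
    using representative_class_of[OF fin] v(1) by (simp add: k_def)
  finally have "output_word n s' = representative (class_of \<Sigma> n v)" .
  moreover have "is_zth_bracelet \<Sigma> n z (class_of \<Sigma> n v)"
    using is_zth_class_of[OF fin _ z(1)] v by (simp add: k_def)
  moreover have "real t \<le> 100000 * time_bound n (card \<Sigma>)"
  proof -
    have "real t \<le> real (100000 * (n^5*k^2))" using t(1) by (rule of_nat_mono)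
    also have "\<dots> = 100000 * (real n ^ 5 * real k ^ 2 * 1)" by simp
    \<comment> \<open>The third factor of \<open>time_bound\<close> is at least 1, so the bound
      without a logarithm suffices.\<close>
    also have "\<dots> \<le> 100000 * (real n ^ 5 * real k ^ 2 * max 1 (log 2 (real k)))"
      by (intro mult_left_mono) simp_all
    finally show ?thesis by (simp add: time_bound_def k_def)
  qed
  ultimately show "\<exists>t s b. exec c_main ?s t s \<and> is_zth_bracelet \<Sigma> n z b \<and>
      output_word n s = representative b \<and> real t \<le> 100000 * time_bound n (card \<Sigma>)"
    using t(2) by blast
qed

end
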